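(* Suppose that $\tilde f=f+\Delta u_0\in C([0,T];H^{\hat\gamma+2m}(\Omega))$ for some $0<\hat\gamma<1/2$, that $\|\Delta^{m+2}u_0\|$ is bounded, that $\|\Delta^{m+1}\partial_t^3f(\cdot,t)\|\le Q\,t^{-\sigma}$ and $\|\Delta^m\partial_t^4f(\cdot,t)\|\le Q\,t^{-\sigma}$ for $t>0$ and some $0<\sigma<1$, that $\rho_k\in[1,1.7319]$, and that $m\ge\frac3\alpha$. Let $V^0=0$ and let $V^k$, $U^k$ ($k\ge1$) solve the time-discrete scheme $$\delta_tV^k-D_k^{1-\alpha}(\Delta V)=F^k,\quad k=1,2,\qquad \bar\delta_tV^k-D_k^{1-\alpha}(\Delta V)=F^k,\quad k\ge3,$$ $$U^k=V^k+u_0+\sum_{\ell=0}^{m-1}I_t^{(\ell+1)\alpha}\Pi_L(\Delta^\ell\tilde f)(\cdot,t_k),\quad k\ge1,$$ with homogeneous Dirichlet boundary conditions for $V^k$. Then $$\|\hat u^n-U^n\|\le\|\hat v^n-V^n\|\le Q\,\tau_n^{2+\alpha},\qquad n\ge1.$$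
   Context: Setting: $\Omega\subset\mathbb R^d$ ($1\le d\le3$) is open, bounded, with smooth boundary; $0<\alpha<1$, $T>0$, $m\in\mathbb N^+$, $L\in\mathbb N^+$; $u_0=u_0(x)$, $f=f(x,t)$ are given, $\tilde f:=f+\Delta u_0$. $\|\cdot\|$ is the $L^2(\Omega)$ norm. $\beta_\nu(t):=t^{\nu-1}/\Gamma(\nu)$, $I_t^\nu g:=\beta_\nu*g$ (convolution on $(0,t)$), and the Caputo derivative of order $\gamma\in(0,1)$ is $\partial_t^\gamma g:=\beta_{1-\gamma}*\partial_tg$. $\{\lambda_q,\phi_q\}$ are the eigenvalues and $L^2$-orthonormal eigenfunctions of the Dirichlet Laplacian $-\Delta$ on $H^2\cap H^1_0$, and $\Pi_Lg:=\sum_{q=1}^L(g,\phi_q)\phi_q$. Truncated model: $\hat v$ solves $\partial_t^\alpha\hat v-\Delta\hat v=I_t^{m\alpha}\Pi_L(\Delta^m\tilde f)$ in $\Omega\times(0,T]$, $\hat v=0$ on $\partial\Omega\times[0,T]$, $\hat v(\cdot,0)=0$; equivalently $\partial_t\hat v-\partial_t^{1-\alpha}\Delta\hat v=F:=\partial_tI_t^{(m+1)\alpha}\Pi_L(\Delta^m\tilde f)$. Moreover $\hat u:=u_0+\hat v+\sum_{\ell=0}^{m-1}I_t^{(\ell+1)\alpha}\Pi_L(\Delta^\ell\tilde f)$. Write $\hat v^k:=\hat v(\cdot,t_k)$, $\hat u^k:=\hat u(\cdot,t_k)$, $F^k:=F(\cdot,t_k)$. Time mesh: $0=t_0<t_1<\dots<t_N=T$,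 $\tau_k=t_k-t_{k-1}$ ($k\ge1$), $\rho_k=\tau_k/\tau_{k-1}$ ($k\ge2$); $n,k\le N$. L2 approximation of the Caputo derivative of order $\gamma\in(0,1)$: $D_k^\gamma w:=\int_0^{t_k}\beta_{1-\gamma}(t_k-s)\,\partial_s(\Lambda^kw)(s)\,ds$, where $\Lambda^1w$ is the linear Lagrange interpolant at $t_0,t_1$ on $(0,t_1)$, and for $k\ge2$, $\Lambda^kw=\Lambda_{2,j}w$ on $(t_{j-1},t_j)$ for $1\le j<k$ and $\Lambda^kw=\Lambda_{2,k-1}w$ on $(t_{k-1},t_k)$, with $\Lambda_{2,j}w$ the quadratic Lagrange interpolant of $w^{j-1},w^j,w^{j+1}$ at $t_{j-1},t_j,t_{j+1}$. In the scheme $\gamma=1-\alpha$. Difference operators: $\delta_kw:=w^k-w^{k-1}$, $\delta_tw^k:=\delta_kw/\tau_k$; for $k\ge3$ the variable-step BDF3 operator is $\bar\delta_tw^k:=\sum_{j=0}^2\sigma_j^{(k)}\delta_tw^{k-j}$ with $\sigma_j^{(k)}:=\sigma_j(\rho_k,\rho_{k-1})$, where $\sigma_0(y,z)=\frac{2y+1}{y+1}+\frac{yz}{yz+z+1}$, $\sigma_1(y,z)=-\frac{y}{y+1}-\frac{yz}{yz+z+1}-\frac{yz^2}{yz+z+1}\cdot\frac{y+1}{z+1}$, $\sigma_2(y,z)=\frac{yz^2}{yz+z+1}\cdot\frac{y+1}{z+1}$. $Q$ is a generic positive constant, independent of $n$ and of the time steps, possibly different at each occurrence. *)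

theory Defs
  imports "HOL-Analysis.Analysis"
begin

text \<open>
  Functions of space have type \<open>'a \<Rightarrow> real\<close> over a Euclidean space \<open>'a\<close>; functions of
  \<open>(x, t)\<close> are curried with time first, \<open>w t x\<close>.  Elements of \<open>L\<^sup>2(\<Omega>)\<close> are represented by
  functions on the whole space, of which only the almost-everywhere values on \<open>\<Omega>\<close> matter.
\<close>


subsection \<open>Smooth functions and smooth boundaries\<close>

definition partial :: "'a::euclidean_space \<Rightarrow> ('a \<Rightarrow> real) \<Rightarrow> 'a \<Rightarrow> real" where
  "partial b u x = frechet_derivative u (at x) b"

text \<open>
  Multi-indices are rendered as lists of basis vectors, the empty list giving the function itself.
\<close>

definition partials :: "'a::euclidean_space list \<Rightarrow> ('a \<Rightarrow> real) \<Rightarrow> 'a \<Rightarrow> real" where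
  "partials bs u = foldr partial bs u"

definition laplacian :: "('a::euclidean_space \<Rightarrow> real) \<Rightarrow> 'a \<Rightarrow> real" where
  "laplacian u x = (\<Sum>b\<in>Basis. partial b (partial b u) x)"

definition smooth :: "('a::euclidean_space \<Rightarrow> real) \<Rightarrow> bool" where
  "smooth u \<longleftrightarrow> (\<forall>bs. set bs \<subseteq> Basis \<longrightarrow> (\<forall>x. partials bs u differentiable (at x)))"

text \<open>
  Near every boundary point, and after a rigid motion, the set is the part of a ball lying strictly
  above the graph of a smooth function of the coordinates orthogonal to a unit vector \<open>e\<close>.
\<close>

definition smooth_boundary :: "'a::euclidean_space set \<Rightarrow> bool" where
  "smooth_boundary \<Omega> \<longleftrightarrow>
     (\<forall>z\<in>frontier \<Omega>. \<exists>r>0. \<exists>e g. norm e = 1 \<and> smooth g \<and>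
        \<Omega> \<inter> ball z r = {x \<in> ball z r. x \<bullet> e > g (x - (x \<bullet> e) *\<^sub>R e)})"

definition test_functions :: "'a::euclidean_space set \<Rightarrow> ('a \<Rightarrow> real) set" where
  "test_functions \<Omega> = {\<psi>. smooth \<psi> \<and> (\<exists>K. compact K \<and> K \<subseteq> \<Omega> \<and> (\<forall>x. x \<notin> K \<longrightarrow> \<psi> x = 0))}"


subsection \<open>The space \<open>L\<^sup>2(\<Omega>)\<close>, weak derivatives and Sobolev spaces\<close>

definition L2_space :: "'a::euclidean_space set \<Rightarrow> ('a \<Rightarrow> real) set" where
  "L2_space \<Omega> = {u \<in> borel_measurable (lebesgue_on \<Omega>). integrable (lebesgue_on \<Omega>) (\<lambda>x. (u x)\<^sup>2)}"

definition L2_inner :: "'a::euclidean_space set \<Rightarrow> ('a \<Rightarrow> real) \<Rightarrow> ('a \<Rightarrow> real) \<Rightarrow> real" where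
  "L2_inner \<Omega> u v = integral\<^sup>L (lebesgue_on \<Omega>) (\<lambda>x. u x * v x)"

definition L2_norm :: "'a::euclidean_space set \<Rightarrow> ('a \<Rightarrow> real) \<Rightarrow> real" where
  "L2_norm \<Omega> u = sqrt (L2_inner \<Omega> u u)"

definition has_weak_deriv ::
  "'a::euclidean_space set \<Rightarrow> 'a list \<Rightarrow> ('a \<Rightarrow> real) \<Rightarrow> ('a \<Rightarrow> real) \<Rightarrow> bool" where
  "has_weak_deriv \<Omega> bs u g \<longleftrightarrow> g \<in> L2_space \<Omega> \<and>
     (\<forall>\<psi>\<in>test_functions \<Omega>. L2_inner \<Omega> u (partials bs \<psi>) = (-1) ^ length bs * L2_inner \<Omega> g \<psi>)"

definition weak_deriv ::
  "'a::euclidean_space set \<Rightarrow> 'a list \<Rightarrow> ('a \<Rightarrow> real) \<Rightarrow> 'a \<Rightarrow> real" where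
  "weak_deriv \<Omega> bs u = (SOME g. has_weak_deriv \<Omega> bs u g)"

definition Sobolev :: "'a::euclidean_space set \<Rightarrow> nat \<Rightarrow> ('a \<Rightarrow> real) set" where
  "Sobolev \<Omega> k = {u \<in> L2_space \<Omega>.
     \<forall>bs. set bs \<subseteq> Basis \<and> length bs \<le> k \<longrightarrow> (\<exists>g. has_weak_deriv \<Omega> bs u g)}"

text \<open>\<open>H\<^sup>1\<^sub>0(\<Omega>)\<close> is the closure of the test functions in the \<open>H\<^sup>1\<close> norm.\<close>

definition Sobolev10 :: "'a::euclidean_space set \<Rightarrow> ('a \<Rightarrow> real) set" where
  "Sobolev10 \<Omega> = {u \<in> Sobolev \<Omega> 1. \<exists>\<psi>::nat \<Rightarrow> 'a \<Rightarrow> real. (\<forall>i. \<psi> i \<in> test_functions \<Omega>) \<and>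
     (\<lambda>i. L2_norm \<Omega> (\<lambda>x. u x - \<psi> i x)) \<longlonglongrightarrow> 0 \<and>
     (\<forall>b\<in>Basis. (\<lambda>i. L2_norm \<Omega> (\<lambda>x. weak_deriv \<Omega> [b] u x - partial b (\<psi> i) x)) \<longlonglongrightarrow> 0)}"

definition gagliardo_sq :: "'a::euclidean_space set \<Rightarrow> real \<Rightarrow> ('a \<Rightarrow> real) \<Rightarrow> ennreal" where
  "gagliardo_sq \<Omega> \<theta> g = (\<integral>\<^sup>+ x. (\<integral>\<^sup>+ y.
      ennreal ((g x - g y)\<^sup>2 / norm (x - y) powr (real DIM('a) + 2 * \<theta>))
      \<partial>lebesgue_on \<Omega>) \<partial>lebesgue_on \<Omega>)"

text \<open>
  The squared Sobolev--Slobodeckij norm of order \<open>k + \<theta>\<close>, \<open>0 < \<theta> < 1\<close>.  Counting a mixed derivative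
  once per ordering of its directions gives an equivalent norm.
\<close>

definition frac_Sobolev_sq ::
  "'a::euclidean_space set \<Rightarrow> nat \<Rightarrow> real \<Rightarrow> ('a \<Rightarrow> real) \<Rightarrow> ennreal" where
  "frac_Sobolev_sq \<Omega> k \<theta> u =
     (\<Sum>bs\<in>{bs. set bs \<subseteq> Basis \<and> length bs \<le> k}. ennreal ((L2_norm \<Omega> (weak_deriv \<Omega> bs u))\<^sup>2)) +
     (\<Sum>bs\<in>{bs. set bs \<subseteq> Basis \<and> length bs = k}. gagliardo_sq \<Omega> \<theta> (weak_deriv \<Omega> bs u))"

definition frac_Sobolev :: "'a::euclidean_space set \<Rightarrow> nat \<Rightarrow> real \<Rightarrow> ('a \<Rightarrow> real) set" where
  "frac_Sobolev \<Omega> k \<theta> = {u \<in> Sobolev \<Omega> k. frac_Sobolev_sq \<Omega> k \<theta> u < \<infinity>}"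

definition continuous_into_frac_Sobolev ::
  "'a::euclidean_space set \<Rightarrow> real set \<Rightarrow> nat \<Rightarrow> real \<Rightarrow> (real \<Rightarrow> 'a \<Rightarrow> real) \<Rightarrow> bool" where
  "continuous_into_frac_Sobolev \<Omega> S k \<theta> w \<longleftrightarrow>
     (\<forall>t\<in>S. w t \<in> frac_Sobolev \<Omega> k \<theta> \<and>
        ((\<lambda>s. frac_Sobolev_sq \<Omega> k \<theta> (\<lambda>x. w s x - w t x)) \<longlongrightarrow> 0) (at t within S))"

text \<open>Powers \<open>\<Delta>\<^sup>k\<close> of the Laplacian in the sense of distributions, with values in \<open>L\<^sup>2(\<Omega>)\<close>.\<close>

definition has_weak_lap ::
  "'a::euclidean_space set \<Rightarrow> nat \<Rightarrow> ('a \<Rightarrow> real) \<Rightarrow> ('a \<Rightarrow> real) \<Rightarrow> bool" where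
  "has_weak_lap \<Omega> k u g \<longleftrightarrow> g \<in> L2_space \<Omega> \<and>
     (\<forall>\<psi>\<in>test_functions \<Omega>. L2_inner \<Omega> u ((laplacian ^^ k) \<psi>) = L2_inner \<Omega> g \<psi>)"

definition weak_lap :: "'a::euclidean_space set \<Rightarrow> nat \<Rightarrow> ('a \<Rightarrow> real) \<Rightarrow> 'a \<Rightarrow> real" where
  "weak_lap \<Omega> k u = (SOME g. has_weak_lap \<Omega> k u g)"

definition lap_in_L2 :: "'a::euclidean_space set \<Rightarrow> nat \<Rightarrow> ('a \<Rightarrow> real) \<Rightarrow> bool" where
  "lap_in_L2 \<Omega> k u \<longleftrightarrow> u \<in> L2_space \<Omega> \<and> (\<exists>g. has_weak_lap \<Omega> k u g)"


subsection \<open>Dirichlet eigenfunctions and the spectral truncation\<close>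

text \<open>The index \<open>q\<close> starts at 1; any enumeration of the eigenpairs is allowed.\<close>

definition dirichlet_eigensystem ::
  "'a::euclidean_space set \<Rightarrow> (nat \<Rightarrow> real) \<Rightarrow> (nat \<Rightarrow> 'a \<Rightarrow> real) \<Rightarrow> bool" where
  "dirichlet_eigensystem \<Omega> lam \<phi> \<longleftrightarrow>
     (\<forall>q\<ge>1. \<phi> q \<in> Sobolev \<Omega> 2 \<inter> Sobolev10 \<Omega> \<and>
        (AE x in lebesgue_on \<Omega>. - weak_lap \<Omega> 1 (\<phi> q) x = lam q * \<phi> q x)) \<and>
     (\<forall>p\<ge>1. \<forall>q\<ge>1. L2_inner \<Omega> (\<phi> p) (\<phi> q) = (if p = q then 1 else 0)) \<and>
     (\<forall>g\<in>L2_space \<Omega>. (\<forall>q\<ge>1. L2_inner \<Omega> g (\<phi> q) = 0) \<longrightarrow> (AE x in lebesgue_on \<Omega>. g x = 0))"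

definition spectral_proj ::
  "'a::euclidean_space set \<Rightarrow> (nat \<Rightarrow> 'a \<Rightarrow> real) \<Rightarrow> nat \<Rightarrow> ('a \<Rightarrow> real) \<Rightarrow> 'a \<Rightarrow> real" where
  "spectral_proj \<Omega> \<phi> L g x = (\<Sum>q=1..L. L2_inner \<Omega> g (\<phi> q) * \<phi> q x)"


subsection \<open>Fractional calculus in time\<close>

definition frac_kernel :: "real \<Rightarrow> real \<Rightarrow> real" where
  "frac_kernel \<nu> t = t powr (\<nu> - 1) / Gamma \<nu>"

definition frac_int :: "real \<Rightarrow> (real \<Rightarrow> real) \<Rightarrow> real \<Rightarrow> real" where
  "frac_int \<nu> g t = set_lebesgue_integral lborel {0<..<t} (\<lambda>s. frac_kernel \<nu> (t - s) * g s)"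

text \<open>Time derivatives are strong derivatives of \<open>L\<^sup>2(\<Omega>)\<close>-valued functions.\<close>

definition has_L2_tderiv ::
  "'a::euclidean_space set \<Rightarrow> real set \<Rightarrow> (real \<Rightarrow> 'a \<Rightarrow> real) \<Rightarrow> ('a \<Rightarrow> real) \<Rightarrow> real \<Rightarrow> bool" where
  "has_L2_tderiv \<Omega> S w d t \<longleftrightarrow> (\<forall>s\<in>S. w s \<in> L2_space \<Omega>) \<and> d \<in> L2_space \<Omega> \<and>
     ((\<lambda>s. L2_norm \<Omega> (\<lambda>x. (w s x - w t x) / (s - t) - d x)) \<longlongrightarrow> 0) (at t within S)"

definition L2_tderiv ::
  "'a::euclidean_space set \<Rightarrow> real set \<Rightarrow> (real \<Rightarrow> 'a \<Rightarrow> real) \<Rightarrow> real \<Rightarrow> 'a \<Rightarrow> real" where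
  "L2_tderiv \<Omega> S w t = (SOME d. has_L2_tderiv \<Omega> S w d t)"

definition L2_differentiable_on ::
  "'a::euclidean_space set \<Rightarrow> real set \<Rightarrow> (real \<Rightarrow> 'a \<Rightarrow> real) \<Rightarrow> bool" where
  "L2_differentiable_on \<Omega> S w \<longleftrightarrow> (\<forall>t\<in>S. \<exists>d. has_L2_tderiv \<Omega> S w d t)"

definition L2_continuous_on ::
  "'a::euclidean_space set \<Rightarrow> real set \<Rightarrow> (real \<Rightarrow> 'a \<Rightarrow> real) \<Rightarrow> bool" where
  "L2_continuous_on \<Omega> S w \<longleftrightarrow> (\<forall>t\<in>S. w t \<in> L2_space \<Omega> \<and>
     ((\<lambda>s. L2_norm \<Omega> (\<lambda>x. w s x - w t x)) \<longlongrightarrow> 0) (at t within S))"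

text \<open>
  \<open>G\<close> is the \<open>L\<^sup>2(\<Omega>)\<close>-valued integral \<open>(\<beta>\<^sub>\<nu> * g)(t)\<close>, characterised by duality (Pettis integral),
  so that nothing depends on the representatives chosen for the classes \<open>g s\<close>.
\<close>

definition has_L2_frac_int ::
  "'a::euclidean_space set \<Rightarrow> real \<Rightarrow> (real \<Rightarrow> 'a \<Rightarrow> real) \<Rightarrow> real \<Rightarrow> ('a \<Rightarrow> real) \<Rightarrow> bool" where
  "has_L2_frac_int \<Omega> \<nu> g t G \<longleftrightarrow> G \<in> L2_space \<Omega> \<and>
     (\<forall>w\<in>L2_space \<Omega>.
        set_integrable lborel {0<..<t} (\<lambda>s. frac_kernel \<nu> (t - s) * L2_inner \<Omega> (g s) w) \<and>
        L2_inner \<Omega> G w = frac_int \<nu> (\<lambda>s. L2_inner \<Omega> (g s) w) t)"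

definition has_L2_caputo ::
  "'a::euclidean_space set \<Rightarrow> real \<Rightarrow> real \<Rightarrow> (real \<Rightarrow> 'a \<Rightarrow> real) \<Rightarrow> real \<Rightarrow> ('a \<Rightarrow> real) \<Rightarrow> bool" where
  "has_L2_caputo \<Omega> T \<gamma> w t G \<longleftrightarrow> L2_differentiable_on \<Omega> {0<..T} w \<and>
     has_L2_frac_int \<Omega> (1 - \<gamma>) (L2_tderiv \<Omega> {0<..T} w) t G"


subsection \<open>The truncated model\<close>

definition f_tilde ::
  "'a::euclidean_space set \<Rightarrow> ('a \<Rightarrow> real) \<Rightarrow> (real \<Rightarrow> 'a \<Rightarrow> real) \<Rightarrow> real \<Rightarrow> 'a \<Rightarrow> real" where
  "f_tilde \<Omega> u0 f t x = f t x + weak_lap \<Omega> 1 u0 x"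

text \<open>\<open>proj_source \<Omega> \<phi> L \<nu> l g t x\<close> is \<open>I\<^sub>t\<^sup>\<nu> \<Pi>\<^sub>L(\<Delta>\<^sup>l g)\<close>; it is a finite combination of the \<open>\<phi> q\<close>,
  so the time integral and the time derivative below may be taken pointwise in \<open>x\<close>.\<close>

definition proj_source ::
  "'a::euclidean_space set \<Rightarrow> (nat \<Rightarrow> 'a \<Rightarrow> real) \<Rightarrow> nat \<Rightarrow> real \<Rightarrow> nat \<Rightarrow> (real \<Rightarrow> 'a \<Rightarrow> real) \<Rightarrow>
     real \<Rightarrow> 'a \<Rightarrow> real" where
  "proj_source \<Omega> \<phi> L \<nu> l g t x = frac_int \<nu> (\<lambda>s. spectral_proj \<Omega> \<phi> L (weak_lap \<Omega> l (g s)) x) t"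

definition truncated_solution ::
  "'a::euclidean_space set \<Rightarrow> real \<Rightarrow> real \<Rightarrow> nat \<Rightarrow> nat \<Rightarrow> (nat \<Rightarrow> 'a \<Rightarrow> real) \<Rightarrow>
     (real \<Rightarrow> 'a \<Rightarrow> real) \<Rightarrow> (real \<Rightarrow> 'a \<Rightarrow> real) \<Rightarrow> bool" where
  "truncated_solution \<Omega> T \<alpha> m L \<phi> g v \<longleftrightarrow>
     L2_continuous_on \<Omega> {0..T} v \<and>
     (AE x in lebesgue_on \<Omega>. v 0 x = 0) \<and>
     (\<forall>t\<in>{0<..T}. v t \<in> Sobolev \<Omega> 2 \<inter> Sobolev10 \<Omega> \<and>
        (\<exists>G. has_L2_caputo \<Omega> T \<alpha> v t G \<and>
           (AE x in lebesgue_on \<Omega>.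
              G x - weak_lap \<Omega> 1 (v t) x = proj_source \<Omega> \<phi> L (real m * \<alpha>) m g t x)))"

definition correction ::
  "'a::euclidean_space set \<Rightarrow> real \<Rightarrow> nat \<Rightarrow> nat \<Rightarrow> (nat \<Rightarrow> 'a \<Rightarrow> real) \<Rightarrow> (real \<Rightarrow> 'a \<Rightarrow> real) \<Rightarrow>
     real \<Rightarrow> 'a \<Rightarrow> real" where
  "correction \<Omega> \<alpha> m L \<phi> g t x = (\<Sum>l<m. proj_source \<Omega> \<phi> L (real (l + 1) * \<alpha>) l g t x)"

definition u_hat ::
  "'a::euclidean_space set \<Rightarrow> real \<Rightarrow> nat \<Rightarrow> nat \<Rightarrow> (nat \<Rightarrow> 'a \<Rightarrow> real) \<Rightarrow> (real \<Rightarrow> 'a \<Rightarrow> real) \<Rightarrow>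
     ('a \<Rightarrow> real) \<Rightarrow> (real \<Rightarrow> 'a \<Rightarrow> real) \<Rightarrow> real \<Rightarrow> 'a \<Rightarrow> real" where
  "u_hat \<Omega> \<alpha> m L \<phi> g u0 v t x = u0 x + v t x + correction \<Omega> \<alpha> m L \<phi> g t x"

text \<open>The source \<open>F = \<partial>\<^sub>t I\<^sub>t\<^bsup>(m+1)\<alpha>\<^esup> \<Pi>\<^sub>L(\<Delta>\<^sup>m g)\<close>; the derivative at \<open>T\<close> is one-sided.\<close>

definition source_F ::
  "'a::euclidean_space set \<Rightarrow> real \<Rightarrow> real \<Rightarrow> nat \<Rightarrow> nat \<Rightarrow> (nat \<Rightarrow> 'a \<Rightarrow> real) \<Rightarrow>
     (real \<Rightarrow> 'a \<Rightarrow> real) \<Rightarrow> real \<Rightarrow> 'a \<Rightarrow> real" where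
  "source_F \<Omega> T \<alpha> m L \<phi> g t x =
     vector_derivative (\<lambda>s. proj_source \<Omega> \<phi> L (real (m + 1) * \<alpha>) m g s x) (at t within {0..T})"


subsection \<open>Time mesh and difference operators\<close>

definition time_mesh :: "real \<Rightarrow> nat \<Rightarrow> (nat \<Rightarrow> real) \<Rightarrow> bool" where
  "time_mesh T N t \<longleftrightarrow> t 0 = 0 \<and> t N = T \<and> (\<forall>k<N. t k < t (Suc k))"

definition step :: "(nat \<Rightarrow> real) \<Rightarrow> nat \<Rightarrow> real" where
  "step t k = t k - t (k - 1)"

definition ratio :: "(nat \<Rightarrow> real) \<Rightarrow> nat \<Rightarrow> real" where
  "ratio t k = step t k / step t (k - 1)"

definition lagrange1 :: "(nat \<Rightarrow> real) \<Rightarrow> (nat \<Rightarrow> real) \<Rightarrow> real \<Rightarrow> real" where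
  "lagrange1 t w s = w 0 * (s - t 1) / (t 0 - t 1) + w 1 * (s - t 0) / (t 1 - t 0)"

definition lagrange2 :: "(nat \<Rightarrow> real) \<Rightarrow> nat \<Rightarrow> (nat \<Rightarrow> real) \<Rightarrow> real \<Rightarrow> real" where
  "lagrange2 t j w s =
     w (j - 1) * ((s - t j) * (s - t (j + 1))) / ((t (j - 1) - t j) * (t (j - 1) - t (j + 1))) +
     w j * ((s - t (j - 1)) * (s - t (j + 1))) / ((t j - t (j - 1)) * (t j - t (j + 1))) +
     w (j + 1) * ((s - t (j - 1)) * (s - t j)) / ((t (j + 1) - t (j - 1)) * (t (j + 1) - t j))"

text \<open>For \<open>s\<close> in \<open>(t\<^sub>j\<^sub>-\<^sub>1, t\<^sub>j)\<close> the \<open>LEAST\<close> below is \<open>j\<close>, and \<open>min\<close> selects the last stencil when \<open>j = k\<close>.\<close>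

definition interpolant :: "(nat \<Rightarrow> real) \<Rightarrow> nat \<Rightarrow> (nat \<Rightarrow> real) \<Rightarrow> real \<Rightarrow> real" where
  "interpolant t k w s =
     (if k = 1 then lagrange1 t w s else lagrange2 t (min (LEAST j. s \<le> t j) (k - 1)) w s)"

definition caputo_L2 :: "(nat \<Rightarrow> real) \<Rightarrow> real \<Rightarrow> nat \<Rightarrow> (nat \<Rightarrow> real) \<Rightarrow> real" where
  "caputo_L2 t \<gamma> k w = set_lebesgue_integral lborel {0<..<t k}
     (\<lambda>s. frac_kernel (1 - \<gamma>) (t k - s) * deriv (interpolant t k w) s)"

definition diff_quot :: "(nat \<Rightarrow> real) \<Rightarrow> (nat \<Rightarrow> real) \<Rightarrow> nat \<Rightarrow> real" where
  "diff_quot t w k = (w k - w (k - 1)) / step t k"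

definition sigma0 :: "real \<Rightarrow> real \<Rightarrow> real" where
  "sigma0 y z = (2 * y + 1) / (y + 1) + y * z / (y * z + z + 1)"

definition sigma1 :: "real \<Rightarrow> real \<Rightarrow> real" where
  "sigma1 y z = - y / (y + 1) - y * z / (y * z + z + 1)
     - y * z\<^sup>2 / (y * z + z + 1) * ((y + 1) / (z + 1))"

definition sigma2 :: "real \<Rightarrow> real \<Rightarrow> real" where
  "sigma2 y z = y * z\<^sup>2 / (y * z + z + 1) * ((y + 1) / (z + 1))"

definition bdf3 :: "(nat \<Rightarrow> real) \<Rightarrow> (nat \<Rightarrow> real) \<Rightarrow> nat \<Rightarrow> real" where
  "bdf3 t w k =
     sigma0 (ratio t k) (ratio t (k - 1)) * diff_quot t w k +
     sigma1 (ratio t k) (ratio t (k - 1)) * diff_quot t w (k - 1) +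
     sigma2 (ratio t k) (ratio t (k - 1)) * diff_quot t w (k - 2)"


subsection \<open>The time-discrete scheme\<close>

definition scheme_V ::
  "'a::euclidean_space set \<Rightarrow> real \<Rightarrow> real \<Rightarrow> nat \<Rightarrow> nat \<Rightarrow> (nat \<Rightarrow> 'a \<Rightarrow> real) \<Rightarrow>
     (real \<Rightarrow> 'a \<Rightarrow> real) \<Rightarrow> nat \<Rightarrow> (nat \<Rightarrow> real) \<Rightarrow> (nat \<Rightarrow> 'a \<Rightarrow> real) \<Rightarrow> bool" where
  "scheme_V \<Omega> T \<alpha> m L \<phi> g N t V \<longleftrightarrow>
     (AE x in lebesgue_on \<Omega>. V 0 x = 0) \<and>
     (\<forall>k\<in>{1..N}. V k \<in> Sobolev \<Omega> 2 \<inter> Sobolev10 \<Omega> \<and>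
        (AE x in lebesgue_on \<Omega>.
           (if k \<le> 2 then diff_quot t (\<lambda>j. V j x) k else bdf3 t (\<lambda>j. V j x) k)
           - caputo_L2 t (1 - \<alpha>) k (\<lambda>j. weak_lap \<Omega> 1 (V j) x)
           = source_F \<Omega> T \<alpha> m L \<phi> g (t k) x))"

definition scheme_U ::
  "'a::euclidean_space set \<Rightarrow> real \<Rightarrow> nat \<Rightarrow> nat \<Rightarrow> (nat \<Rightarrow> 'a \<Rightarrow> real) \<Rightarrow> (real \<Rightarrow> 'a \<Rightarrow> real) \<Rightarrow>
     ('a \<Rightarrow> real) \<Rightarrow> nat \<Rightarrow> (nat \<Rightarrow> real) \<Rightarrow> (nat \<Rightarrow> 'a \<Rightarrow> real) \<Rightarrow> (nat \<Rightarrow> 'a \<Rightarrow> real) \<Rightarrow> bool" where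
  "scheme_U \<Omega> \<alpha> m L \<phi> g u0 N t V U \<longleftrightarrow>
     (\<forall>k\<in>{1..N}. AE x in lebesgue_on \<Omega>.
        U k x = V k x + u0 x + correction \<Omega> \<alpha> m L \<phi> g (t k) x)"

end

(*
  Expand everything in the Dirichlet eigenfunctions. The coefficients of both solutions above the
  truncation level vanish, so only finitely many scalar fractional equations remain and the constant
  may depend on their eigenvalues.

  Regularity: a coefficient y solves y + lam I^alpha y = I^((m+1) alpha) g with g continuous.
  Substituting the equation into itself and using the semigroup law gives y = I^((m+1) alpha) h with h
  bounded. As (m+1) alpha >= 3 + alpha, y has three derivatives vanishing at 0, the third one
  alpha-Hoelder. This suffices for the consistency order 2 + alpha of every part of the scheme; the
  BDF3 formula is the derivative of the cubic Newton interpolant, and interpolation errors are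
  controlled by Rolle's theorem. Away from the last cell the L2 error is integrated by parts and the
  resulting kernel differences telescope.

  Stability: in terms of the difference quotients d_k the scheme is a three-term recursion with a
  weakly singular memory term. Two BDF3 steps contract the maximum norm for ratios in [1, 1.7319].
  While the steps are small, the memory term is a small perturbation in the norm weighted by
  exp (- omega t). Once a step is large, so are all later ones; there the nonnegative diagonal
  coefficient of the memory term allows a bounded growth per step, and only a bounded number of such
  steps fits into [0, T].
*)

theory Submission
  imports Defs
begin

subsection \<open>Square-integrable functions, weak Laplacians and Dirichlet eigenfunctions\<close>

text \<open>Ratios of at least 1 serve two purposes: the current step is the largest so far, so all
  earlier residuals are bounded by a power of \<open>step t n\<close>, and a small step implies that
  all steps before it are small. The order \<open>2 + \<alpha>\<close> is an interpolation error of
  size \<open>c ^ 3\<close> times the kernel value of size \<open>c powr (\<alpha> - 1)\<close> one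
  step away from the singularity. The two starting steps are only backward differences, but cost no
  order: the vanishing data at 0 give \<open>y1 s = O(s powr (2 + \<alpha>))\<close>, and
  \<open>t k \<le> 2 * step t k\<close> for \<open>k \<le> 2\<close>. In the stability proof no
  constant may depend on the mesh, while two BDF3 steps contract only by 0.98; the memory term has
  to fit into the remaining 0.02, and this fixes the exponential weight. In space every identity is
  tested against eigenfunctions or test functions, because \<open>weak_lap\<close> and
  \<open>weak_deriv\<close> are arbitrary choices of representatives and satisfy no pointwise
  algebra.\<close>

lemma L2_integrable_mult:
  assumes "u \<in> L2_space \<Omega>" "v \<in> L2_space \<Omega>"
  shows "integrable (lebesgue_on \<Omega>) (\<lambda>x. u x * v x)"
proof (rule Bochner_Integration.integrable_bound)
  show "integrable (lebesgue_on \<Omega>) (\<lambda>x. (u x)\<^sup>2 + (v x)\<^sup>2)"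
    using assms by (auto simp: L2_space_def)
  show "(\<lambda>x. u x * v x) \<in> borel_measurable (lebesgue_on \<Omega>)"
    using assms by (auto simp: L2_space_def)
  have "\<bar>a * b\<bar> \<le> \<bar>a\<^sup>2 + b\<^sup>2\<bar>" for a b :: real
  proof -
    have "2 * \<bar>a * b\<bar> \<le> a\<^sup>2 + b\<^sup>2"
      using sum_squares_bound[of "\<bar>a\<bar>" "\<bar>b\<bar>"] by (simp add: abs_mult)
    then show ?thesis by linarith
  qed
  then show "AE x in lebesgue_on \<Omega>. norm (u x * v x) \<le> norm ((u x)\<^sup>2 + (v x)\<^sup>2)"
    by simp
qed

lemma L2_space_add:
  assumes "u \<in> L2_space \<Omega>" "v \<in> L2_space \<Omega>"
  shows "(\<lambda>x. u x + v x) \<in> L2_space \<Omega>"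
proof -
  have "integrable (lebesgue_on \<Omega>) (\<lambda>x. (u x)\<^sup>2 + 2 * (u x * v x) + (v x)\<^sup>2)"
    using assms L2_integrable_mult[OF assms] by (auto simp: L2_space_def)
  then show ?thesis
    using assms by (auto simp: L2_space_def power2_sum algebra_simps)
qed

lemma L2_space_cmult: "u \<in> L2_space \<Omega> \<Longrightarrow> (\<lambda>x. c * u x) \<in> L2_space \<Omega>"
  by (auto simp: L2_space_def power_mult_distrib)

lemma L2_space_diff:
  assumes "u \<in> L2_space \<Omega>" "v \<in> L2_space \<Omega>"
  shows "(\<lambda>x. u x - v x) \<in> L2_space \<Omega>"
  using L2_space_add[OF assms(1) L2_space_cmult[OF assms(2), of "-1"]] by simp

lemma L2_space_zero: "(\<lambda>x. 0) \<in> L2_space \<Omega>"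
  by (auto simp: L2_space_def)

lemma L2_space_sum:
  assumes "\<And>i. i \<in> I \<Longrightarrow> u i \<in> L2_space \<Omega>"
  shows "(\<lambda>x. \<Sum>i\<in>I. u i x) \<in> L2_space \<Omega>"
  using assms
  by (induction I rule: infinite_finite_induct) (auto intro: L2_space_add L2_space_zero)

lemma L2_inner_commute: "L2_inner \<Omega> u v = L2_inner \<Omega> v u"
  by (simp add: L2_inner_def mult.commute)

lemma L2_inner_add_left:
  assumes "u \<in> L2_space \<Omega>" "v \<in> L2_space \<Omega>" "w \<in> L2_space \<Omega>"
  shows "L2_inner \<Omega> (\<lambda>x. u x + v x) w = L2_inner \<Omega> u w + L2_inner \<Omega> v w"
  using L2_integrable_mult[OF assms(1,3)] L2_integrable_mult[OF assms(2,3)]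
  by (simp add: L2_inner_def distrib_right)

lemma L2_inner_diff_left:
  assumes "u \<in> L2_space \<Omega>" "v \<in> L2_space \<Omega>" "w \<in> L2_space \<Omega>"
  shows "L2_inner \<Omega> (\<lambda>x. u x - v x) w = L2_inner \<Omega> u w - L2_inner \<Omega> v w"
  using L2_integrable_mult[OF assms(1,3)] L2_integrable_mult[OF assms(2,3)]
  by (simp add: L2_inner_def left_diff_distrib)

lemma L2_inner_cmult_left: "L2_inner \<Omega> (\<lambda>x. c * u x) w = c * L2_inner \<Omega> u w"
  by (simp add: L2_inner_def mult.assoc)

lemma L2_inner_sum_left:
  assumes "\<And>i. i \<in> I \<Longrightarrow> u i \<in> L2_space \<Omega>" "w \<in> L2_space \<Omega>"
  shows "L2_inner \<Omega> (\<lambda>x. \<Sum>i\<in>I. u i x) w = (\<Sum>i\<in>I. L2_inner \<Omega> (u i) w)"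
  using assms(1) L2_integrable_mult[OF assms]
  by (simp add: L2_inner_def sum_distrib_right)

lemma L2_inner_cong_AE:
  assumes "u \<in> L2_space \<Omega>" "v \<in> L2_space \<Omega>" "w \<in> L2_space \<Omega>"
    and "AE x in lebesgue_on \<Omega>. u x = v x"
  shows "L2_inner \<Omega> u w = L2_inner \<Omega> v w"
  unfolding L2_inner_def
proof (rule integral_cong_AE)
  show "AE x in lebesgue_on \<Omega>. u x * w x = v x * w x"
    using assms(4) by eventually_elim simp
qed (use assms in \<open>auto simp: L2_space_def\<close>)

lemma L2_inner_self_nonneg: "0 \<le> L2_inner \<Omega> u u"
  by (simp add: L2_inner_def)

lemma L2_norm_nonneg: "0 \<le> L2_norm \<Omega> u"
  by (simp add: L2_norm_def L2_inner_self_nonneg)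

lemma L2_norm_power2: "(L2_norm \<Omega> u)\<^sup>2 = L2_inner \<Omega> u u"
  by (simp add: L2_norm_def L2_inner_self_nonneg)

text \<open>The polynomial \<open>a - 2 * t * b + t\<^sup>2 * c\<close> is the squared norm of
  \<open>u - t v\<close>, hence nonnegative for every \<open>t\<close>. Its value at the minimiser
  \<open>b / c\<close> gives the inequality; for \<open>c = 0\<close> it is affine in
  \<open>t\<close> and its slope has to vanish.\<close>

lemma L2_Cauchy_Schwarz:
  assumes u: "u \<in> L2_space \<Omega>" and v: "v \<in> L2_space \<Omega>"
  shows "\<bar>L2_inner \<Omega> u v\<bar> \<le> L2_norm \<Omega> u * L2_norm \<Omega> v"
proof -
  define a b c where "a = L2_inner \<Omega> u u" and "b = L2_inner \<Omega> u v" and "c = L2_inner \<Omega> v v"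
  have "0 \<le> a - 2 * t * b + t\<^sup>2 * c" for t
  proof -
    have tv: "(\<lambda>x. t * v x) \<in> L2_space \<Omega>" by (rule L2_space_cmult[OF v])
    have d: "(\<lambda>x. u x - t * v x) \<in> L2_space \<Omega>" by (rule L2_space_diff[OF u tv])
    have "L2_inner \<Omega> (\<lambda>x. u x - t * v x) (\<lambda>x. u x - t * v x)
        = L2_inner \<Omega> u (\<lambda>x. u x - t * v x) - t * L2_inner \<Omega> v (\<lambda>x. u x - t * v x)"
      by (simp add: L2_inner_diff_left[OF u tv d] L2_inner_cmult_left)
    also have "\<dots> = a - 2 * t * b + t\<^sup>2 * c"
      by (simp add: L2_inner_commute[of _ _ "\<lambda>x. u x - t * v x"] L2_inner_diff_left[OF u tv]
          u v L2_inner_cmult_left a_def b_def c_def L2_inner_commute[of _ v u]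
          algebra_simps power2_eq_square)
    finally show ?thesis using L2_inner_self_nonneg by metis
  qed note quad = this
  have c0: "0 \<le> c" "0 \<le> a" by (simp_all add: a_def c_def L2_inner_self_nonneg)
  have "b\<^sup>2 \<le> a * c"
  proof (cases "c = 0")
    case True
    have "b = 0"
    proof (rule ccontr)
      assume "b \<noteq> 0"
      \<comment> \<open>At this point the affine expression equals -1.\<close>
      then show False using quad[of "(a + 1) / (2 * b)"] True by (simp add: field_simps)
    qed
    then show ?thesis using c0 by simp
  next
    case False
    then have "0 < c" using c0 by simp
    then show ?thesis using quad[of "b / c"] by (simp add: field_simps power2_eq_square)
  qed
  then have "sqrt (b\<^sup>2) \<le> sqrt (a * c)" by (rule real_sqrt_le_mono)
  then show ?thesis by (simp add: L2_norm_def a_def b_def c_def real_sqrt_mult)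
qed

lemma L2_inner_tendsto:
  assumes "u \<in> L2_space \<Omega>" "v \<in> L2_space \<Omega>" "\<And>i. \<psi> i \<in> L2_space \<Omega>"
    and lim: "((\<lambda>i. L2_norm \<Omega> (\<lambda>x. v x - \<psi> i x)) \<longlongrightarrow> 0) F"
  shows "((\<lambda>i. L2_inner \<Omega> u (\<psi> i)) \<longlongrightarrow> L2_inner \<Omega> u v) F"
proof -
  have "((\<lambda>i. L2_norm \<Omega> (\<lambda>x. v x - \<psi> i x) * L2_norm \<Omega> u) \<longlongrightarrow> 0 * L2_norm \<Omega> u) F"
    by (intro tendsto_intros lim)
  then have "((\<lambda>i. L2_inner \<Omega> u (\<psi> i) - L2_inner \<Omega> u v) \<longlongrightarrow> 0) F"
  proof (rule Lim_null_comparison[rotated, OF tendsto_eq_rhs])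
    show "\<forall>\<^sub>F i in F. norm (L2_inner \<Omega> u (\<psi> i) - L2_inner \<Omega> u v)
        \<le> L2_norm \<Omega> (\<lambda>x. v x - \<psi> i x) * L2_norm \<Omega> u"
    proof (intro always_eventually allI)
      fix i
      have "L2_inner \<Omega> u (\<psi> i) - L2_inner \<Omega> u v = - L2_inner \<Omega> (\<lambda>x. v x - \<psi> i x) u"
        using L2_inner_diff_left[of v \<Omega> "\<psi> i" u] assms by (simp add: L2_inner_commute)
      then show "norm (L2_inner \<Omega> u (\<psi> i) - L2_inner \<Omega> u v)
          \<le> L2_norm \<Omega> (\<lambda>x. v x - \<psi> i x) * L2_norm \<Omega> u"
        using L2_Cauchy_Schwarz[OF L2_space_diff[OF assms(2,3)] assms(1)] by simp
    qed
  qed simp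
  then show ?thesis by (simp add: LIM_zero_iff)
qed

section \<open>Test functions and iterated Laplacians\<close>

lemma partials_Nil [simp]: "partials [] u = u"
  by (simp add: partials_def)

lemma partials_Cons [simp]: "partials (b # bs) u = partial b (partials bs u)"
  by (simp add: partials_def)

lemma partials_append: "partials (as @ bs) u = partials as (partials bs u)"
  by (simp add: partials_def)

lemma smooth_partials: "smooth \<psi> \<Longrightarrow> set bs \<subseteq> Basis \<Longrightarrow> smooth (partials bs \<psi>)"
  unfolding smooth_def by (metis partials_append set_append Un_subset_iff)

lemma smooth_differentiable: "smooth \<psi> \<Longrightarrow> \<psi> differentiable (at x)"
  unfolding smooth_def by (metis partials_Nil empty_subsetI list.set(1))

text \<open>The complement of \<open>K\<close> is open, so \<open>\<psi>\<close> vanishes in a whole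
  neighbourhood of \<open>x\<close> and its derivative there is zero. Iterating this keeps the
  support of all partial derivatives inside the same compact set.\<close>

lemma partial_zero_outside:
  assumes "closed K" "\<And>x. x \<notin> K \<Longrightarrow> \<psi> x = 0" "x \<notin> K"
  shows "partial b \<psi> x = 0"
proof -
  have "((\<lambda>x. 0) has_derivative (\<lambda>x. 0)) (at x)" by simp
  then have "(\<psi> has_derivative (\<lambda>x. 0)) (at x)"
    by (rule has_derivative_transform_within_open[of _ _ _ _ "- K"]) (use assms in auto)
  then have "frechet_derivative \<psi> (at x) = (\<lambda>x. 0)"
    by (metis frechet_derivative_at)
  then show ?thesis by (simp add: partial_def)
qed

lemma test_functions_partials:
  assumes "\<psi> \<in> test_functions \<Omega>" "set bs \<subseteq> Basis"
  shows "partials bs \<psi> \<in> test_functions \<Omega>"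
proof -
  obtain K where K: "compact K" "K \<subseteq> \<Omega>" "\<And>x. x \<notin> K \<Longrightarrow> \<psi> x = 0" and sm: "smooth \<psi>"
    using assms(1) by (auto simp: test_functions_def)
  have "partials bs \<psi> x = 0" if "x \<notin> K" for x
    using that
  proof (induction bs arbitrary: x)
    case (Cons b bs)
    show ?case
      using partial_zero_outside[OF compact_imp_closed[OF K(1)] Cons.IH Cons.prems] by simp
  qed (use K in auto)
  then show ?thesis
    using K smooth_partials[OF sm assms(2)] by (auto simp: test_functions_def)
qed

lemma test_functions_L2:
  fixes \<Omega> :: "'a::euclidean_space set"
  assumes "open \<Omega>" "\<psi> \<in> test_functions \<Omega>"
  shows "\<psi> \<in> L2_space \<Omega>"
proof -
  obtain K where K: "compact K" "K \<subseteq> \<Omega>" "\<And>x. x \<notin> K \<Longrightarrow> \<psi> x = 0" and sm: "smooth \<psi>"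
    using assms(2) by (auto simp: test_functions_def)
  have cont: "continuous_on UNIV \<psi>"
    using smooth_differentiable[OF sm]
    by (simp add: continuous_at_imp_continuous_on differentiable_imp_continuous_within)
  then have meas: "\<psi> \<in> borel_measurable borel"
    by (rule borel_measurable_continuous_onI)
  have "integrable lborel (\<lambda>x. indicator K x *\<^sub>R (\<psi> x)\<^sup>2)"
    by (rule borel_integrable_compact[OF K(1)]) (intro continuous_intros continuous_on_subset[OF cont], auto)
  moreover have "(\<lambda>x. indicator K x *\<^sub>R (\<psi> x)\<^sup>2) = (\<lambda>x. indicator \<Omega> x *\<^sub>R (\<psi> x)\<^sup>2)"
    using K by (auto simp: fun_eq_iff indicator_def)
  ultimately have "integrable lborel (\<lambda>x. indicator \<Omega> x *\<^sub>R (\<psi> x)\<^sup>2)" by simp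
  then have "integrable lebesgue (\<lambda>x. indicator \<Omega> x *\<^sub>R (\<psi> x)\<^sup>2)"
    by (subst integrable_completion) (use assms(1) meas in \<open>auto simp: borel_measurable_integrable\<close>)
  then have "integrable (lebesgue_on \<Omega>) (\<lambda>x. (\<psi> x)\<^sup>2)"
    using assms(1) by (subst integrable_restrict_space) auto
  moreover have "\<psi> \<in> borel_measurable (lebesgue_on \<Omega>)"
    using meas by (intro measurable_restrict_space1 measurable_completion) auto
  ultimately show ?thesis by (simp add: L2_space_def)
qed

lemma partial_sum:
  assumes "\<And>i. i \<in> I \<Longrightarrow> u i differentiable (at x)"
  shows "partial b (\<lambda>x. \<Sum>i\<in>I. u i x) x = (\<Sum>i\<in>I. partial b (u i) x)"
proof -
  have "((\<lambda>x. \<Sum>i\<in>I. u i x) has_derivative (\<lambda>h. \<Sum>i\<in>I. frechet_derivative (u i) (at x) h)) (at x)"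
    using assms by (intro has_derivative_sum) (simp add: frechet_derivative_works)
  then show ?thesis
    unfolding partial_def by (metis frechet_derivative_at)
qed

text \<open>The multi-indices in the expansion of the \<open>k\<close>-th power of the Laplacian.
  Ordered choices of \<open>k\<close> directions are listed separately, so the expansion carries no
  multinomial coefficients; each direction occurs twice in a row, which makes the length
  even.\<close>

primrec doubled_lists :: "nat \<Rightarrow> 'a::euclidean_space list set" where
  "doubled_lists 0 = {[]}"
| "doubled_lists (Suc k) = (\<lambda>(b, bs). b # b # bs) ` (Basis \<times> doubled_lists k)"

lemma doubled_lists_basis: "bs \<in> doubled_lists k \<Longrightarrow> set bs \<subseteq> Basis \<and> length bs = 2 * k"
  by (induction k arbitrary: bs) (simp, fastforce)

lemma laplacian_power_eq:
  assumes "smooth \<psi>"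
  shows "(laplacian ^^ k) \<psi> = (\<lambda>x. \<Sum>bs\<in>doubled_lists k. partials bs \<psi> x)"
proof (induction k)
  case (Suc k)
  have diff: "partials cs \<psi> differentiable (at x)" if "set cs \<subseteq> Basis" for cs x
    using assms that by (auto simp: smooth_def)
  have *: "laplacian (\<lambda>x. \<Sum>bs\<in>doubled_lists k. partials bs \<psi> x) x
      = (\<Sum>bs\<in>doubled_lists (Suc k). partials bs \<psi> x)" for x
  proof -
    have 1: "partial b (\<lambda>x. \<Sum>bs\<in>doubled_lists k. partials bs \<psi> x)
        = (\<lambda>x. \<Sum>bs\<in>doubled_lists k. partials (b # bs) \<psi> x)" for b
      using partial_sum[of "doubled_lists k" "\<lambda>bs. partials bs \<psi>"] diff doubled_lists_basis
      by (fastforce simp: fun_eq_iff)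
    have 2: "partial b (\<lambda>x. \<Sum>bs\<in>doubled_lists k. partials (b # bs) \<psi> x) x
        = (\<Sum>bs\<in>doubled_lists k. partials (b # b # bs) \<psi> x)" if "b \<in> Basis" for b
    proof -
      have "partials (b # bs) \<psi> differentiable (at x)" if "bs \<in> doubled_lists k" for bs
        using diff[of "b # bs"] doubled_lists_basis[OF that] \<open>b \<in> Basis\<close> by simp
      then show ?thesis
        using partial_sum[of "doubled_lists k" "\<lambda>bs. partials (b # bs) \<psi>"] by simp
    qed
    have inj: "inj_on (\<lambda>(b, bs). b # b # bs) (Basis \<times> doubled_lists k)"
      by (auto simp: inj_on_def)
    have "(\<Sum>bs\<in>doubled_lists (Suc k). partials bs \<psi> x)
        = (\<Sum>p\<in>Basis \<times> doubled_lists k. partials ((\<lambda>(b, bs). b # b # bs) p) \<psi> x)"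
      by (simp only: doubled_lists.simps sum.reindex[OF inj] o_def)
    also have "\<dots> = (\<Sum>b\<in>Basis. \<Sum>bs\<in>doubled_lists k. partials (b # b # bs) \<psi> x)"
      by (subst sum.cartesian_product) (auto intro: sum.cong)
    finally show ?thesis
      unfolding laplacian_def 1 using 2 by simp
  qed
  show ?case
    unfolding funpow.simps o_def Suc.IH using * by (rule ext)
qed simp

section \<open>Weak powers of the Laplacian and Green's formula\<close>

lemma has_weak_deriv_weak_deriv:
  "u \<in> Sobolev \<Omega> k \<Longrightarrow> set bs \<subseteq> Basis \<Longrightarrow> length bs \<le> k \<Longrightarrow> has_weak_deriv \<Omega> bs u (weak_deriv \<Omega> bs u)"
  unfolding weak_deriv_def Sobolev_def by (auto intro: someI_ex[of "has_weak_deriv \<Omega> bs u"])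

text \<open>All lists have even length \<open>2 * k\<close>, so the signs from integrating by parts
  disappear. This is the existence proof that makes the choice in \<open>weak_lap\<close> meaningful
  on \<open>Sobolev \<Omega> (2 * k)\<close>.\<close>

lemma has_weak_lap_sum_weak_deriv:
  assumes "open \<Omega>" "u \<in> Sobolev \<Omega> (2 * k)"
  shows "has_weak_lap \<Omega> k u (\<lambda>x. \<Sum>bs\<in>doubled_lists k. weak_deriv \<Omega> bs u x)"
  unfolding has_weak_lap_def
proof (intro conjI ballI)
  have wd: "has_weak_deriv \<Omega> bs u (weak_deriv \<Omega> bs u)" if "bs \<in> doubled_lists k" for bs
    using has_weak_deriv_weak_deriv[OF assms(2)] doubled_lists_basis[OF that] by simp
  have L2: "weak_deriv \<Omega> bs u \<in> L2_space \<Omega>" if "bs \<in> doubled_lists k" for bs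
    using wd[OF that] by (simp add: has_weak_deriv_def)
  then show "(\<lambda>x. \<Sum>bs\<in>doubled_lists k. weak_deriv \<Omega> bs u x) \<in> L2_space \<Omega>"
    by (rule L2_space_sum)
  fix \<psi> assume \<psi>: "\<psi> \<in> test_functions \<Omega>"
  then have sm: "smooth \<psi>" by (simp add: test_functions_def)
  have u: "u \<in> L2_space \<Omega>" using assms(2) by (simp add: Sobolev_def)
  have t: "partials bs \<psi> \<in> L2_space \<Omega>" if "bs \<in> doubled_lists k" for bs
    using test_functions_L2[OF assms(1) test_functions_partials[OF \<psi>]] doubled_lists_basis[OF that]
    by simp
  have "L2_inner \<Omega> u ((laplacian ^^ k) \<psi>) = (\<Sum>bs\<in>doubled_lists k. L2_inner \<Omega> u (partials bs \<psi>))"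
    using L2_inner_sum_left[OF t u] by (simp add: laplacian_power_eq[OF sm] L2_inner_commute)
  also have "\<dots> = (\<Sum>bs\<in>doubled_lists k. L2_inner \<Omega> (weak_deriv \<Omega> bs u) \<psi>)"
  proof (rule sum.cong)
    fix bs :: "'a list" assume bs: "bs \<in> doubled_lists k"
    have "L2_inner \<Omega> u (partials bs \<psi>) = (-1) ^ length bs * L2_inner \<Omega> (weak_deriv \<Omega> bs u) \<psi>"
      using wd[OF bs] \<psi> by (simp add: has_weak_deriv_def)
    then show "L2_inner \<Omega> u (partials bs \<psi>) = L2_inner \<Omega> (weak_deriv \<Omega> bs u) \<psi>"
      using doubled_lists_basis[OF bs] by simp
  qed simp
  also have "\<dots> = L2_inner \<Omega> (\<lambda>x. \<Sum>bs\<in>doubled_lists k. weak_deriv \<Omega> bs u x) \<psi>"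
    by (rule L2_inner_sum_left[symmetric, OF L2 test_functions_L2[OF assms(1) \<psi>]])
  finally show "L2_inner \<Omega> u ((laplacian ^^ k) \<psi>)
      = L2_inner \<Omega> (\<lambda>x. \<Sum>bs\<in>doubled_lists k. weak_deriv \<Omega> bs u x) \<psi>" .
qed

lemma has_weak_lap_weak_lap: "has_weak_lap \<Omega> k u g \<Longrightarrow> has_weak_lap \<Omega> k u (weak_lap \<Omega> k u)"
  unfolding weak_lap_def by (rule someI[of "has_weak_lap \<Omega> k u"])

lemma Sobolev_weak_lap:
  "open \<Omega> \<Longrightarrow> u \<in> Sobolev \<Omega> (2 * k) \<Longrightarrow> has_weak_lap \<Omega> k u (weak_lap \<Omega> k u)"
  using has_weak_lap_weak_lap has_weak_lap_sum_weak_deriv by blast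

text \<open>Functions in \<open>H\<^sup>1\<^sub>0\<close> are \<open>L\<^sup>2\<close> limits of test functions, hence cannot distinguish two
  elements of \<open>L\<^sup>2\<close> that agree as distributions.\<close>

lemma L2_inner_Sobolev10_eqI:
  assumes "open \<Omega>" "w \<in> Sobolev10 \<Omega>" "g \<in> L2_space \<Omega>" "h \<in> L2_space \<Omega>"
    and "\<And>\<psi>. \<psi> \<in> test_functions \<Omega> \<Longrightarrow> L2_inner \<Omega> g \<psi> = L2_inner \<Omega> h \<psi>"
  shows "L2_inner \<Omega> g w = L2_inner \<Omega> h w"
proof -
  obtain \<psi> where \<psi>: "\<And>i::nat. \<psi> i \<in> test_functions \<Omega>"
    and lim: "(\<lambda>i. L2_norm \<Omega> (\<lambda>x. w x - \<psi> i x)) \<longlonglongrightarrow> 0"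
    using assms(2) by (auto simp: Sobolev10_def)
  have w: "w \<in> L2_space \<Omega>" using assms(2) by (auto simp: Sobolev10_def Sobolev_def)
  note t = test_functions_L2[OF assms(1) \<psi>]
  show ?thesis
    using L2_inner_tendsto[OF assms(3) w t lim] L2_inner_tendsto[OF assms(4) w t lim]
    unfolding assms(5)[OF \<psi>] by (rule LIMSEQ_unique)
qed

text \<open>For a test function in place of \<open>w\<close> this is the definition of the weak
  derivatives. Both sides are continuous along the sequence of test functions that approximates
  \<open>w\<close> in the \<open>H\<^sup>1\<close> norm. The right-hand side is symmetric in
  \<open>u\<close> and \<open>w\<close> and nonpositive for \<open>u = w\<close>; the first gives
  self-adjointness, the second the sign of the eigenvalues.\<close>

lemma L2_inner_weak_lap_Green:
  assumes "open \<Omega>" "u \<in> Sobolev \<Omega> 2" "w \<in> Sobolev10 \<Omega>"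
  shows "L2_inner \<Omega> (weak_lap \<Omega> 1 u) w
    = - (\<Sum>b\<in>Basis. L2_inner \<Omega> (weak_deriv \<Omega> [b] u) (weak_deriv \<Omega> [b] w))"
proof -
  obtain \<psi> where \<psi>: "\<And>i::nat. \<psi> i \<in> test_functions \<Omega>"
    and lim: "(\<lambda>i. L2_norm \<Omega> (\<lambda>x. w x - \<psi> i x)) \<longlonglongrightarrow> 0"
    and limb: "\<And>b. b \<in> Basis \<Longrightarrow> (\<lambda>i. L2_norm \<Omega> (\<lambda>x. weak_deriv \<Omega> [b] w x - partial b (\<psi> i) x)) \<longlonglongrightarrow> 0"
    using assms(3) by (auto simp: Sobolev10_def)
  have w1: "w \<in> Sobolev \<Omega> 1" and w: "w \<in> L2_space \<Omega>"
    using assms(3) by (auto simp: Sobolev10_def Sobolev_def)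
  have u: "u \<in> L2_space \<Omega>" using assms(2) by (simp add: Sobolev_def)
  have lap: "has_weak_lap \<Omega> 1 u (weak_lap \<Omega> 1 u)"
    using Sobolev_weak_lap[of \<Omega> u 1] assms by simp
  have wdu: "has_weak_deriv \<Omega> [b] u (weak_deriv \<Omega> [b] u)"
    and wdw: "has_weak_deriv \<Omega> [b] w (weak_deriv \<Omega> [b] w)" if "b \<in> Basis" for b
    using has_weak_deriv_weak_deriv[OF assms(2), of "[b]"] has_weak_deriv_weak_deriv[OF w1, of "[b]"] that
    by simp_all
  note t = test_functions_L2[OF assms(1) \<psi>]
  have tb: "partial b (\<psi> i) \<in> test_functions \<Omega>" if "b \<in> Basis" for b i
    using test_functions_partials[OF \<psi>, of "[b]" i] that by simp
  have eq: "L2_inner \<Omega> (weak_lap \<Omega> 1 u) (\<psi> i)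
      = - (\<Sum>b\<in>Basis. L2_inner \<Omega> (weak_deriv \<Omega> [b] u) (partial b (\<psi> i)))" for i
  proof -
    have "L2_inner \<Omega> (weak_lap \<Omega> 1 u) (\<psi> i) = L2_inner \<Omega> u (laplacian (\<psi> i))"
      using lap \<psi> by (simp add: has_weak_lap_def)
    also have "\<dots> = (\<Sum>b\<in>Basis. L2_inner \<Omega> u (partial b (partial b (\<psi> i))))"
    proof -
      have "partial b (partial b (\<psi> i)) \<in> L2_space \<Omega>" if "b \<in> Basis" for b
        using test_functions_L2[OF assms(1) test_functions_partials[OF \<psi>, of "[b, b]" i]] that by simp
      then show ?thesis
        using L2_inner_sum_left[of Basis "\<lambda>b. partial b (partial b (\<psi> i))" \<Omega> u] u
        by (simp add: L2_inner_commute laplacian_def[abs_def])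
    qed
    \<comment> \<open>Only one of the two derivatives is moved onto \<open>u\<close>:
      \<open>partial b (\<psi> i)\<close> is itself a test function.\<close>
    also have "\<dots> = (\<Sum>b\<in>Basis. - L2_inner \<Omega> (weak_deriv \<Omega> [b] u) (partial b (\<psi> i)))"
      using wdu tb by (intro sum.cong) (auto simp: has_weak_deriv_def)
    finally show ?thesis by (simp add: sum_negf)
  qed
  have 1: "(\<lambda>i. L2_inner \<Omega> (weak_lap \<Omega> 1 u) (\<psi> i)) \<longlonglongrightarrow> L2_inner \<Omega> (weak_lap \<Omega> 1 u) w"
    using lap by (intro L2_inner_tendsto w t lim) (simp add: has_weak_lap_def)
  have 2: "(\<lambda>i. - (\<Sum>b\<in>Basis. L2_inner \<Omega> (weak_deriv \<Omega> [b] u) (partial b (\<psi> i))))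
     \<longlonglongrightarrow> - (\<Sum>b\<in>Basis. L2_inner \<Omega> (weak_deriv \<Omega> [b] u) (weak_deriv \<Omega> [b] w))"
    using wdu wdw tb limb test_functions_L2[OF assms(1)]
    by (intro tendsto_minus tendsto_sum L2_inner_tendsto) (auto simp: has_weak_deriv_def)
  show ?thesis using LIMSEQ_unique[OF 1[unfolded eq] 2] .
qed

lemma weak_lap_symmetric:
  assumes "open \<Omega>" "u \<in> Sobolev \<Omega> 2 \<inter> Sobolev10 \<Omega>" "w \<in> Sobolev \<Omega> 2 \<inter> Sobolev10 \<Omega>"
  shows "L2_inner \<Omega> (weak_lap \<Omega> 1 u) w = L2_inner \<Omega> u (weak_lap \<Omega> 1 w)"
  using L2_inner_weak_lap_Green[OF assms(1), of u w] L2_inner_weak_lap_Green[OF assms(1), of w u] assms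
  by (simp add: L2_inner_commute)

lemma weak_lap_L2: "open \<Omega> \<Longrightarrow> u \<in> Sobolev \<Omega> 2 \<Longrightarrow> weak_lap \<Omega> 1 u \<in> L2_space \<Omega>"
  using Sobolev_weak_lap[of \<Omega> u 1] by (simp add: has_weak_lap_def)

section \<open>Consequences for Dirichlet eigenfunctions\<close>

lemma dirichlet_eigensystem_L2:
  "dirichlet_eigensystem \<Omega> lam \<phi> \<Longrightarrow> 1 \<le> q \<Longrightarrow> \<phi> q \<in> L2_space \<Omega>"
  by (auto simp: dirichlet_eigensystem_def Sobolev_def)

lemma L2_inner_weak_lap_eigen:
  assumes "open \<Omega>" "dirichlet_eigensystem \<Omega> lam \<phi>" "1 \<le> q" "u \<in> Sobolev \<Omega> 2 \<inter> Sobolev10 \<Omega>"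
  shows "L2_inner \<Omega> (weak_lap \<Omega> 1 u) (\<phi> q) = - lam q * L2_inner \<Omega> u (\<phi> q)"
proof -
  have \<phi>: "\<phi> q \<in> Sobolev \<Omega> 2 \<inter> Sobolev10 \<Omega>"
    and ae: "AE x in lebesgue_on \<Omega>. - weak_lap \<Omega> 1 (\<phi> q) x = lam q * \<phi> q x"
    using assms(2,3) by (auto simp: dirichlet_eigensystem_def)
  have u: "u \<in> L2_space \<Omega>" using assms(4) by (simp add: Sobolev_def)
  have "L2_inner \<Omega> (weak_lap \<Omega> 1 u) (\<phi> q) = L2_inner \<Omega> (weak_lap \<Omega> 1 (\<phi> q)) u"
    using weak_lap_symmetric[OF assms(1,4) \<phi>] by (simp add: L2_inner_commute)
  also have "\<dots> = L2_inner \<Omega> (\<lambda>x. - lam q * \<phi> q x) u"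
  proof (rule L2_inner_cong_AE)
    show "AE x in lebesgue_on \<Omega>. weak_lap \<Omega> 1 (\<phi> q) x = - lam q * \<phi> q x"
      using ae by eventually_elim simp
    show "(\<lambda>x. - lam q * \<phi> q x) \<in> L2_space \<Omega>"
      by (rule L2_space_cmult[OF dirichlet_eigensystem_L2[OF assms(2,3)]])
  qed (use weak_lap_L2[OF assms(1)] \<phi> u in auto)
  also have "\<dots> = - lam q * L2_inner \<Omega> u (\<phi> q)"
    by (simp only: L2_inner_cmult_left L2_inner_commute)
  finally show ?thesis .
qed

text \<open>Green's formula with both arguments equal to the normalised eigenfunction. The sign is
  what later makes the diagonal of the memory term stabilising.\<close>

lemma dirichlet_eigenvalue_nonneg:
  assumes "open \<Omega>" "dirichlet_eigensystem \<Omega> lam \<phi>" "1 \<le> q"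
  shows "0 \<le> lam q"
proof -
  have \<phi>: "\<phi> q \<in> Sobolev \<Omega> 2 \<inter> Sobolev10 \<Omega>" and n: "L2_inner \<Omega> (\<phi> q) (\<phi> q) = 1"
    using assms(2,3) by (auto simp: dirichlet_eigensystem_def)
  have "- lam q = L2_inner \<Omega> (weak_lap \<Omega> 1 (\<phi> q)) (\<phi> q)"
    using L2_inner_weak_lap_eigen[OF assms \<phi>] n by simp
  also have "\<dots> \<le> 0"
    using L2_inner_weak_lap_Green[OF assms(1), of "\<phi> q" "\<phi> q"] \<phi>
    by (simp add: sum_nonneg L2_inner_self_nonneg)
  finally show ?thesis by simp
qed

text \<open>The chosen representative could a priori be anything. It pairs to zero with all test
  functions, hence with every eigenfunction, since these are \<open>L\<^sup>2\<close> limits of test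
  functions; completeness of the eigensystem then forces it to vanish. The scheme needs this for
  \<open>V 0\<close>, which is zero only almost everywhere.\<close>

lemma weak_lap_AE_zero:
  assumes "open \<Omega>" "dirichlet_eigensystem \<Omega> lam \<phi>" "AE x in lebesgue_on \<Omega>. u x = 0"
  shows "AE x in lebesgue_on \<Omega>. weak_lap \<Omega> k u x = 0"
proof -
  have z: "L2_inner \<Omega> u \<psi> = 0" for \<psi>
  proof -
    have "AE x in lebesgue_on \<Omega>. u x * \<psi> x = 0" using assms(3) by eventually_elim simp
    then show ?thesis unfolding L2_inner_def by (rule integral_eq_zero_AE)
  qed
  have "has_weak_lap \<Omega> k u (\<lambda>x. 0)"
    unfolding has_weak_lap_def
  proof (intro conjI ballI L2_space_zero)
    fix \<psi> assume "\<psi> \<in> test_functions \<Omega>"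
    then have "L2_inner \<Omega> u ((laplacian ^^ k) \<psi>) = 0" using z by blast
    then show "L2_inner \<Omega> u ((laplacian ^^ k) \<psi>) = L2_inner \<Omega> (\<lambda>x. 0) \<psi>" by (simp add: L2_inner_def)
  qed
  then have W: "has_weak_lap \<Omega> k u (weak_lap \<Omega> k u)" by (rule has_weak_lap_weak_lap)
  have "L2_inner \<Omega> (weak_lap \<Omega> k u) (\<phi> q) = 0" if "1 \<le> q" for q
  proof -
    have "L2_inner \<Omega> (weak_lap \<Omega> k u) (\<phi> q) = L2_inner \<Omega> (\<lambda>x. 0) (\<phi> q)"
    proof (rule L2_inner_Sobolev10_eqI[OF assms(1)])
      show "\<phi> q \<in> Sobolev10 \<Omega>" using assms(2) that by (auto simp: dirichlet_eigensystem_def)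
      fix \<psi> assume "\<psi> \<in> test_functions \<Omega>"
      then have "L2_inner \<Omega> (weak_lap \<Omega> k u) \<psi> = L2_inner \<Omega> u ((laplacian ^^ k) \<psi>)"
        using W by (simp add: has_weak_lap_def)
      also have "\<dots> = 0" using z by blast
      finally show "L2_inner \<Omega> (weak_lap \<Omega> k u) \<psi> = L2_inner \<Omega> (\<lambda>x. 0) \<psi>" by (simp add: L2_inner_def)
    qed (use W L2_space_zero in \<open>auto simp: has_weak_lap_def\<close>)
    then show ?thesis by (simp add: L2_inner_def)
  qed
  then show ?thesis
    using assms(2) W by (auto simp: dirichlet_eigensystem_def has_weak_lap_def)
qed

subsection \<open>Fractional integrals\<close>

text \<open>For nonnegative integrands the gauge integral and the Lebesgue integral agree, and
  integrability comes for free. This lets weakly singular kernels be integrated by the fundamental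
  theorem of calculus.\<close>

lemma nonneg_has_integral_set_integrable:
  fixes f :: "real \<Rightarrow> real"
  assumes [measurable]: "f \<in> borel_measurable borel" "S \<in> sets borel"
    and nn: "\<And>x. x \<in> S \<Longrightarrow> 0 \<le> f x" and I: "(f has_integral I) S"
  shows "set_integrable lborel S f" "(LINT x:S|lborel. f x) = I"
proof -
  have I0: "0 \<le> I" using has_integral_nonneg[OF I nn] .
  have "((\<lambda>x. if x \<in> S then f x else 0) has_integral I) UNIV"
    using I by (simp add: has_integral_restrict_UNIV)
  moreover have "(\<lambda>x. if x \<in> S then f x else 0) = (\<lambda>x. indicator S x * f x)"
    by (auto simp: indicator_def)
  ultimately have "(\<integral>\<^sup>+x. ennreal (indicator S x * f x) \<partial>lborel) = ennreal I"
    by (intro nn_integral_has_integral_lborel) (auto simp: indicator_def nn)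
  moreover have "AE x in lborel. 0 \<le> indicator S x * f x" by (simp add: indicator_def nn)
  ultimately have "integrable lborel (\<lambda>x. indicator S x * f x) \<and> (\<integral>x. indicator S x * f x \<partial>lborel) = I"
    using I0 nn_integral_eq_integrable[of "\<lambda>x. indicator S x * f x" lborel I] by simp
  then show "set_integrable lborel S f" "(LINT x:S|lborel. f x) = I"
    by (simp_all add: set_integrable_def set_lebesgue_integral_def)
qed

lemma frac_kernel_measurable [measurable]: "frac_kernel \<nu> \<in> borel_measurable borel"
  unfolding frac_kernel_def[abs_def] by measurable

lemma frac_kernel_nonneg: "0 < \<nu> \<Longrightarrow> 0 \<le> frac_kernel \<nu> u"
  by (simp add: frac_kernel_def Gamma_real_nonneg)

lemma frac_kernel_1: "0 < u \<Longrightarrow> frac_kernel 1 u = 1"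
  by (simp add: frac_kernel_def)

lemma frac_kernel_antimono:
  assumes "0 < \<nu>" "\<nu> \<le> 1" "0 < u" "u \<le> w"
  shows "frac_kernel \<nu> w \<le> frac_kernel \<nu> u"
  unfolding frac_kernel_def
  by (intro divide_right_mono powr_mono2') (use assms Gamma_real_nonneg in auto)

text \<open>The primitive \<open>- (t - s) powr \<nu> / Gamma (\<nu> + 1)\<close> stays continuous
  at \<open>s = t\<close> although the kernel may blow up there. The interior form of the
  fundamental theorem therefore covers the case \<open>b = t\<close> as well.\<close>

lemma frac_kernel_integral:
  assumes "0 < \<nu>" "a \<le> b" "b \<le> t"
  shows "set_integrable lborel {a<..<b} (\<lambda>s. frac_kernel \<nu> (t - s))"
    and "(LINT s:{a<..<b}|lborel. frac_kernel \<nu> (t - s)) = ((t - a) powr \<nu> - (t - b) powr \<nu>) / Gamma (\<nu> + 1)"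
proof -
  have G: "Gamma (\<nu> + 1) = \<nu> * Gamma \<nu>" using assms(1) by (intro Gamma_plus1) (auto elim!: nonpos_Ints_cases)
  have G0: "0 < Gamma (\<nu> + 1)" using assms(1) by (intro Gamma_real_pos) simp
  have "((\<lambda>s. frac_kernel \<nu> (t - s)) has_integral
      (- ((t - b) powr \<nu> / Gamma (\<nu> + 1)) - - ((t - a) powr \<nu> / Gamma (\<nu> + 1)))) {a..b}"
  proof (rule fundamental_theorem_of_calculus_interior[OF assms(2)])
    have "continuous_on {a..b} (\<lambda>s. (t - s) powr \<nu>)"
      using assms by (intro continuous_on_powr' continuous_intros) auto
    then show "continuous_on {a..b} (\<lambda>s. - ((t - s) powr \<nu> / Gamma (\<nu> + 1)))"
      using G0 by (intro continuous_on_minus continuous_on_divide continuous_on_const) auto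
    fix s assume s: "s \<in> {a<..<b}"
    have "((\<lambda>s. - ((t - s) powr \<nu> / Gamma (\<nu> + 1))) has_real_derivative
        - ((\<nu> * (t - s) powr (\<nu> - 1) * -1) / Gamma (\<nu> + 1))) (at s)"
      using s assms less_imp_neq[OF G0] by (auto intro!: derivative_eq_intros simp: divide_simps)
    moreover have "- ((\<nu> * (t - s) powr (\<nu> - 1) * -1) / Gamma (\<nu> + 1)) = frac_kernel \<nu> (t - s)"
      using assms(1) Gamma_real_pos[of \<nu>] by (simp add: G frac_kernel_def)
    ultimately show "((\<lambda>s. - ((t - s) powr \<nu> / Gamma (\<nu> + 1))) has_vector_derivative
        frac_kernel \<nu> (t - s)) (at s)"
      by (simp add: has_real_derivative_iff_has_vector_derivative)
  qed
  then have I: "((\<lambda>s. frac_kernel \<nu> (t - s)) has_integral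
      ((t - a) powr \<nu> - (t - b) powr \<nu>) / Gamma (\<nu> + 1)) {a<..<b}"
    by (simp add: has_integral_Icc_iff_Ioo diff_divide_distrib)
  show "set_integrable lborel {a<..<b} (\<lambda>s. frac_kernel \<nu> (t - s))"
    and "(LINT s:{a<..<b}|lborel. frac_kernel \<nu> (t - s)) = ((t - a) powr \<nu> - (t - b) powr \<nu>) / Gamma (\<nu> + 1)"
    using nonneg_has_integral_set_integrable[OF _ _ _ I] assms frac_kernel_nonneg[of \<nu>] by auto
qed

text \<open>The working class of densities. Measurability is required on the whole line, which suits
  Fubini, but boundedness only on the intervals \<open>{0<..<T}\<close>, the points that
  \<open>frac_int\<close> sees. The class is closed under linear combinations and under fractional
  integration, so a Volterra equation can be iterated inside it.\<close>

definition loc_bounded :: "(real \<Rightarrow> real) \<Rightarrow> bool" where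
  "loc_bounded h \<longleftrightarrow> h \<in> borel_measurable borel \<and> (\<forall>T. \<exists>B\<ge>0. \<forall>s\<in>{0<..<T}. \<bar>h s\<bar> \<le> B)"

lemma loc_boundedD: "loc_bounded h \<Longrightarrow> \<exists>B\<ge>0. \<forall>s\<in>{0<..<T}. \<bar>h s\<bar> \<le> B"
  by (simp add: loc_bounded_def)

lemma loc_bounded_lincomb:
  assumes "loc_bounded f" "loc_bounded g"
  shows "loc_bounded (\<lambda>s. f s + c * g s)"
  unfolding loc_bounded_def
proof (intro conjI allI)
  fix T
  obtain A B where A: "A \<ge> 0" "\<forall>s\<in>{0<..<T}. \<bar>f s\<bar> \<le> A" and B: "B \<ge> 0" "\<forall>s\<in>{0<..<T}. \<bar>g s\<bar> \<le> B"
    using loc_boundedD assms by metis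
  have "\<bar>f s + c * g s\<bar> \<le> A + \<bar>c\<bar> * B" if "s \<in> {0<..<T}" for s
  proof -
    have "\<bar>f s + c * g s\<bar> \<le> \<bar>f s\<bar> + \<bar>c\<bar> * \<bar>g s\<bar>" by (metis abs_mult abs_triangle_ineq)
    also have "\<dots> \<le> A + \<bar>c\<bar> * B" using A B that by (intro add_mono mult_left_mono) auto
    finally show ?thesis .
  qed
  then show "\<exists>B\<ge>0. \<forall>s\<in>{0<..<T}. \<bar>f s + c * g s\<bar> \<le> B"
    using A B by (intro exI[of _ "A + \<bar>c\<bar> * B"]) auto
qed (use assms in \<open>auto simp: loc_bounded_def\<close>)

lemma set_integrable_kernel_mult:
  assumes \<nu>: "0 < \<nu>" and ab: "a \<le> b" "b \<le> t"
    and meas: "set_borel_measurable lborel {a<..<b} h"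
    and B: "\<And>s. s \<in> {a<..<b} \<Longrightarrow> \<bar>h s\<bar> \<le> B"
  shows "set_integrable lborel {a<..<b} (\<lambda>s. frac_kernel \<nu> (t - s) * h s)"
    and "\<bar>LINT s:{a<..<b}|lborel. frac_kernel \<nu> (t - s) * h s\<bar>
      \<le> B * ((t - a) powr \<nu> - (t - b) powr \<nu>) / Gamma (\<nu> + 1)"
proof -
  have kint: "set_integrable lborel {a<..<b} (\<lambda>s. B * frac_kernel \<nu> (t - s))"
    using frac_kernel_integral(1)[OF \<nu> ab] by simp
  have bd: "\<bar>frac_kernel \<nu> (t - s) * h s\<bar> \<le> B * frac_kernel \<nu> (t - s)" if "s \<in> {a<..<b}" for s
    using B[OF that] frac_kernel_nonneg[OF \<nu>, of "t - s"]
    by (simp add: abs_mult mult.commute mult_right_mono)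
  have "(\<lambda>s. frac_kernel \<nu> (t - s) * (indicator {a<..<b} s * h s)) \<in> borel_measurable borel"
    using meas by (simp add: set_borel_measurable_def)
  then have m: "set_borel_measurable lborel {a<..<b} (\<lambda>s. frac_kernel \<nu> (t - s) * h s)"
    by (simp add: set_borel_measurable_def mult.left_commute)
  show int: "set_integrable lborel {a<..<b} (\<lambda>s. frac_kernel \<nu> (t - s) * h s)"
    by (rule set_integrable_bound[OF kint m]) (use bd in fastforce)
  have "\<bar>LINT s:{a<..<b}|lborel. frac_kernel \<nu> (t - s) * h s\<bar>
      \<le> (LINT s:{a<..<b}|lborel. B * frac_kernel \<nu> (t - s))"
  proof (rule abs_leI)
    show "(LINT s:{a<..<b}|lborel. frac_kernel \<nu> (t - s) * h s)
        \<le> (LINT s:{a<..<b}|lborel. B * frac_kernel \<nu> (t - s))"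
      using bd by (intro set_integral_mono int kint) (meson abs_le_D1)
    have "- (LINT s:{a<..<b}|lborel. frac_kernel \<nu> (t - s) * h s)
        = (LINT s:{a<..<b}|lborel. - (frac_kernel \<nu> (t - s) * h s))"
      by (simp add: set_lebesgue_integral_def)
    also have "\<dots> \<le> (LINT s:{a<..<b}|lborel. B * frac_kernel \<nu> (t - s))"
      using bd int kint by (intro set_integral_mono) (auto simp: set_integrable_def abs_le_iff)
    finally show "- (LINT s:{a<..<b}|lborel. frac_kernel \<nu> (t - s) * h s)
        \<le> (LINT s:{a<..<b}|lborel. B * frac_kernel \<nu> (t - s))" .
  qed
  also have "\<dots> = B * ((t - a) powr \<nu> - (t - b) powr \<nu>) / Gamma (\<nu> + 1)"
    using frac_kernel_integral(2)[OF \<nu> ab] by simp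
  finally show "\<bar>LINT s:{a<..<b}|lborel. frac_kernel \<nu> (t - s) * h s\<bar>
      \<le> B * ((t - a) powr \<nu> - (t - b) powr \<nu>) / Gamma (\<nu> + 1)" .
qed

lemma loc_bounded_measurable: "loc_bounded h \<Longrightarrow> h \<in> borel_measurable borel"
  by (simp add: loc_bounded_def)

lemma loc_bounded_set_measurable: "loc_bounded h \<Longrightarrow> set_borel_measurable lborel {a<..<b} h"
  using loc_bounded_measurable[of h] by (simp add: set_borel_measurable_def)

lemma frac_int_nonpos: "t \<le> 0 \<Longrightarrow> frac_int \<nu> h t = 0"
  by (simp add: frac_int_def set_lebesgue_integral_def)

lemma frac_int_cong: "(\<And>s. 0 < s \<Longrightarrow> s < t \<Longrightarrow> f s = g s) \<Longrightarrow> frac_int \<nu> f t = frac_int \<nu> g t"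
  unfolding frac_int_def by (intro set_lebesgue_integral_cong) auto

lemma frac_int_integrable:
  assumes "0 < \<nu>" "loc_bounded h"
  shows "set_integrable lborel {0<..<t} (\<lambda>s. frac_kernel \<nu> (t - s) * h s)"
proof (cases "0 \<le> t")
  case True
  obtain B where "\<forall>s\<in>{0<..<t}. \<bar>h s\<bar> \<le> B" using loc_boundedD[OF assms(2)] by metis
  then show ?thesis
    using set_integrable_kernel_mult(1)[OF assms(1) True order_refl] loc_bounded_set_measurable[OF assms(2)]
    by blast
qed (simp add: set_integrable_def)

lemma frac_int_bound:
  assumes "0 < \<nu>" "loc_bounded h" "0 \<le> t" "\<And>s. s \<in> {0<..<t} \<Longrightarrow> \<bar>h s\<bar> \<le> B"
  shows "\<bar>frac_int \<nu> h t\<bar> \<le> B * t powr \<nu> / Gamma (\<nu> + 1)"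
  using set_integrable_kernel_mult(2)[OF assms(1,3) order_refl loc_bounded_set_measurable[OF assms(2)] assms(4)]
  using assms(1) by (simp add: frac_int_def)

lemma frac_int_lincomb:
  assumes "0 < \<nu>" "loc_bounded f" "loc_bounded g"
  shows "frac_int \<nu> (\<lambda>s. f s + c * g s) t = frac_int \<nu> f t + c * frac_int \<nu> g t"
proof -
  have "frac_int \<nu> (\<lambda>s. f s + c * g s) t
      = (LINT s:{0<..<t}|lborel. frac_kernel \<nu> (t - s) * f s + c * (frac_kernel \<nu> (t - s) * g s))"
    by (simp add: frac_int_def algebra_simps)
  also have "\<dots> = (LINT s:{0<..<t}|lborel. frac_kernel \<nu> (t - s) * f s)
      + (LINT s:{0<..<t}|lborel. c * (frac_kernel \<nu> (t - s) * g s))"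
    by (rule set_integral_add(2))
      (use frac_int_integrable[OF assms(1,2)] frac_int_integrable[OF assms(1,3)] in simp_all)
  finally show ?thesis by (simp add: frac_int_def)
qed

lemma frac_int_measurable:
  assumes [measurable]: "h \<in> borel_measurable borel"
  shows "frac_int \<nu> h \<in> borel_measurable borel"
proof -
  have "(\<lambda>t. \<integral>s. (if 0 < s \<and> s < t then frac_kernel \<nu> (t - s) * h s else 0) \<partial>lborel)
      \<in> borel_measurable borel"
    by (rule lborel.borel_measurable_lebesgue_integral) measurable
  moreover have "indicator {0<..<t} s *\<^sub>R (frac_kernel \<nu> (t - s) * h s)
      = (if 0 < s \<and> s < t then frac_kernel \<nu> (t - s) * h s else 0)" for s t
    by (simp add: indicator_def)
  ultimately show ?thesis
    unfolding frac_int_def[abs_def] set_lebesgue_integral_def by presburger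
qed

lemma loc_bounded_frac_int:
  assumes "0 < \<nu>" "loc_bounded h"
  shows "loc_bounded (frac_int \<nu> h)"
  unfolding loc_bounded_def
proof (intro conjI allI)
  show "frac_int \<nu> h \<in> borel_measurable borel"
    using assms(2) frac_int_measurable by (simp add: loc_bounded_def)
  fix T
  obtain B where B: "B \<ge> 0" "\<forall>s\<in>{0<..<T}. \<bar>h s\<bar> \<le> B" using loc_boundedD[OF assms(2)] by metis
  have G: "0 < Gamma (\<nu> + 1)" using assms(1) by (simp add: Gamma_real_pos)
  have "\<bar>frac_int \<nu> h t\<bar> \<le> B * T powr \<nu> / Gamma (\<nu> + 1)" if "t \<in> {0<..<T}" for t
  proof -
    have "\<bar>frac_int \<nu> h t\<bar> \<le> B * t powr \<nu> / Gamma (\<nu> + 1)"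
      using that B by (intro frac_int_bound assms) auto
    also have "\<dots> \<le> B * T powr \<nu> / Gamma (\<nu> + 1)"
      using that B assms(1) G by (intro divide_right_mono mult_left_mono powr_mono2) auto
    finally show ?thesis .
  qed
  then show "\<exists>B\<ge>0. \<forall>s\<in>{0<..<T}. \<bar>frac_int \<nu> h s\<bar> \<le> B"
    using B G by (intro exI[of _ "B * T powr \<nu> / Gamma (\<nu> + 1)"]) auto
qed

text \<open>Split the integral up to \<open>b\<close> at \<open>a\<close>. The part over
  \<open>{a<..<b}\<close> is at most \<open>B * (b - a) powr \<nu> / Gamma (\<nu> + 1)\<close>. On
  \<open>{0<..<a}\<close> the kernel difference has one sign because \<open>\<nu> \<le> 1\<close>,
  so its integral is explicit, and \<open>a powr \<nu> \<le> b powr \<nu>\<close> bounds it by the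
  same quantity; hence the factor 2.\<close>

lemma frac_int_Holder:
  assumes \<nu>: "0 < \<nu>" "\<nu> \<le> 1" and h: "loc_bounded h" and B: "\<And>s. s \<in> {0<..<b} \<Longrightarrow> \<bar>h s\<bar> \<le> B"
    and ab: "a < b" and B0: "0 \<le> B"
  shows "\<bar>frac_int \<nu> h b - frac_int \<nu> h a\<bar> \<le> 2 * B / Gamma (\<nu> + 1) * (b - a) powr \<nu>"
proof -
  have G: "0 < Gamma (\<nu> + 1)" using \<nu> by (simp add: Gamma_real_pos)
  \<comment> \<open>Fractional integrals vanish at nonpositive times, so the estimate extends across
    0 to the whole line.\<close>
  consider "b \<le> 0" | "a \<le> 0" "0 < b" | "0 < a" by linarith
  then show ?thesis
  proof cases
    case 1
    then show ?thesis using ab B0 G by (simp add: frac_int_nonpos)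
  next
    case 2
    have "\<bar>frac_int \<nu> h b\<bar> \<le> B * b powr \<nu> / Gamma (\<nu> + 1)"
      using 2 B by (intro frac_int_bound \<nu> h) auto
    also have "\<dots> \<le> B * (b - a) powr \<nu> / Gamma (\<nu> + 1)"
      using 2 B0 \<nu> G by (intro divide_right_mono mult_left_mono powr_mono2) auto
    also have "\<dots> \<le> 2 * B / Gamma (\<nu> + 1) * (b - a) powr \<nu>"
      using B0 G by (simp add: divide_right_mono mult_right_mono)
    finally show ?thesis using 2 by (simp add: frac_int_nonpos)
  next
    case 3
    define k where "k = (\<lambda>t s. frac_kernel \<nu> (t - s))"
    have mono: "k b s \<le> k a s" if "s \<in> {0<..<a}" for s
      using that ab \<nu> by (auto simp: k_def intro: frac_kernel_antimono)
    note m = loc_bounded_set_measurable[OF h]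
    have i1: "set_integrable lborel {0<..<a} (\<lambda>s. k b s * h s)"
      and i2: "set_integrable lborel {a<..<b} (\<lambda>s. k b s * h s)"
      and i3: "set_integrable lborel {0<..<a} (\<lambda>s. k a s * h s)"
      using 3 ab B \<nu> unfolding k_def by (auto intro!: set_integrable_kernel_mult(1)[OF _ _ _ m, of _ _ _ _ B])
    have k1: "set_integrable lborel {0<..<a} (k b)" and k3: "set_integrable lborel {0<..<a} (k a)"
      using frac_kernel_integral(1)[OF \<nu>(1), of 0 a b] frac_kernel_integral(1)[OF \<nu>(1), of 0 a a] 3 ab
      by (simp_all add: k_def[abs_def])
    have "frac_int \<nu> h b = (LINT s:{0<..<a} \<union> {a<..<b}|lborel. k b s * h s)"
      unfolding frac_int_def k_def
    proof (rule set_integral_cong_set)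
      have meas: "(\<lambda>s. frac_kernel \<nu> (b - s) * h s) \<in> borel_measurable borel"
        using loc_bounded_measurable[OF h] by measurable
      show "set_borel_measurable lborel ({0<..<a} \<union> {a<..<b}) (\<lambda>s. frac_kernel \<nu> (b - s) * h s)"
        and "set_borel_measurable lborel {0<..<b} (\<lambda>s. frac_kernel \<nu> (b - s) * h s)"
        using meas by (auto simp: set_borel_measurable_def)
      have "AE x in lborel. x \<noteq> a" by (rule AE_lborel_singleton)
      then show "AE x in lborel. (x \<in> {0<..<a} \<union> {a<..<b}) = (x \<in> {0<..<b})"
        by eventually_elim (use 3 ab in auto)
    qed
    also have "\<dots> = (LINT s:{0<..<a}|lborel. k b s * h s) + (LINT s:{a<..<b}|lborel. k b s * h s)"
      by (rule set_integral_Un[OF _ i1 i2]) auto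
    finally have eq: "frac_int \<nu> h b - frac_int \<nu> h a
       = (LINT s:{a<..<b}|lborel. k b s * h s) - (LINT s:{0<..<a}|lborel. k a s * h s - k b s * h s)"
      using set_integral_diff(2)[OF i3 i1] by (simp add: frac_int_def k_def)
    have b1: "\<bar>LINT s:{a<..<b}|lborel. k b s * h s\<bar> \<le> B * ((b - a) powr \<nu> - (b - b) powr \<nu>) / Gamma (\<nu> + 1)"
      unfolding k_def using 3 ab B \<nu> by (intro set_integrable_kernel_mult(2) m) auto
    have kk: "set_integrable lborel {0<..<a} (\<lambda>s. B * (k a s - k b s))"
      using set_integral_diff(1)[OF k3 k1] by simp
    have "\<bar>k a s * h s - k b s * h s\<bar> \<le> B * (k a s - k b s)" if "s \<in> {0<..<a}" for s
    proof -
      have "\<bar>k a s * h s - k b s * h s\<bar> = (k a s - k b s) * \<bar>h s\<bar>"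
        using mono[OF that] by (simp add: left_diff_distrib[symmetric] abs_mult)
      also have "\<dots> \<le> (k a s - k b s) * B"
        using mono[OF that] B[of s] that ab by (intro mult_left_mono) auto
      finally show ?thesis by (simp add: mult.commute)
    qed
    then have "norm (LINT s:{0<..<a}|lborel. k a s * h s - k b s * h s) \<le> (LINT s:{0<..<a}|lborel. B * (k a s - k b s))"
      unfolding set_lebesgue_integral_def
      by (intro Bochner_Integration.integral_norm_bound_integral)
        (use set_integral_diff(1)[OF i3 i1] kk in \<open>auto simp: set_integrable_def indicator_def\<close>)
    also have "\<dots> = B * ((LINT s:{0<..<a}|lborel. k a s) - (LINT s:{0<..<a}|lborel. k b s))"
      using set_integral_diff(2)[OF k3 k1] by simp
    also have "\<dots> = B * (a powr \<nu> / Gamma (\<nu> + 1) - (b powr \<nu> - (b - a) powr \<nu>) / Gamma (\<nu> + 1))"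
      using frac_kernel_integral(2)[OF \<nu>(1), of 0 a b] frac_kernel_integral(2)[OF \<nu>(1), of 0 a a] 3 ab \<nu>
      by (simp add: k_def)
    also have "\<dots> \<le> B * ((b - a) powr \<nu> / Gamma (\<nu> + 1))"
    proof -
      have "a powr \<nu> \<le> b powr \<nu>" using 3 ab \<nu> by (intro powr_mono2) auto
      then show ?thesis using B0 G by (intro mult_left_mono) (auto simp: field_simps)
    qed
    finally have "\<bar>LINT s:{0<..<a}|lborel. k a s * h s - k b s * h s\<bar>
        \<le> B * ((b - a) powr \<nu> / Gamma (\<nu> + 1))" by simp
    moreover have "B * ((b - a) powr \<nu> - (b - b) powr \<nu>) / Gamma (\<nu> + 1) = B * ((b - a) powr \<nu> / Gamma (\<nu> + 1))"
      and "2 * B / Gamma (\<nu> + 1) * (b - a) powr \<nu> = 2 * (B * ((b - a) powr \<nu> / Gamma (\<nu> + 1)))"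
      using \<nu> by simp_all
    ultimately show ?thesis using eq b1 by linarith
  qed
qed

lemma frac_int_continuous_le1:
  assumes "0 < \<nu>" "\<nu> \<le> 1" "loc_bounded h"
  shows "continuous_on UNIV (frac_int \<nu> h)"
  unfolding continuous_on_eq_continuous_at[OF open_UNIV]
proof
  fix t :: real
  obtain B where B: "B \<ge> 0" "\<forall>s\<in>{0<..<t + 1}. \<bar>h s\<bar> \<le> B" using loc_boundedD[OF assms(3)] by metis
  define C where "C = 2 * B / Gamma (\<nu> + 1)"
  have "((\<lambda>s. C * \<bar>s - t\<bar> powr \<nu>) \<longlongrightarrow> C * \<bar>t - t\<bar> powr \<nu>) (at t)"
    using assms(1) by (intro tendsto_intros tendsto_powr') auto
  then have "((\<lambda>s. frac_int \<nu> h s - frac_int \<nu> h t) \<longlongrightarrow> 0) (at t)"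
  proof (rule Lim_null_comparison[rotated, OF tendsto_eq_rhs])
    have "\<forall>\<^sub>F s in at t. s \<in> {t - 1<..<t + 1} - {t}"
      by (rule eventually_at_in_open) auto
    then show "\<forall>\<^sub>F s in at t. norm (frac_int \<nu> h s - frac_int \<nu> h t) \<le> C * \<bar>s - t\<bar> powr \<nu>"
    proof eventually_elim
      case (elim s)
      then consider "s < t" | "t < s" by fastforce
      then show ?case
      proof cases
        case 1
        then show ?thesis using frac_int_Holder[OF assms, of t B s] B
          by (simp add: C_def abs_minus_commute)
      next
        case 2
        then show ?thesis using frac_int_Holder[OF assms, of s B t] B elim
          by (simp add: C_def)
      qed
    qed
  qed (use assms in simp)
  then show "isCont (frac_int \<nu> h) t" by (simp add: isCont_def LIM_zero_iff)
qed

section \<open>The semigroup law and differentiation of fractional integrals\<close>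

text \<open>The substitution \<open>s = t - (t - r) * u\<close> turns the convolution of two kernels
  into the Beta integral. Working with nonnegative extended integrals yields integrability and the
  value together.\<close>

lemma frac_kernel_Beta:
  assumes a: "0 < a" and b: "0 < b" and rt: "r < t"
  shows "integrable lborel (\<lambda>s. indicator {r<..<t} s * (frac_kernel a (t - s) * frac_kernel b (s - r)))"
    and "(\<integral>s. indicator {r<..<t} s * (frac_kernel a (t - s) * frac_kernel b (s - r)) \<partial>lborel)
      = frac_kernel (a + b) (t - r)"
proof -
  define k where "k = (\<lambda>s. indicator {r<..<t} s * (frac_kernel a (t - s) * frac_kernel b (s - r)))"
  have [measurable]: "k \<in> borel_measurable borel" unfolding k_def by measurable
  have k0: "0 \<le> k s" for s using a b by (simp add: k_def frac_kernel_nonneg)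
  \<comment> \<open>The powers of \<open>t - r\<close> released by the two kernels; the Jacobian of
    the substitution supplies the missing factor \<open>t - r\<close>.\<close>
  define c where "c = (t - r) powr (a + b - 2) / (Gamma a * Gamma b)"
  have G: "0 < Gamma a" "0 < Gamma b" "0 < Gamma (a + b)" using a b by (auto intro: Gamma_real_pos)
  have c0: "0 \<le> c" using G by (simp add: c_def)
  have kaff: "k (t + (- (t - r)) * u)
      = c * (if u \<in> {0<..<1} then u powr (a - 1) * (1 - u) powr (b - 1) else 0)" for u
  proof (cases "u \<in> {0<..<1}")
    case True
    define w where "w = (t - r) * u"
    have w: "t + (- (t - r)) * u = t - w" "t - w - r = (t - r) * (1 - u)"
      by (simp_all only: w_def) (simp_all add: algebra_simps)
    have "w < (t - r) * 1" "0 < w"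
      using True rt by (simp_all add: w_def del: mult_1_right)
    then have "k (t - w) = frac_kernel a w * frac_kernel b ((t - r) * (1 - u))"
      by (simp add: k_def flip: w(2))
    then have "k (t + (- (t - r)) * u) = frac_kernel a ((t - r) * u) * frac_kernel b ((t - r) * (1 - u))"
      by (simp only: w(1) w_def)
    also have "\<dots> = (t - r) powr (a - 1) * u powr (a - 1) * ((t - r) powr (b - 1) * (1 - u) powr (b - 1)) / (Gamma a * Gamma b)"
      using True rt by (simp add: frac_kernel_def powr_mult)
    also have "(t - r) powr (a - 1) * u powr (a - 1) * ((t - r) powr (b - 1) * (1 - u) powr (b - 1))
        = (t - r) powr (a + b - 2) * (u powr (a - 1) * (1 - u) powr (b - 1))"
      using rt by (simp add: powr_add[symmetric, of "t - r" "a - 1" "b - 1"] algebra_simps flip: powr_add)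
    finally show ?thesis using True by (simp add: c_def)
  next
    case False
    have "t + (- (t - r)) * u \<notin> {r<..<t}"
    proof
      assume *: "t + (- (t - r)) * u \<in> {r<..<t}"
      then have "r < t - (t - r) * u \<and> t - (t - r) * u < t"
        by (simp only: mult_minus_left add_uminus_conv_diff greaterThanLessThan_iff)
      then have "0 < (t - r) * u" "(t - r) * u < t - r" by linarith+
      then have "0 < u" "u < 1"
        using rt mult_less_cancel_left_pos[of "t - r" u 1] by (auto simp: zero_less_mult_iff)
      then show False using False by simp
    qed
    then have "k (t + (- (t - r)) * u) = 0" unfolding k_def by (metis indicator_simps(2) mult_zero_left)
    then show ?thesis using False by (metis mult_zero_right)
  qed
  have "((\<lambda>u. u powr (a - 1) * (1 - u) powr (b - 1)) has_integral Beta a b) {0<..<1}"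
    using has_integral_Beta_real[OF a b] by (simp add: has_integral_Icc_iff_Ioo)
  then have "((\<lambda>u. if u \<in> {0<..<1} then u powr (a - 1) * (1 - u) powr (b - 1) else 0) has_integral Beta a b) UNIV"
    by (simp only: has_integral_restrict_UNIV)
  then have "((\<lambda>u. k (t + (- (t - r)) * u)) has_integral c * Beta a b) UNIV"
    unfolding kaff by (rule has_integral_mult_right)
  then have I: "(\<integral>\<^sup>+u. ennreal (k (t + (- (t - r)) * u)) \<partial>lborel) = ennreal (c * Beta a b)"
    by (rule nn_integral_has_integral_lborel[rotated 2]) (auto simp: k0)
  have "(\<integral>\<^sup>+s. ennreal (k s) \<partial>lborel) = ennreal \<bar>- (t - r)\<bar> * ennreal (c * Beta a b)"
    using nn_integral_real_affine[of "\<lambda>s. ennreal (k s)" "- (t - r)" t] rt I by simp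
  also have "\<dots> = ennreal ((t - r) * (c * Beta a b))" using rt by (simp add: ennreal_mult')
  also have "(t - r) * (c * Beta a b) = frac_kernel (a + b) (t - r)"
  proof -
    have "(t - r) powr (a + b - 1) = (t - r) powr (a + b - 2) * (t - r) powr 1"
      by (subst powr_add[symmetric]) simp
    then show ?thesis using G rt by (simp add: c_def Beta_def frac_kernel_def)
  qed
  finally have "(\<integral>\<^sup>+s. ennreal (k s) \<partial>lborel) = ennreal (frac_kernel (a + b) (t - r))" .
  then have "integrable lborel k \<and> integral\<^sup>L lborel k = frac_kernel (a + b) (t - r)"
    using nn_integral_eq_integrable[of k lborel "frac_kernel (a + b) (t - r)"] k0 a b
    by (simp add: frac_kernel_nonneg)
  then show "integrable lborel (\<lambda>s. indicator {r<..<t} s * (frac_kernel a (t - s) * frac_kernel b (s - r)))"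
    and "(\<integral>s. indicator {r<..<t} s * (frac_kernel a (t - s) * frac_kernel b (s - r)) \<partial>lborel)
      = frac_kernel (a + b) (t - r)"
    by (simp_all add: k_def)
qed

text \<open>Fubini on the triangle \<open>0 < r < s < t\<close>; the inner integral over
  \<open>s\<close> is the Beta identity. Integrability is asked only against the kernel of order
  \<open>a + b\<close>, so that \<open>h\<close> may be an unbounded time derivative.\<close>

lemma frac_int_frac_int:
  assumes a: "0 < a" and b: "0 < b" and h: "h \<in> borel_measurable borel"
    and int: "set_integrable lborel {0<..<t} (\<lambda>s. frac_kernel (a + b) (t - s) * h s)"
  shows "frac_int a (frac_int b h) t = frac_int (a + b) h t"
proof -
  note [measurable] = h
  define k where "k = (\<lambda>s r. if 0 < r \<and> r < s \<and> s < t
      then frac_kernel a (t - s) * (frac_kernel b (s - r) * h r) else 0)"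
  have k_r: "k s r = (if 0 < r \<and> r < t then h r * (indicator {r<..<t} s *
      (frac_kernel a (t - s) * frac_kernel b (s - r))) else 0)" for s r
    by (auto simp: k_def indicator_def)
  have k_s: "k s r = indicator {0<..<t} s * frac_kernel a (t - s) *
      (indicator {0<..<s} r * (frac_kernel b (s - r) * h r))" for s r
    by (auto simp: k_def indicator_def)
  have norm_r: "norm (k s r) = (if 0 < r \<and> r < t then \<bar>h r\<bar> * (indicator {r<..<t} s *
      (frac_kernel a (t - s) * frac_kernel b (s - r))) else 0)" for s r
    using frac_kernel_nonneg[OF a] frac_kernel_nonneg[OF b] by (simp add: k_r abs_mult)
  have int_s: "(\<integral>s. k s r \<partial>lborel) = indicator {0<..<t} r * (frac_kernel (a + b) (t - r) * h r)" for r
    using frac_kernel_Beta[OF a b, of r t] unfolding k_r by (cases "0 < r \<and> r < t") auto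
  have int_norm: "(\<integral>s. norm (k s r) \<partial>lborel)
      = \<bar>indicator {0<..<t} r * (frac_kernel (a + b) (t - r) * h r)\<bar>" for r
    using frac_kernel_Beta[OF a b, of r t] frac_kernel_nonneg[of "a + b"] a b
    unfolding norm_r by (cases "0 < r \<and> r < t") (auto simp: abs_mult)
  have "integrable (lborel \<Otimes>\<^sub>M lborel) (case_prod (\<lambda>r s. k s r))"
  proof (rule lborel_pair.Fubini_integrable)
    show "case_prod (\<lambda>r s. k s r) \<in> borel_measurable (lborel \<Otimes>\<^sub>M lborel)"
      unfolding k_def by measurable
    show "integrable lborel (\<lambda>r. \<integral>s. norm (case (r, s) of (r, s) \<Rightarrow> k s r) \<partial>lborel)"
      using integrable_norm[OF int[unfolded set_integrable_def]] by (simp only: int_norm[unfolded real_norm_def] case_prod_conv real_norm_def real_scaleR_def)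
    show "AE r in lborel. integrable lborel (\<lambda>s. case (r, s) of (r, s) \<Rightarrow> k s r)"
    proof (rule AE_I2)
      fix r
      show "integrable lborel (\<lambda>s. case (r, s) of (r, s) \<Rightarrow> k s r)"
        using frac_kernel_Beta(1)[OF a b, of r t] unfolding k_r case_prod_conv
        by (cases "0 < r \<and> r < t") auto
    qed
  qed
  then have "(\<integral>s. (\<integral>r. k s r \<partial>lborel) \<partial>lborel) = (\<integral>r. (\<integral>s. k s r \<partial>lborel) \<partial>lborel)"
    by (rule lborel_pair.Fubini_integral)
  moreover have "(\<integral>r. k s r \<partial>lborel) = indicator {0<..<t} s * (frac_kernel a (t - s) * frac_int b h s)" for s
    by (simp add: k_s frac_int_def set_lebesgue_integral_def)
  ultimately show ?thesis
    by (simp add: int_s frac_int_def set_lebesgue_integral_def)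
qed

lemma frac_int_semigroup:
  assumes "0 < a" "0 < b" "loc_bounded h"
  shows "frac_int a (frac_int b h) = frac_int (a + b) h"
proof
  fix t show "frac_int a (frac_int b h) t = frac_int (a + b) h t"
    using assms by (intro frac_int_frac_int frac_int_integrable) (auto simp: loc_bounded_measurable)
qed

lemma frac_int_continuous:
  assumes "0 < \<nu>" "loc_bounded h"
  shows "continuous_on UNIV (frac_int \<nu> h)"
proof (cases "\<nu> \<le> 1")
  case False
  then have "frac_int \<nu> h = frac_int 1 (frac_int (\<nu> - 1) h)"
    using assms by (simp add: frac_int_semigroup)
  moreover have "loc_bounded (frac_int (\<nu> - 1) h)"
    using False assms by (intro loc_bounded_frac_int) auto
  ultimately show ?thesis using frac_int_continuous_le1[of 1] by simp
qed (use frac_int_continuous_le1 assms in blast)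

lemma frac_int_1_eq: "frac_int 1 g t = (LINT s:{0<..<t}|lborel. g s)"
  unfolding frac_int_def by (intro set_lebesgue_integral_cong) (auto simp: frac_kernel_1)

text \<open>By the semigroup law the integral of order \<open>\<nu> + 1\<close> is the ordinary
  integral of the continuous function \<open>frac_int \<nu> h\<close>.\<close>

lemma frac_int_has_derivative:
  assumes \<nu>: "0 < \<nu>" and h: "loc_bounded h"
  shows "(frac_int (\<nu> + 1) h has_real_derivative frac_int \<nu> h t) (at t)"
proof -
  define g where "g = frac_int \<nu> h"
  have cont: "continuous_on S g" for S
    using continuous_on_subset[OF frac_int_continuous[OF \<nu> h]] by (auto simp: g_def)
  \<comment> \<open>A base point to the left of both 0 and \<open>t\<close>. Since \<open>g\<close>
    vanishes on nonpositive times, the integral may start there, and the derivative is two-sided at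
    every real \<open>t\<close>, including 0.\<close>
  define c where "c = - \<bar>t\<bar> - 1"
  have c0: "c < 0" by (simp add: c_def)
  have eq: "frac_int (\<nu> + 1) h s = integral {c..s} g" if "c \<le> s" for s
  proof -
    have z: "((g) has_integral 0) {c..0}"
      by (rule has_integral_eq[of _ "\<lambda>x. 0"]) (auto simp: g_def frac_int_nonpos)
    show ?thesis
    proof (cases "s \<le> 0")
      case True
      have "(g has_integral 0) {c..s}"
        by (rule has_integral_eq[of _ "\<lambda>x. 0"]) (use True in \<open>auto simp: g_def frac_int_nonpos\<close>)
      then show ?thesis using True by (simp add: frac_int_nonpos integral_unique)
    next
      case False
      have "frac_int (\<nu> + 1) h s = frac_int 1 g s"
        using \<nu> h by (simp add: g_def frac_int_semigroup add.commute)
      also have "\<dots> = integral {0<..<s} g"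
        unfolding frac_int_1_eq
      proof (rule set_borel_integral_eq_integral(2))
        have "set_integrable lborel {0..s} g"
          by (rule borel_integrable_atLeastAtMost') (rule cont)
        then show "set_integrable lborel {0<..<s} g"
          by (rule set_integrable_subset) auto
      qed
      also have "\<dots> = integral {0..s} g" by (simp add: integral_open_interval_real)
      also have "\<dots> = integral {c..s} g"
        using Henstock_Kurzweil_Integration.integral_combine[of c 0 s g] c0 False
          integrable_continuous_interval[OF cont] integral_unique[OF z] by simp
      finally show ?thesis .
    qed
  qed
  have "((\<lambda>s. integral {c..s} g) has_real_derivative g t) (at t within {c..t + 1})"
    by (rule integral_has_real_derivative[OF cont]) (auto simp: c_def)
  then have "((\<lambda>s. integral {c..s} g) has_real_derivative g t) (at t)"
    by (subst (asm) at_within_interior) (auto simp: c_def)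
  then have "(frac_int (\<nu> + 1) h has_real_derivative g t) (at t)"
    by (rule has_field_derivative_transform_within_open[of _ _ _ "{c<..}"]) (auto simp: c_def eq)
  then show ?thesis by (simp add: g_def)
qed

text \<open>Substitute \<open>u = \<omega> * (t - s)\<close> and enlarge the domain to all
  \<open>u \<ge> 0\<close>: the Gamma integral cancels the normalisation of the kernel. In the norm
  weighted by \<open>exp (- \<omega> t)\<close> fractional integration thus has norm at most
  \<open>\<omega> powr (- \<nu>)\<close>, as small as desired.\<close>

lemma frac_int_exp_le:
  assumes \<nu>: "0 < \<nu>" and \<omega>: "0 < \<omega>"
  shows "frac_int \<nu> (\<lambda>s. exp (\<omega> * s)) t \<le> \<omega> powr (- \<nu>) * exp (\<omega> * t)"
proof -
  define k where "k = (\<lambda>s. indicator {0<..<t} s * (frac_kernel \<nu> (t - s) * exp (\<omega> * s)))"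
  define K where "K = (\<lambda>u. \<omega> powr (1 - \<nu>) * exp (\<omega> * t) / Gamma \<nu> *
      (if u \<in> {0..} then u powr (\<nu> - 1) / exp u else 0))"
  have [measurable]: "k \<in> borel_measurable borel" unfolding k_def by measurable
  have G: "0 < Gamma \<nu>" using \<nu> by (simp add: Gamma_real_pos)
  have k0: "0 \<le> k s" for s using \<nu> by (simp add: k_def frac_kernel_nonneg)
  have K0: "0 \<le> K u" for u using G by (simp add: K_def)
  have kK: "k (t + (- (1 / \<omega>)) * u) \<le> K u" for u
  proof (cases "0 < u")
    case True
    have "k (t + (- (1 / \<omega>)) * u) \<le> frac_kernel \<nu> (u / \<omega>) * exp (\<omega> * (t - u / \<omega>))"
      using \<nu> by (simp add: k_def indicator_def frac_kernel_nonneg)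
    also have "\<dots> = K u"
    proof -
      have "(u / \<omega>) powr (\<nu> - 1) = u powr (\<nu> - 1) * \<omega> powr (1 - \<nu>)"
        using True \<omega> powr_minus[of \<omega> "\<nu> - 1"] by (simp add: powr_divide) (simp add: divide_inverse)
      moreover have "exp (\<omega> * (t - u / \<omega>)) = exp (\<omega> * t) / exp u"
        using \<omega> by (simp add: right_diff_distrib exp_diff)
      ultimately show ?thesis using True by (simp add: K_def frac_kernel_def mult_ac)
    qed
    finally show ?thesis .
  next
    case False
    then have "k (t + (- (1 / \<omega>)) * u) = 0" using \<omega> by (simp add: k_def indicator_def field_simps)
    then show ?thesis using K0 by simp
  qed
  have "((\<lambda>u. if u \<in> {0..} then u powr (\<nu> - 1) / exp u else 0) has_integral Gamma \<nu>) UNIV"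
    unfolding has_integral_restrict_UNIV by (rule Gamma_integral_real[OF \<nu>])
  then have "(K has_integral \<omega> powr (1 - \<nu>) * exp (\<omega> * t) / Gamma \<nu> * Gamma \<nu>) UNIV"
    unfolding K_def by (rule has_integral_mult_right)
  then have "(K has_integral \<omega> powr (1 - \<nu>) * exp (\<omega> * t)) UNIV" using G by simp
  moreover have [measurable]: "K \<in> borel_measurable borel" unfolding K_def by measurable
  ultimately have IK: "(\<integral>\<^sup>+u. ennreal (K u) \<partial>lborel) = ennreal (\<omega> powr (1 - \<nu>) * exp (\<omega> * t))"
    by (intro nn_integral_has_integral_lborel K0)
  have "(\<integral>\<^sup>+s. ennreal (k s) \<partial>lborel) = ennreal \<bar>- (1 / \<omega>)\<bar> * (\<integral>\<^sup>+u. ennreal (k (t + (- (1 / \<omega>)) * u)) \<partial>lborel)"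
    using \<omega> by (intro nn_integral_real_affine) auto
  also have "\<dots> \<le> ennreal \<bar>- (1 / \<omega>)\<bar> * (\<integral>\<^sup>+u. ennreal (K u) \<partial>lborel)"
    by (intro mult_left_mono nn_integral_mono ennreal_leI kK) auto
  also have "\<dots> = ennreal ((1 / \<omega>) * (\<omega> powr (1 - \<nu>) * exp (\<omega> * t)))"
    using \<omega> by (simp add: IK ennreal_mult'[symmetric])
  also have "(1 / \<omega>) * (\<omega> powr (1 - \<nu>) * exp (\<omega> * t)) = \<omega> powr (- \<nu>) * exp (\<omega> * t)"
    using \<omega> powr_add[of \<omega> 1 "- \<nu>"] by simp
  finally have le: "(\<integral>\<^sup>+s. ennreal (k s) \<partial>lborel) \<le> ennreal (\<omega> powr (- \<nu>) * exp (\<omega> * t))" .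
  have "integral\<^sup>L lborel k \<le> \<omega> powr (- \<nu>) * exp (\<omega> * t)"
    by (rule integral_real_bounded[OF _ le]) simp
  then show ?thesis
    by (simp add: frac_int_def set_lebesgue_integral_def k_def)
qed

subsection \<open>Regularity of the Volterra equation\<close>

lemma frac_int_abs_le:
  assumes \<nu>: "0 < \<nu>" and f: "loc_bounded f" and g: "loc_bounded g"
    and le: "\<And>s. 0 < s \<Longrightarrow> s < t \<Longrightarrow> \<bar>f s\<bar> \<le> g s"
  shows "\<bar>frac_int \<nu> f t\<bar> \<le> frac_int \<nu> g t"
proof -
  have "norm (frac_int \<nu> f t) \<le> frac_int \<nu> g t"
    unfolding frac_int_def set_lebesgue_integral_def
  proof (rule Bochner_Integration.integral_norm_bound_integral)
    fix s
    show "norm (indicator {0<..<t} s *\<^sub>R (frac_kernel \<nu> (t - s) * f s))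
        \<le> indicator {0<..<t} s *\<^sub>R (frac_kernel \<nu> (t - s) * g s)"
      using le[of s] frac_kernel_nonneg[OF \<nu>, of "t - s"]
      by (auto simp: indicator_def abs_mult mult_left_mono)
  qed (use frac_int_integrable[OF \<nu> f, of t] frac_int_integrable[OF \<nu> g, of t] in \<open>auto simp: set_integrable_def\<close>)
  then show ?thesis by simp
qed

lemma continuous_on_loc_bounded:
  fixes y :: "real \<Rightarrow> real"
  assumes "continuous_on {0..T} y"
  shows "loc_bounded (\<lambda>s. if s \<in> {0..T} then y s else 0)"
  unfolding loc_bounded_def
proof (intro conjI allI)
  have "(\<lambda>s. indicator {0..T} s *\<^sub>R y s) \<in> borel_measurable borel"
    using borel_measurable_continuous_on_indicator[OF _ assms] by simp
  moreover have "(\<lambda>s. indicator {0..T} s *\<^sub>R y s) = (\<lambda>s. if s \<in> {0..T} then y s else 0)"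
    by (auto simp: indicator_def)
  ultimately show "(\<lambda>s. if s \<in> {0..T} then y s else 0) \<in> borel_measurable borel" by simp
  have "bounded (y ` {0..T})"
    by (intro compact_imp_bounded compact_continuous_image assms compact_Icc)
  then obtain B where "0 < B" "\<forall>s\<in>{0..T}. \<bar>y s\<bar> \<le> B" by (auto simp: bounded_pos)
  then show "\<exists>B\<ge>0. \<forall>s\<in>{0<..<S}. \<bar>if s \<in> {0..T} then y s else 0\<bar> \<le> B" for S
    by (intro exI[of _ B]) auto
qed

lemma loc_bounded_exp: "loc_bounded (\<lambda>s. exp (\<omega> * s))"
  unfolding loc_bounded_def
proof (intro conjI allI)
  fix T :: real
  have "\<bar>exp (\<omega> * s)\<bar> \<le> exp (\<bar>\<omega>\<bar> * \<bar>T\<bar>)" if "s \<in> {0<..<T}" for s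
  proof -
    have "\<omega> * s \<le> \<bar>\<omega>\<bar> * \<bar>T\<bar>" using that by (intro mult_mono) auto
    then show ?thesis by simp
  qed
  then show "\<exists>B\<ge>0. \<forall>s\<in>{0<..<T}. \<bar>exp (\<omega> * s)\<bar> \<le> B" by (intro exI[of _ "exp (\<bar>\<omega>\<bar> * \<bar>T\<bar>)"]) auto
qed measurable

lemma loc_bounded_cmult: "loc_bounded g \<Longrightarrow> loc_bounded (\<lambda>s. c * g s)"
  using loc_bounded_lincomb[of "\<lambda>_. 0" g c] by (auto simp: loc_bounded_def)

lemma frac_int_cmult: "frac_int \<nu> (\<lambda>s. c * g s) t = c * frac_int \<nu> g t"
  by (simp add: frac_int_def mult.left_commute)

lemma exists_weight:
  assumes "0 < \<nu>" "0 < \<epsilon>"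
  shows "\<exists>\<omega>>0. \<omega> powr (- \<nu>) \<le> (\<epsilon>::real)"
proof (intro exI conjI)
  show "0 < \<epsilon> powr (- 1 / \<nu>)" using assms by simp
  show "(\<epsilon> powr (- 1 / \<nu>)) powr (- \<nu>) \<le> \<epsilon>" using assms by (simp add: powr_powr)
qed

text \<open>In a sufficiently strong exponential weight the right-hand side contracts by one half.
  Starting from any bound \<open>B\<close> for \<open>y\<close>, iteration gives
  \<open>B * (1 / 2) ^ n\<close> times the weight, for every \<open>n\<close>.\<close>

lemma volterra_unique:
  assumes \<alpha>: "0 < \<alpha>" and y: "loc_bounded y"
    and eq: "\<And>t. 0 < t \<Longrightarrow> t \<le> T \<Longrightarrow> y t = - lam * frac_int \<alpha> y t" and t: "0 < t" "t \<le> T"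
  shows "y t = 0"
proof -
  obtain \<omega> where \<omega>: "0 < \<omega>" "\<omega> powr (- \<alpha>) \<le> 1 / (2 * (\<bar>lam\<bar> + 1))"
  proof -
    have "0 < 1 / (2 * (\<bar>lam\<bar> + 1))" by simp
    from exists_weight[OF \<alpha> this] show ?thesis using that by blast
  qed
  obtain B where B: "0 \<le> B" "\<forall>s\<in>{0<..<T + 1}. \<bar>y s\<bar> \<le> B" using loc_boundedD[OF y] by metis
  have contr: "\<bar>lam\<bar> * \<omega> powr (- \<alpha>) \<le> 1 / 2"
  proof -
    have "\<bar>lam\<bar> * \<omega> powr (- \<alpha>) \<le> \<bar>lam\<bar> * (1 / (2 * (\<bar>lam\<bar> + 1)))" by (intro mult_left_mono \<omega>) auto
    also have "\<dots> \<le> 1 / 2" by (simp add: field_simps)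
    finally show ?thesis .
  qed
  have bound: "\<bar>y s\<bar> \<le> B * (1 / 2) ^ n * exp (\<omega> * s)" if "0 < s" "s \<le> T" for n s
    using that
  proof (induction n arbitrary: s)
    case 0
    then have "\<bar>y s\<bar> \<le> B" "1 \<le> exp (\<omega> * s)" using B \<omega> by auto
    then show ?case using mult_left_mono[of 1 "exp (\<omega> * s)" B] B by simp
  next
    case (Suc n)
    have "\<bar>frac_int \<alpha> y s\<bar> \<le> frac_int \<alpha> (\<lambda>s. (B * (1 / 2) ^ n) * exp (\<omega> * s)) s"
      using Suc by (intro frac_int_abs_le \<alpha> y loc_bounded_cmult loc_bounded_exp) auto
    also have "\<dots> \<le> (B * (1 / 2) ^ n) * (\<omega> powr (- \<alpha>) * exp (\<omega> * s))"
      unfolding frac_int_cmult using B by (intro mult_left_mono frac_int_exp_le \<alpha> \<omega>) auto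
    finally have *: "\<bar>lam\<bar> * \<bar>frac_int \<alpha> y s\<bar> \<le> \<bar>lam\<bar> * ((B * (1 / 2) ^ n) * (\<omega> powr (- \<alpha>) * exp (\<omega> * s)))"
      by (rule mult_left_mono) simp
    have "\<bar>y s\<bar> = \<bar>lam\<bar> * \<bar>frac_int \<alpha> y s\<bar>" using eq[OF Suc.prems] by (simp add: abs_mult)
    also note *
    also have "\<bar>lam\<bar> * ((B * (1 / 2) ^ n) * (\<omega> powr (- \<alpha>) * exp (\<omega> * s)))
        = (\<bar>lam\<bar> * \<omega> powr (- \<alpha>)) * ((B * (1 / 2) ^ n) * exp (\<omega> * s))" by simp
    also have "\<dots> \<le> (1 / 2) * ((B * (1 / 2) ^ n) * exp (\<omega> * s))"
      using B by (intro mult_right_mono contr) auto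
    finally show ?case by simp
  qed
  have "(\<lambda>n. B * (1 / 2) ^ n * exp (\<omega> * t)) \<longlonglongrightarrow> B * 0 * exp (\<omega> * t)"
    by (intro tendsto_intros LIMSEQ_power_zero) simp
  then have "\<bar>y t\<bar> \<le> B * 0 * exp (\<omega> * t)"
    by (rule LIMSEQ_le_const) (use bound[OF t] in blast)
  then show ?thesis by simp
qed

text \<open>If \<open>y\<close> is a fractional integral of order \<open>k * \<alpha>\<close>, the
  equation shows that it is one of order \<open>(k + 1) * \<alpha>\<close>, until the order of the
  source term is reached. Only boundedness of the density is carried along.\<close>

lemma volterra_regularity:
  assumes \<alpha>: "0 < \<alpha>" and g: "loc_bounded g" and y: "loc_bounded y"
    and eq: "\<And>t. 0 < t \<Longrightarrow> t \<le> T \<Longrightarrow> y t = frac_int (real (Suc m) * \<alpha>) g t - lam * frac_int \<alpha> y t"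
  shows "\<exists>h. loc_bounded h \<and> (\<forall>t\<in>{0<..T}. y t = frac_int (real (Suc m) * \<alpha>) h t)"
proof -
  \<comment> \<open>The start of the induction is treated separately because
    \<open>frac_int 0\<close> is not the identity.\<close>
  have "\<exists>h. loc_bounded h \<and> (\<forall>t\<in>{0<..T}. y t = (if k = 0 then h t else frac_int (real k * \<alpha>) h t))"
    if "k \<le> Suc m" for k
    using that
  proof (induction k)
    case 0
    then show ?case using y by auto
  next
    case (Suc k)
    then obtain h where h: "loc_bounded h"
      and yh: "\<And>t. t \<in> {0<..T} \<Longrightarrow> y t = (if k = 0 then h t else frac_int (real k * \<alpha>) h t)"
      by auto
    have Iy: "frac_int \<alpha> y t = frac_int (real (Suc k) * \<alpha>) h t" if "0 < t" "t \<le> T" for t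
    proof (cases "k = 0")
      case True
      then show ?thesis using yh that by (auto intro!: frac_int_cong)
    next
      case False
      then have "frac_int \<alpha> y t = frac_int \<alpha> (frac_int (real k * \<alpha>) h) t"
        using yh that by (intro frac_int_cong) auto
      also have "\<dots> = frac_int (\<alpha> + real k * \<alpha>) h t"
        using False \<alpha> h by (subst frac_int_semigroup) auto
      finally show ?thesis by (simp add: algebra_simps)
    qed
    show ?case
    proof (cases "k = m")
      case True
      have "y t = frac_int (real (Suc k) * \<alpha>) (\<lambda>s. g s + (- lam) * h s) t" if "t \<in> {0<..T}" for t
        using eq[of t] Iy[of t] that True \<alpha> g h by (subst frac_int_lincomb) auto
      then show ?thesis using loc_bounded_lincomb[OF g h, of "- lam"] by (intro exI[of _ "\<lambda>s. g s + (- lam) * h s"]) auto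
    next
      case False
      \<comment> \<open>The surplus order of the source is kept inside the density, so that source
        and memory term become integrals of the same order.\<close>
      define g' where "g' = frac_int (real (m - k) * \<alpha>) g"
      have km: "k < m" using False Suc by simp
      have g': "loc_bounded g'" unfolding g'_def using km \<alpha> g by (intro loc_bounded_frac_int) auto
      have ak: "0 < real (Suc k) * \<alpha>" "0 < real (m - k) * \<alpha>" using km \<alpha> by simp_all
      have "real (Suc k) * \<alpha> + real (m - k) * \<alpha> = real (Suc m) * \<alpha>"
        using km by (simp add: of_nat_diff algebra_simps)
      then have "frac_int (real (Suc m) * \<alpha>) g = frac_int (real (Suc k) * \<alpha>) g'"
        unfolding g'_def using frac_int_semigroup[OF ak g] by simp
      then have "y t = frac_int (real (Suc k) * \<alpha>) (\<lambda>s. g' s + (- lam) * h s) t" if "t \<in> {0<..T}" for t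
        using eq[of t] Iy[of t] that \<alpha> g' h by (subst frac_int_lincomb) auto
      then show ?thesis using loc_bounded_lincomb[OF g' h, of "- lam"] by (intro exI[of _ "\<lambda>s. g' s + (- lam) * h s"]) auto
    qed
  qed
  from this[of "Suc m"] show ?thesis by auto
qed

text \<open>Apply the integral of order \<open>\<alpha>\<close> to the equation: by the semigroup
  law the orders \<open>\<alpha>\<close> and \<open>1 - \<alpha>\<close> combine to an ordinary
  integral of \<open>y'\<close>, which is \<open>y\<close>. The delicate point is that
  \<open>y'\<close> is given only on \<open>{0<..T}\<close>, may be unbounded near 0, and is known
  only to be integrable against kernels.\<close>

lemma caputo_imp_volterra:
  assumes \<alpha>: "0 < \<alpha>" "\<alpha> < 1" and m: "0 < m" and g: "loc_bounded g"
    and cont: "continuous_on {0..T} y" and y0: "y 0 = 0"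
    and der: "\<And>t. t \<in> {0<..T} \<Longrightarrow> (y has_real_derivative y' t) (at t within {0<..T})"
    and int: "\<And>t. t \<in> {0<..T} \<Longrightarrow> set_integrable lborel {0<..<t} (\<lambda>s. frac_kernel (1 - \<alpha>) (t - s) * y' s)"
    and eq: "\<And>t. t \<in> {0<..T} \<Longrightarrow> frac_int (1 - \<alpha>) y' t + lam * y t = frac_int (real m * \<alpha>) g t"
    and t: "t \<in> {0<..T}"
  shows "y t = frac_int (real (Suc m) * \<alpha>) g t - lam * frac_int \<alpha> (\<lambda>s. if s \<in> {0..T} then y s else 0) t"
proof -
  define z where "z = (\<lambda>s. indicator {0<..<T} s * y' s)"
  define w where "w = (\<lambda>s. if s \<in> {0..T} then y s else 0)"
  have w: "loc_bounded w" unfolding w_def by (rule continuous_on_loc_bounded[OF cont])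
  have T: "0 < T" using t by auto
  have G: "0 < Gamma (1 - \<alpha>)" using \<alpha> by (simp add: Gamma_real_pos)
  have [measurable]: "z \<in> borel_measurable borel"
  proof -
    \<comment> \<open>Measurability of \<open>y'\<close> is extracted from the integrability of its
      product with the kernel at the final time, by dividing the positive kernel out.\<close>
    have "(\<lambda>s. indicator {0<..<T} s * (frac_kernel (1 - \<alpha>) (T - s) * y' s) / frac_kernel (1 - \<alpha>) (T - s))
        \<in> borel_measurable borel"
      using borel_measurable_integrable[OF int[of T, unfolded set_integrable_def]] T
      by (intro borel_measurable_divide) simp_all
    also have "(\<lambda>s. indicator {0<..<T} s * (frac_kernel (1 - \<alpha>) (T - s) * y' s) / frac_kernel (1 - \<alpha>) (T - s)) = z"
      using G by (auto simp: z_def frac_kernel_def indicator_def)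
    finally show ?thesis .
  qed
  have zint: "set_integrable lborel {0<..<t} z"
  proof (rule set_integrable_bound)
    \<comment> \<open>The kernel of order \<open>1 - \<alpha>\<close> is decreasing, so on
      \<open>{0<..<t}\<close> it is at least its value at distance \<open>t\<close>. Dividing by
      this bound makes \<open>y'\<close> itself integrable.\<close>
    define K where "K = frac_kernel (1 - \<alpha>) t"
    have K: "0 < K" using G t by (simp add: K_def frac_kernel_def)
    show "set_integrable lborel {0<..<t} (\<lambda>s. (1 / K) * (frac_kernel (1 - \<alpha>) (t - s) * y' s))"
      using int[OF t] by (intro set_integrable_mult_right) simp
    show "set_borel_measurable lborel {0<..<t} z" by (simp add: set_borel_measurable_def)
    have "\<bar>z s\<bar> \<le> \<bar>(1 / K) * (frac_kernel (1 - \<alpha>) (t - s) * y' s)\<bar>" if "s \<in> {0<..<t}" for s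
    proof -
      have "K \<le> frac_kernel (1 - \<alpha>) (t - s)"
        unfolding K_def using that \<alpha> by (intro frac_kernel_antimono) auto
      then have "\<bar>y' s\<bar> * K \<le> \<bar>y' s\<bar> * frac_kernel (1 - \<alpha>) (t - s)" by (rule mult_left_mono) simp
      moreover have "z s = y' s" using that t by (simp add: z_def)
      ultimately show ?thesis using K \<alpha> frac_kernel_nonneg[of "1 - \<alpha>" "t - s"]
        by (simp add: abs_mult field_simps)
    qed
    then show "AE s in lborel. s \<in> {0<..<t} \<longrightarrow> norm (z s) \<le> norm ((1 / K) * (frac_kernel (1 - \<alpha>) (t - s) * y' s))"
      by simp
  qed
  have "(y' has_integral y t - y 0) {0..t}"
  proof (rule fundamental_theorem_of_calculus_interior)
    show "continuous_on {0..t} y" using continuous_on_subset[OF cont] t by auto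
    fix s assume s: "s \<in> {0<..<t}"
    then have "at s within {0<..T} = at s" using t by (intro at_within_interior) auto
    then show "(y has_vector_derivative y' s) (at s)"
      using der[of s] s t by (simp add: has_real_derivative_iff_has_vector_derivative)
  qed (use t in auto)
  then have "(y' has_integral y t) {0<..<t}" using y0 by (simp add: has_integral_Icc_iff_Ioo)
  then have "(z has_integral y t) {0<..<t}"
    by (rule has_integral_eq[rotated]) (use t in \<open>auto simp: z_def\<close>)
  then have yt: "y t = frac_int 1 z t"
    using set_borel_integral_eq_integral(2)[OF zint] by (simp add: frac_int_1_eq integral_unique)
  have "frac_int 1 z t = frac_int \<alpha> (frac_int (1 - \<alpha>) z) t"
  proof -
    have "set_integrable lborel {0<..<t} (\<lambda>s. frac_kernel 1 (t - s) * z s)"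
      using zint by (subst set_integrable_cong[of _ _ _ _ _ z]) (auto simp: frac_kernel_1)
    then show ?thesis
      using frac_int_frac_int[of \<alpha> "1 - \<alpha>" z t] \<alpha> by simp
  qed
  also have "\<dots> = frac_int \<alpha> (\<lambda>s. frac_int (real m * \<alpha>) g s + (- lam) * w s) t"
  proof (rule frac_int_cong)
    fix s assume s: "0 < s" "s < t"
    have "frac_int (1 - \<alpha>) z s = frac_int (1 - \<alpha>) y' s"
      by (rule frac_int_cong) (use s t in \<open>auto simp: z_def\<close>)
    then show "frac_int (1 - \<alpha>) z s = frac_int (real m * \<alpha>) g s + (- lam) * w s"
      using eq[of s] s t by (simp add: w_def)
  qed
  also have "\<dots> = frac_int \<alpha> (frac_int (real m * \<alpha>) g) t + (- lam) * frac_int \<alpha> w t"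
    using \<alpha> m g w by (intro frac_int_lincomb loc_bounded_frac_int) auto
  also have "frac_int \<alpha> (frac_int (real m * \<alpha>) g) = frac_int (real (Suc m) * \<alpha>) g"
    using \<alpha> m g by (subst frac_int_semigroup) (auto simp: algebra_simps)
  finally show ?thesis using yt by (simp add: w_def)
qed

text \<open>With \<open>y\<close> an integral of order \<open>3 + \<alpha>\<close> of a bounded
  density \<open>h\<close>, its derivatives are the integrals of orders \<open>2 + \<alpha>\<close>,
  \<open>1 + \<alpha>\<close> and \<open>\<alpha>\<close>. They vanish at 0, and the last one is
  Hoelder continuous. The final conclusion rewrites the source of the scheme in terms of
  \<open>y1\<close>, which turns the scheme into a discretisation of an identity for
  \<open>y1\<close>.\<close>

lemma volterra_smooth:
  assumes \<alpha>: "0 < \<alpha>" "\<alpha> < 1" and T: "0 < T" and g: "loc_bounded g" and w: "loc_bounded w"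
    and \<mu>: "\<mu> = real (Suc m) * \<alpha>" "3 + \<alpha> \<le> \<mu>"
    and eq0: "\<forall>t\<in>{0<..T}. w t = frac_int \<mu> g t - lam * frac_int \<alpha> w t"
  shows "\<exists>y y1 y2 y3 C. (\<forall>t\<in>{0<..T}. w t = y t) \<and> y 0 = 0 \<and> y1 0 = 0 \<and> y2 0 = 0 \<and> y3 0 = 0
    \<and> (\<forall>t. (y has_real_derivative y1 t) (at t)) \<and> (\<forall>t. (y1 has_real_derivative y2 t) (at t))
    \<and> (\<forall>t. (y2 has_real_derivative y3 t) (at t))
    \<and> (\<forall>a b. a \<le> b \<longrightarrow> b \<le> T \<longrightarrow> \<bar>y3 b - y3 a\<bar> \<le> C * (b - a) powr \<alpha>) \<and> 0 \<le> C
    \<and> (\<forall>t\<in>{0<..T}. frac_int (\<mu> - 1) g t = y1 t + lam * frac_int \<alpha> y1 t)"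
proof -
  have eq: "w t = frac_int \<mu> g t - lam * frac_int \<alpha> w t" if "0 < t" "t \<le> T" for t
    using eq0 that by auto
  obtain h0 where h0: "loc_bounded h0" "\<forall>t\<in>{0<..T}. w t = frac_int \<mu> h0 t"
    using volterra_regularity[OF \<alpha>(1) g w, of T m lam] eq \<mu>(1) by auto
  define h where "h = (if \<mu> = 3 + \<alpha> then h0 else frac_int (\<mu> - (3 + \<alpha>)) h0)"
  have h: "loc_bounded h"
    unfolding h_def using h0(1) \<mu>(2) by (auto intro!: loc_bounded_frac_int)
  have I: "frac_int \<mu> h0 = frac_int (3 + \<alpha>) h"
  proof (cases "\<mu> = 3 + \<alpha>")
    case False
    then show ?thesis
      using frac_int_semigroup[OF _ _ h0(1), of "3 + \<alpha>" "\<mu> - (3 + \<alpha>)"] \<mu>(2) \<alpha> by (simp add: h_def)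
  qed (simp add: h_def)
  define y where "y = frac_int (3 + \<alpha>) h"
  define y1 where "y1 = frac_int (2 + \<alpha>) h"
  define y2 where "y2 = frac_int (1 + \<alpha>) h"
  define y3 where "y3 = frac_int \<alpha> h"
  have wy: "w t = y t" if "t \<in> {0<..T}" for t using h0(2) I that by (simp add: y_def)
  have d1: "(y has_real_derivative y1 t) (at t)" for t
    using frac_int_has_derivative[of "2 + \<alpha>" h t] \<alpha> h by (simp add: y_def y1_def add.commute add.left_commute)
  have d2: "(y1 has_real_derivative y2 t) (at t)" for t
    using frac_int_has_derivative[of "1 + \<alpha>" h t] \<alpha> h by (simp add: y2_def y1_def add.commute add.left_commute)
  have d3: "(y2 has_real_derivative y3 t) (at t)" for t
    using frac_int_has_derivative[of "\<alpha>" h t] \<alpha> h by (simp add: y2_def y3_def add.commute)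
  obtain B where B: "0 \<le> B" "\<forall>s\<in>{0<..<T}. \<bar>h s\<bar> \<le> B" using loc_boundedD[OF h] by metis
  define C where "C = 2 * B / Gamma (\<alpha> + 1)"
  have C: "0 \<le> C" using B \<alpha> by (auto simp: C_def intro!: divide_nonneg_nonneg Gamma_real_nonneg)
  have hol: "\<bar>y3 b - y3 a\<bar> \<le> C * (b - a) powr \<alpha>" if "a \<le> b" "b \<le> T" for a b
  proof (cases "a = b")
    case False
    then show ?thesis
      unfolding y3_def C_def using that B \<alpha> by (intro frac_int_Holder h) auto
  qed simp
  \<comment> \<open>The Volterra equation is differentiated on both sides. It is known only on
    \<open>{0..T}\<close>, so the derivatives are compared within that interval, one-sidedly at
    \<open>T\<close>.\<close>
  have F: "frac_int (\<mu> - 1) g t = y1 t + lam * frac_int \<alpha> y1 t" if t: "t \<in> {0<..T}" for t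
  proof -
    have "frac_int \<alpha> y = frac_int (2 + 2 * \<alpha> + 1) h" "frac_int \<alpha> y1 = frac_int (2 + 2 * \<alpha>) h"
      unfolding y_def y1_def using \<alpha> h by (subst frac_int_semigroup; simp add: algebra_simps)+
    then have "(frac_int \<alpha> y has_real_derivative frac_int \<alpha> y1 t) (at t)"
      using frac_int_has_derivative[of "2 + 2 * \<alpha>" h t] \<alpha> h by simp
    then have "((\<lambda>s. y s + lam * frac_int \<alpha> y s) has_real_derivative y1 t + lam * frac_int \<alpha> y1 t) (at t)"
      by (intro derivative_intros d1 DERIV_cmult)
    then have R: "((\<lambda>s. y s + lam * frac_int \<alpha> y s) has_real_derivative y1 t + lam * frac_int \<alpha> y1 t)
        (at t within {0..T})" by (rule has_field_derivative_at_within)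
    have "(frac_int \<mu> g has_real_derivative frac_int (\<mu> - 1) g t) (at t within {0..T})"
      using frac_int_has_derivative[of "\<mu> - 1" g t] \<alpha> \<mu>(2) g by (simp add: has_field_derivative_at_within)
    then have L: "((\<lambda>s. y s + lam * frac_int \<alpha> y s) has_real_derivative frac_int (\<mu> - 1) g t) (at t within {0..T})"
    proof (rule has_field_derivative_transform_within[OF _ zero_less_one])
      fix s assume "s \<in> {0..T}"
      show "frac_int \<mu> g s = y s + lam * frac_int \<alpha> y s"
      proof (cases "s = 0")
        case False
        then have s: "s \<in> {0<..T}" using \<open>s \<in> {0..T}\<close> by auto
        have "frac_int \<alpha> w s = frac_int \<alpha> y s" using wy s by (intro frac_int_cong) auto
        then show ?thesis using eq[of s] wy[OF s] s by simp
      qed (simp add: y_def frac_int_nonpos)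
    qed (use t in auto)
    have "at t within {0..T} \<noteq> bot" using T t by (simp add: trivial_limit_within islimpt_Icc)
    then show ?thesis using has_field_derivative_unique[OF L R] by blast
  qed
  have z: "y 0 = 0" "y1 0 = 0" "y2 0 = 0" "y3 0 = 0"
    by (simp_all add: y_def y1_def y2_def y3_def frac_int_nonpos)
  show ?thesis
    by (intro exI[of _ y] exI[of _ y1] exI[of _ y2] exI[of _ y3] exI[of _ C] conjI ballI allI impI)
      (simp_all only: wy z d1 d2 d3 hol C F)
qed

subsection \<open>Discrete Caputo derivative\<close>

lemma mesh_less:
  assumes "time_mesh T N t" "i < j" "j \<le> N"
  shows "t i < t j"
  using assms(2,3)
proof (induction j)
  case (Suc j)
  have "t j < t (Suc j)" using assms(1) Suc.prems by (simp add: time_mesh_def)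
  then show ?case using Suc by (cases "i = j") auto
qed simp

lemma mesh_le: "time_mesh T N t \<Longrightarrow> i \<le> j \<Longrightarrow> j \<le> N \<Longrightarrow> t i \<le> t j"
  using mesh_less[of T N t i j] by (cases "i = j") auto

lemma mesh_range: "time_mesh T N t \<Longrightarrow> j \<le> N \<Longrightarrow> 0 \<le> t j \<and> t j \<le> T"
  using mesh_le[of T N t 0 j] mesh_le[of T N t j N] by (auto simp: time_mesh_def)

lemma step_pos: "time_mesh T N t \<Longrightarrow> 1 \<le> j \<Longrightarrow> j \<le> N \<Longrightarrow> 0 < step t j"
  using mesh_less[of T N t "j - 1" j] by (simp add: step_def)

lemma step_mono:
  assumes "time_mesh T N t" "\<And>k. k \<in> {2..N} \<Longrightarrow> 1 \<le> ratio t k" "1 \<le> i" "i \<le> j" "j \<le> N"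
  shows "step t i \<le> step t j"
  using assms(4,5)
proof (induction j rule: dec_induct)
  case (step j)
  have "1 \<le> step t (Suc j) / step t j"
    using assms(2)[of "Suc j"] assms(3) step by (auto simp: ratio_def)
  then have "step t j \<le> step t (Suc j)"
    using step_pos[OF assms(1), of j] assms(3) step by (simp add: field_simps)
  then show ?case using step by auto
qed simp

lemma set_integral_mesh:
  fixes f :: "real \<Rightarrow> real" and t :: "nat \<Rightarrow> real"
  assumes "\<And>j. 1 \<le> j \<Longrightarrow> j \<le> n \<Longrightarrow> t (j - 1) < t j"
    and "\<And>j. 1 \<le> j \<Longrightarrow> j \<le> n \<Longrightarrow> set_integrable lborel {t (j - 1)<..<t j} f"
  shows "set_integrable lborel {t 0<..<t n} f
    \<and> (LINT s:{t 0<..<t n}|lborel. f s) = (\<Sum>j=1..n. LINT s:{t (j - 1)<..<t j}|lborel. f s)"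
  using assms
proof (induction n)
  case 0
  then show ?case by (simp add: set_integrable_def set_lebesgue_integral_def)
next
  case (Suc n)
  have IH: "set_integrable lborel {t 0<..<t n} f"
    "(LINT s:{t 0<..<t n}|lborel. f s) = (\<Sum>j=1..n. LINT s:{t (j - 1)<..<t j}|lborel. f s)"
    using Suc by auto
  have le: "t 0 \<le> t n"
  proof -
    have "t 0 \<le> t j" if "j \<le> n" for j
      using that
    proof (induction j)
      case (Suc j)
      then show ?case using Suc.prems \<open>\<And>j. 1 \<le> j \<Longrightarrow> j \<le> Suc n \<Longrightarrow> t (j - 1) < t j\<close>[of "Suc j"] by simp
    qed simp
    then show ?thesis by simp
  qed
  have lt: "t n < t (Suc n)" using Suc.prems(1)[of "Suc n"] by simp
  have s1: "set_integrable lborel {t n<..<t (Suc n)} f" using Suc.prems(2)[of "Suc n"] by simp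
  have s0: "set_integrable lborel {t n} f"
  proof -
    have "(\<lambda>x. indicator {t n} x *\<^sub>R f x) = (\<lambda>x. indicator {t n} x *\<^sub>R f (t n))"
      by (auto simp: indicator_def)
    then show ?thesis unfolding set_integrable_def by (simp add: integrable_indicator_iff)
  qed
  have sB: "set_integrable lborel ({t 0<..<t n} \<union> {t n<..<t (Suc n)}) f"
    by (rule set_integrable_Un[OF IH(1) s1]) auto
  have "set_integrable lborel ({t 0<..<t n} \<union> {t n<..<t (Suc n)} \<union> {t n}) f"
    by (rule set_integrable_Un[OF sB s0]) auto
  then have sA: "set_integrable lborel {t 0<..<t (Suc n)} f"
    by (rule set_integrable_subset) auto
  have "(LINT s:{t 0<..<t (Suc n)}|lborel. f s) = (LINT s:{t 0<..<t n} \<union> {t n<..<t (Suc n)}|lborel. f s)"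
  proof (rule set_integral_cong_set)
    show "set_borel_measurable lborel ({t 0<..<t n} \<union> {t n<..<t (Suc n)}) f"
      and "set_borel_measurable lborel {t 0<..<t (Suc n)} f"
      using sA sB by (auto simp: set_integrable_def set_borel_measurable_def)
    have "AE x in lborel. x \<noteq> t n" by (rule AE_lborel_singleton)
    then show "AE x in lborel. (x \<in> {t 0<..<t n} \<union> {t n<..<t (Suc n)}) = (x \<in> {t 0<..<t (Suc n)})"
      by eventually_elim (use le lt in auto)
  qed
  also have "\<dots> = (LINT s:{t 0<..<t n}|lborel. f s) + (LINT s:{t n<..<t (Suc n)}|lborel. f s)"
    by (rule set_integral_Un[OF _ IH(1) s1]) auto
  finally show ?case using sA IH(2) by simp
qed

section \<open>Newton form of the interpolants\<close>

lemma newton_cell_identity: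
  fixes p q x :: real
  assumes "0 < p" "0 < q"
  shows "w0 * ((x - p) * (x - (p + q))) / (p * (p + q)) - w1 * (x * (x - (p + q))) / (p * q)
      + w2 * (x * (x - p)) / ((p + q) * q)
    = w1 + (w1 - w0) / p * (x - p) + ((w2 - w1) / q - (w1 - w0) / p) / (p + q) * ((x - p) * x)"
proof -
  \<comment> \<open>Reciprocals become indeterminates subject to polynomial relations, which reduces
    the rational identity to ideal membership.\<close>
  define P Q S where "P = inverse p" and "Q = inverse q" and "S = inverse (p + q)"
  have "p * P = 1" "q * Q = 1" "(p + q) * S = 1" using assms by (auto simp: P_def Q_def S_def)
  then have "w0 * ((x - p) * (x - (p + q))) * (P * S) - w1 * (x * (x - (p + q))) * (P * Q)
      + w2 * (x * (x - p)) * (S * Q)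
    = w1 + (w1 - w0) * P * (x - p) + ((w2 - w1) * Q - (w1 - w0) * P) * S * ((x - p) * x)"
    by algebra
  then show ?thesis by (simp add: divide_inverse P_def Q_def S_def)
qed

lemma lagrange2_newton:
  assumes "a < b" "b < (c::real)"
  shows "w0 * ((s - b) * (s - c)) / ((a - b) * (a - c)) + w1 * ((s - a) * (s - c)) / ((b - a) * (b - c))
      + w2 * ((s - a) * (s - b)) / ((c - a) * (c - b))
    = w1 + (w1 - w0) / (b - a) * (s - b) + ((w2 - w1) / (c - b) - (w1 - w0) / (b - a)) / (c - a) * ((s - b) * (s - a))"
proof -
  have e1: "(a - b) * (a - c) = (b - a) * ((b - a) + (c - b))"
    and e2: "(b - a) * (b - c) = - ((b - a) * (c - b))"
    and e3: "(c - a) * (c - b) = ((b - a) + (c - b)) * (c - b)"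
    and e4: "c - a = (b - a) + (c - b)" "s - b = (s - a) - (b - a)" "s - c = (s - a) - ((b - a) + (c - b))"
    by (simp_all add: algebra_simps)
  have "w0 * ((s - b) * (s - c)) / ((a - b) * (a - c)) + w1 * ((s - a) * (s - c)) / ((b - a) * (b - c))
      + w2 * ((s - a) * (s - b)) / ((c - a) * (c - b))
    = w0 * ((s - b) * (s - c)) / ((b - a) * ((b - a) + (c - b))) - w1 * ((s - a) * (s - c)) / ((b - a) * (c - b))
      + w2 * ((s - a) * (s - b)) / (((b - a) + (c - b)) * (c - b))"
    unfolding e1 e2 e3 by simp
  also have "\<dots> = w1 + (w1 - w0) / (b - a) * (s - b) + ((w2 - w1) / (c - b) - (w1 - w0) / (b - a)) / ((b - a) + (c - b)) * ((s - b) * (s - a))"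
    using newton_cell_identity[of "b - a" "c - b" w0 "s - a" w1 w2] assms unfolding e4(2,3) by simp
  finally show ?thesis by simp
qed

text \<open>The derivative on cell \<open>j\<close> in Newton form. It depends on \<open>w\<close>
  only through difference quotients, which are the unknowns of the stability analysis, and it is an
  affine function of \<open>s\<close> on the whole line, so continuity needs no care at the mesh
  points. The index \<open>i\<close> is the stencil, shifted back by one on the last cell.\<close>

definition interp_slope :: "(nat \<Rightarrow> real) \<Rightarrow> nat \<Rightarrow> (nat \<Rightarrow> real) \<Rightarrow> nat \<Rightarrow> real \<Rightarrow> real" where
  "interp_slope t k w j s = (if k = 1 then diff_quot t w 1 else
     let i = min j (k - 1) in diff_quot t w i + (2 * s - t (i - 1) - t i) / (t (i + 1) - t (i - 1)) *
       (diff_quot t w (i + 1) - diff_quot t w i))"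

lemma lagrange1_eq_newton:
  assumes "t 0 < t 1"
  shows "lagrange1 t w s = w 0 + diff_quot t w 1 * (s - t 0)"
proof -
  define p x where "p = t 1 - t 0" and "x = s - t 0"
  have p: "0 < p" using assms by (simp add: p_def)
  have e: "s - t 1 = x - p" "t 0 - t 1 = - p" "t 1 - t 0 = p" "s - t 0 = x" by (auto simp: p_def x_def)
  have "w 0 * (x - p) / (- p) + w 1 * x / p = w 0 + (w 1 - w 0) / p * x"
    using p by (simp add: field_simps)
  moreover have "diff_quot t w 1 = (w 1 - w 0) / p" by (simp add: diff_quot_def step_def p_def)
  ultimately show ?thesis unfolding lagrange1_def e by simp
qed

lemma lagrange2_eq_newton:
  assumes "t (i - 1) < t i" "t i < t (i + 1)"
  shows "lagrange2 t i w s = w i + diff_quot t w i * (s - t i) +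
    (diff_quot t w (i + 1) - diff_quot t w i) / (t (i + 1) - t (i - 1)) * ((s - t i) * (s - t (i - 1)))"
  unfolding lagrange2_def lagrange2_newton[OF assms] by (simp add: diff_quot_def step_def)

lemma interpolant_eq:
  assumes mesh: "time_mesh T N t" and k: "1 \<le> k" "k \<le> N" "1 \<le> j" "j \<le> k" and s: "t (j - 1) < s" "s \<le> t j"
  shows "interpolant t k w s = (if k = 1 then lagrange1 t w s else lagrange2 t (min j (k - 1)) w s)"
proof -
  have "(LEAST i. s \<le> t i) = j"
  proof (rule Least_equality)
    show "s \<le> t j" by (rule s(2))
    fix i assume i: "s \<le> t i"
    show "j \<le> i"
    proof (rule ccontr)
      assume "\<not> j \<le> i"
      then have "t i \<le> t (j - 1)" using k by (intro mesh_le[OF mesh]) auto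
      then show False using i s by simp
    qed
  qed
  then show ?thesis by (simp add: interpolant_def)
qed

text \<open>Inside an open cell the interpolant coincides near \<open>s\<close> with one polynomial.
  At the mesh points its slope may jump, but these form a null set for the memory integral.\<close>

lemma interpolant_deriv:
  assumes mesh: "time_mesh T N t" and k: "1 \<le> k" "k \<le> N" "1 \<le> j" "j \<le> k" and s: "t (j - 1) < s" "s < t j"
  shows "deriv (interpolant t k w) s = interp_slope t k w j s"
proof (rule DERIV_imp_deriv)
  show "(interpolant t k w has_real_derivative interp_slope t k w j s) (at s)"
  proof (cases "k = 1")
    case True
    have "t 0 < t 1" using mesh_less[OF mesh, of 0 1] k by simp
    then have "((\<lambda>s. w 0 + diff_quot t w 1 * (s - t 0)) has_real_derivative interp_slope t k w j s) (at s)"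
      using True by (auto intro!: derivative_eq_intros simp: interp_slope_def)
    then show ?thesis
      by (rule has_field_derivative_transform_within_open[of _ _ _ "{t (j - 1)<..<t j}"])
        (use s True k \<open>t 0 < t 1\<close> interpolant_eq[OF mesh k] lagrange1_eq_newton in auto)
  next
    case False
    define i where "i = min j (k - 1)"
    have i: "1 \<le> i" "i + 1 \<le> k" using False k by (auto simp: i_def)
    then have lt: "t (i - 1) < t i" "t i < t (i + 1)" using k by (auto intro: mesh_less[OF mesh])
    have slope: "interp_slope t k w j s = diff_quot t w i + (diff_quot t w (i + 1) - diff_quot t w i) /
        (t (i + 1) - t (i - 1)) * (2 * s - t (i - 1) - t i)"
      unfolding interp_slope_def Let_def i_def using False by simp
    have "((\<lambda>s. A + B * (s - c) + K * ((s - c) * (s - a))) has_real_derivative B + K * (2 * s - a - c)) (at s)"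
      for A B K a c :: real
      by (auto intro!: derivative_eq_intros simp: algebra_simps)
    from this[of "w i" "diff_quot t w i" "t i"
        "(diff_quot t w (i + 1) - diff_quot t w i) / (t (i + 1) - t (i - 1))" "t (i - 1)"]
    have "((\<lambda>s. w i + diff_quot t w i * (s - t i) +
      (diff_quot t w (i + 1) - diff_quot t w i) / (t (i + 1) - t (i - 1)) * ((s - t i) * (s - t (i - 1))))
      has_real_derivative interp_slope t k w j s) (at s)"
      using slope by simp
    then show ?thesis
      by (rule has_field_derivative_transform_within_open[of _ _ _ "{t (j - 1)<..<t j}"])
        (use s False interpolant_eq[OF mesh k] lagrange2_eq_newton[OF lt] in \<open>auto simp: i_def\<close>)
  qed
qed

lemma interp_slope_continuous: "continuous_on S (interp_slope t k w j)"
  unfolding interp_slope_def[abs_def] Let_def divide_inverse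
  by (cases "k = 1") (simp_all add: continuous_intros)

lemma interp_slope_integrable:
  assumes "0 < \<alpha>" "a \<le> b" "b \<le> u"
  shows "set_integrable lborel {a<..<b} (\<lambda>s. frac_kernel \<alpha> (u - s) * interp_slope t k w j s)"
proof -
  have "bounded (interp_slope t k w j ` {a..b})"
    by (intro compact_imp_bounded compact_continuous_image interp_slope_continuous compact_Icc)
  then obtain B where B: "\<forall>s\<in>{a..b}. \<bar>interp_slope t k w j s\<bar> \<le> B" by (auto simp: bounded_iff)
  have "interp_slope t k w j \<in> borel_measurable borel"
    by (rule borel_measurable_continuous_onI[OF interp_slope_continuous])
  then have "set_borel_measurable lborel {a<..<b} (interp_slope t k w j)"
    by (simp add: set_borel_measurable_def)
  then show ?thesis
    by (rule set_integrable_kernel_mult(1)[OF assms, of _ B]) (use B in auto)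
qed

lemma caputo_L2_eq_sum:
  assumes mesh: "time_mesh T N t" and k: "1 \<le> k" "k \<le> N" and \<alpha>: "0 < \<alpha>"
  shows "caputo_L2 t (1 - \<alpha>) k w =
    (\<Sum>j=1..k. LINT s:{t (j - 1)<..<t j}|lborel. frac_kernel \<alpha> (t k - s) * interp_slope t k w j s)"
proof -
  define f where "f = (\<lambda>s. frac_kernel \<alpha> (t k - s) * deriv (interpolant t k w) s)"
  have eq: "f s = frac_kernel \<alpha> (t k - s) * interp_slope t k w j s"
    if "1 \<le> j" "j \<le> k" "s \<in> {t (j - 1)<..<t j}" for j s
    using interpolant_deriv[OF mesh k that(1,2)] that by (simp add: f_def)
  have "set_integrable lborel {t (j - 1)<..<t j} f" if "1 \<le> j" "j \<le> k" for j
    using interp_slope_integrable[OF \<alpha> mesh_le[OF mesh, of "j - 1" j] mesh_le[OF mesh, of j k], of t k w j]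
      eq[OF that] that k
    by (subst set_integrable_cong[OF refl refl]) auto
  then have "(LINT s:{t 0<..<t k}|lborel. f s) = (\<Sum>j=1..k. LINT s:{t (j - 1)<..<t j}|lborel. f s)"
    using set_integral_mesh[of k t f] mesh_less[OF mesh] k by auto
  also have "\<dots> = (\<Sum>j=1..k. LINT s:{t (j - 1)<..<t j}|lborel. frac_kernel \<alpha> (t k - s) * interp_slope t k w j s)"
    using eq by (intro sum.cong set_lebesgue_integral_cong) auto
  finally show ?thesis
    using mesh by (simp add: caputo_L2_def f_def time_mesh_def)
qed

text \<open>Replaces the discrete memory term by a continuous fractional integral of a majorant, so
  that bounds for \<open>frac_int\<close>, in particular the exponential one, apply directly to any
  mesh.\<close>

lemma caputo_L2_abs_le:
  assumes mesh: "time_mesh T N t" and k: "1 \<le> k" "k \<le> N" and \<alpha>: "0 < \<alpha>" and G: "loc_bounded G"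
    and le: "\<And>j s. 1 \<le> j \<Longrightarrow> j \<le> k \<Longrightarrow> t (j - 1) < s \<Longrightarrow> s < t j \<Longrightarrow> \<bar>interp_slope t k w j s\<bar> \<le> G s"
  shows "\<bar>caputo_L2 t (1 - \<alpha>) k w\<bar> \<le> frac_int \<alpha> G (t k)"
proof -
  have t0: "t 0 = 0" using mesh by (simp add: time_mesh_def)
  have intG: "set_integrable lborel {t (j - 1)<..<t j} (\<lambda>s. frac_kernel \<alpha> (t k - s) * G s)"
    if "1 \<le> j" "j \<le> k" for j
  proof (rule set_integrable_subset[OF frac_int_integrable[OF \<alpha> G, of "t k"]])
    have "j - 1 \<le> N" using that k by simp
    then have "0 \<le> t (j - 1)" "t j \<le> t k"
      using mesh_range[OF mesh] mesh_le[OF mesh] that k by auto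
    then show "{t (j - 1)<..<t j} \<subseteq> {0<..<t k}" by auto
  qed simp
  have "\<bar>caputo_L2 t (1 - \<alpha>) k w\<bar>
      \<le> (\<Sum>j=1..k. \<bar>LINT s:{t (j - 1)<..<t j}|lborel. frac_kernel \<alpha> (t k - s) * interp_slope t k w j s\<bar>)"
    unfolding caputo_L2_eq_sum[OF mesh k \<alpha>] by (rule sum_abs)
  also have "\<dots> \<le> (\<Sum>j=1..k. LINT s:{t (j - 1)<..<t j}|lborel. frac_kernel \<alpha> (t k - s) * G s)"
  proof (rule sum_mono)
    fix j assume "j \<in> {1..k}"
    then have j: "1 \<le> j" "j \<le> k" by auto
    have i: "set_integrable lborel {t (j - 1)<..<t j} (\<lambda>s. frac_kernel \<alpha> (t k - s) * interp_slope t k w j s)"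
      using j k by (intro interp_slope_integrable \<alpha> mesh_le[OF mesh]) auto
    have "norm (LINT s:{t (j - 1)<..<t j}|lborel. frac_kernel \<alpha> (t k - s) * interp_slope t k w j s)
        \<le> (LINT s:{t (j - 1)<..<t j}|lborel. frac_kernel \<alpha> (t k - s) * G s)"
      unfolding set_lebesgue_integral_def
    proof (rule Bochner_Integration.integral_norm_bound_integral)
      fix s
      show "norm (indicator {t (j - 1)<..<t j} s *\<^sub>R (frac_kernel \<alpha> (t k - s) * interp_slope t k w j s))
          \<le> indicator {t (j - 1)<..<t j} s *\<^sub>R (frac_kernel \<alpha> (t k - s) * G s)"
        using le[OF j, of s] frac_kernel_nonneg[OF \<alpha>, of "t k - s"]
        by (auto simp: indicator_def abs_mult mult_left_mono)
    qed (use i intG[OF j] in \<open>auto simp: set_integrable_def\<close>)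
    then show "\<bar>LINT s:{t (j - 1)<..<t j}|lborel. frac_kernel \<alpha> (t k - s) * interp_slope t k w j s\<bar>
        \<le> (LINT s:{t (j - 1)<..<t j}|lborel. frac_kernel \<alpha> (t k - s) * G s)" by simp
  qed
  also have "\<dots> = frac_int \<alpha> G (t k)"
    unfolding frac_int_def
    using set_integral_mesh[of k t "\<lambda>s. frac_kernel \<alpha> (t k - s) * G s"] mesh_less[OF mesh] intG k t0
    by auto
  finally show ?thesis .
qed

text \<open>The slope is one difference quotient plus \<open>\<theta>\<close> times a difference of
  two, hence at most \<open>E + 2 * (2 * E)\<close>. A stencil reaches one cell ahead, so quotients
  up to index \<open>j + 1\<close> enter.\<close>

lemma interp_slope_abs_le:
  assumes mesh: "time_mesh T N t" and k: "1 \<le> k" "k \<le> N" "1 \<le> j" "j \<le> k" and s: "t (j - 1) < s" "s < t j"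
    and E: "\<And>i. 1 \<le> i \<Longrightarrow> i \<le> k \<Longrightarrow> i \<le> j + 1 \<Longrightarrow> \<bar>diff_quot t w i\<bar> \<le> E"
  shows "\<bar>interp_slope t k w j s\<bar> \<le> 5 * E"
proof (cases "k = 1")
  case True
  then show ?thesis using E[of 1] k by (auto simp: interp_slope_def)
next
  case False
  define i where "i = min j (k - 1)"
  have i: "1 \<le> i" "i + 1 \<le> k" "i \<le> j" "j \<le> i + 1" using False k by (auto simp: i_def)
  then have lt: "t (i - 1) < t i" "t i < t (i + 1)" using k by (auto intro: mesh_less[OF mesh])
  define \<theta> where "\<theta> = (2 * s - t (i - 1) - t i) / (t (i + 1) - t (i - 1))"
  have "t (i - 1) \<le> t (j - 1)" "t j \<le> t (i + 1)" using i k by (auto intro!: mesh_le[OF mesh])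
  \<comment> \<open>Since \<open>s\<close> lies between \<open>t (i - 1)\<close> and
    \<open>t (i + 1)\<close>, the numerator is at least minus the denominator and at most twice
    it.\<close>
  then have "\<bar>\<theta>\<bar> \<le> 2"
    using lt s unfolding \<theta>_def by (auto simp: abs_le_iff field_simps)
  moreover have "\<bar>diff_quot t w i\<bar> \<le> E" "\<bar>diff_quot t w (i + 1)\<bar> \<le> E" using i by (auto intro: E)
  moreover have "\<bar>diff_quot t w (i + 1) - diff_quot t w i\<bar> \<le> 2 * E" using calculation by linarith
  ultimately have "\<bar>diff_quot t w i\<bar> + \<bar>\<theta>\<bar> * \<bar>diff_quot t w (i + 1) - diff_quot t w i\<bar> \<le> E + 2 * (2 * E)"
    by (intro add_mono mult_mono) auto
  moreover have "interp_slope t k w j s = diff_quot t w i + \<theta> * (diff_quot t w (i + 1) - diff_quot t w i)"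
    using False by (simp add: interp_slope_def \<theta>_def i_def Let_def)
  moreover have "\<bar>diff_quot t w i + \<theta> * (diff_quot t w (i + 1) - diff_quot t w i)\<bar>
     \<le> \<bar>diff_quot t w i\<bar> + \<bar>\<theta>\<bar> * \<bar>diff_quot t w (i + 1) - diff_quot t w i\<bar>"
    by (metis abs_mult abs_triangle_ineq)
  ultimately show ?thesis by linarith
qed

subsection \<open>Stability of the variable-step scheme\<close>

text \<open>The quantities \<open>A\<close>, \<open>B\<close> and \<open>D\<close> are largest at
  \<open>y = z = 1.7319\<close>, just below the square root of 3; the constants 0.634, 0.5236 and
  1.7320 are these maxima rounded up, and 2.158 is an upper bound for \<open>1 + A + B\<close>. That
  the coefficients sum to 1 expresses exactness for linear functions.\<close>

lemma bdf3_coefficients: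
  fixes y z :: real
  assumes y: "1 \<le> y" "y \<le> 1.7319" and z: "1 \<le> z" "z \<le> 1.7319"
  shows "sigma0 y z + sigma1 y z + sigma2 y z = 1" "1 \<le> sigma0 y z" "sigma0 y z \<le> 2.158"
    "0 \<le> sigma2 y z" "sigma2 y z \<le> 0.455 * sigma0 y z"
proof -
  define A where "A = y / (y + 1)"
  define B where "B = y * z / (y * z + z + 1)"
  define D where "D = z * (y + 1) / (z + 1)"
  have yz: "0 < y * z" using y z by simp
  have s0: "sigma0 y z = 1 + A + B"
  proof -
    have "(2 * y + 1) / (y + 1) = 1 + A" using y by (simp add: A_def divide_simps)
    then show ?thesis by (simp add: sigma0_def B_def)
  qed
  have s2: "sigma2 y z = B * D"
    by (simp add: sigma2_def B_def D_def power2_eq_square)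
  have s1: "sigma1 y z = - A - B - B * D"
    by (simp add: sigma1_def A_def B_def D_def power2_eq_square)
  have A: "1 / 2 \<le> A" "A \<le> 0.634" using y by (simp_all add: A_def field_simps)
  have B0: "0 \<le> B" using yz z by (simp add: B_def)
  have B: "B \<le> 0.5236"
  proof -
    define w where "w = y * z"
    have "w \<le> 1.7319 * z" unfolding w_def using y z by (intro mult_right_mono) auto
    then have "w \<le> 0.5236 * (w + z + 1)" using z by simp
    then have "y * z \<le> 0.5236 * (y * z + z + 1)" by (simp only: w_def)
    then show ?thesis using yz z by (simp add: B_def divide_le_eq)
  qed
  have D: "1 \<le> D" "D \<le> 1.7320"
  proof -
    have "1 * 1 \<le> z * y" using y z by (intro mult_mono) auto
    then have "z + 1 \<le> z * (y + 1)" using z by (simp add: algebra_simps)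
    then show "1 \<le> D" using z by (simp add: D_def)
    have "z * (y + 1) \<le> z * 2.7319" using y z by (intro mult_left_mono) auto
    also have "\<dots> \<le> 1.7320 * (z + 1)" using z by simp
    finally show "D \<le> 1.7320" using z by (simp add: D_def divide_le_eq)
  qed
  show "sigma0 y z + sigma1 y z + sigma2 y z = 1" by (simp add: s0 s1 s2)
  show "1 \<le> sigma0 y z" "sigma0 y z \<le> 2.158" using A B B0 by (simp_all add: s0)
  show "0 \<le> sigma2 y z" using B0 D by (simp add: s2)
  \<comment> \<open>The claim \<open>B * D \<le> 0.455 * (1 + A + B)\<close> with the
    \<open>B\<close> terms collected; since \<open>A \<ge> 1 / 2\<close>, the right-hand side is at
    least 0.6825, while this product is below 0.669.\<close>
  have "B * (D - 0.455) \<le> 0.5236 * 1.277" using B D B0 by (intro mult_mono) auto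
  then show "sigma2 y z \<le> 0.455 * sigma0 y z" using A by (simp add: s0 s2 algebra_simps)
qed

text \<open>One step of the recursion \<open>d = p d\<^sub>1 - q d\<^sub>2\<close> need not contract the maximum norm, since
  \<open>p + q\<close> may exceed 1; two steps do.\<close>

lemma two_step_contraction:
  fixes p q u p' q' u' :: real
  assumes "p = q + u" "p' = q' + u'" "0 \<le> q" "q \<le> 0.455" "0 \<le> q'" "q' \<le> 0.455"
    "0 \<le> u" "u \<le> 0.5367" "0 \<le> u'" "u' \<le> 0.5367"
  shows "\<bar>p * p' - q\<bar> + p * q' \<le> 0.98"
proof (cases "q \<le> p * p'")
  case True
  \<comment> \<open>Here \<open>1.4467 = 2 * 0.455 + 0.5367\<close> is the maximum of
    \<open>p' + q'\<close>. What remains is \<open>0.4467 * q + 1.4467 * u\<close>, at most about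
    0.9797.\<close>
  have "p * (p' + q') \<le> p * 1.4467" using assms by (intro mult_left_mono) auto
  moreover have "p * p' - q + p * q' = p * (p' + q') - q" by (simp add: algebra_simps)
  ultimately show ?thesis using True assms by simp
next
  case False
  have "p * q' \<le> 1 * 0.455" using assms by (intro mult_mono) auto
  moreover have "0 \<le> p * p'" using assms by simp
  moreover have "\<bar>p * p' - q\<bar> = q - p * p'" using False by simp
  ultimately have "\<bar>p * p' - q\<bar> + p * q' \<le> q + 1 * 0.455" by linarith
  also have "\<dots> \<le> 0.98" using assms(4) by simp
  finally show ?thesis .
qed

text \<open>Division by \<open>sigma0\<close>. Because the coefficients sum to 1, the two feedback
  factors satisfy \<open>p - q = 1 - 1 / sigma0\<close>; this difference is \<open>u\<close>, and
  0.5367 comes from \<open>sigma0 \<le> 2.158\<close>. Keeping \<open>u\<close> separate from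
  \<open>q\<close> is what makes the two-step estimate possible.\<close>

lemma bdf3_recursion:
  assumes y: "y \<in> {1..1.7319}" and z: "z \<in> {1..1.7319}"
    and eq: "sigma0 y z * d + sigma1 y z * d1 + sigma2 y z * d2 = r"
  obtains p q u where "p = q + u" "0 \<le> q" "q \<le> 0.455" "0 \<le> u" "u \<le> 0.5367"
    "\<bar>d - (p * d1 - q * d2)\<bar> \<le> \<bar>r\<bar>"
proof -
  define s0 s1 s2 where "s0 = sigma0 y z" and "s1 = sigma1 y z" and "s2 = sigma2 y z"
  have c: "s0 + s1 + s2 = 1" "1 \<le> s0" "s0 \<le> 2.158" "0 \<le> s2" "s2 \<le> 0.455 * s0"
    using bdf3_coefficients[of y z] y z by (auto simp: s0_def s1_def s2_def)
  define q u where "q = s2 / s0" and "u = 1 - 1 / s0"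
  have "1 / s0 \<ge> 1 / 2.158" using c by (intro divide_left_mono) auto
  then have u: "0 \<le> u" "u \<le> 0.5367" using c by (simp_all add: u_def)
  have q: "0 \<le> q" "q \<le> 0.455" using c by (simp_all add: q_def divide_le_eq)
  have "s0 * (d - ((q + u) * d1 - q * d2)) = r"
  proof -
    have "s0 * q = s2" "s0 * u = s0 - 1" using c by (simp_all add: q_def u_def right_diff_distrib)
    moreover have "s0 * (d - ((q + u) * d1 - q * d2)) = s0 * d - (s0 * q + s0 * u) * d1 + (s0 * q) * d2"
      by (simp add: algebra_simps)
    ultimately have "s0 * (d - ((q + u) * d1 - q * d2)) = s0 * d - (s2 + (s0 - 1)) * d1 + s2 * d2" by simp
    also have "s2 + (s0 - 1) = - s1" using c(1) by simp
    also have "s0 * d - (- s1) * d1 + s2 * d2 = r" using eq by (simp add: s0_def s1_def s2_def)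
    finally show ?thesis .
  qed
  then have "\<bar>r\<bar> = s0 * \<bar>d - ((q + u) * d1 - q * d2)\<bar>" using c(2) by (simp add: abs_mult flip: \<open>s0 * _ = r\<close>)
  moreover have "1 * \<bar>d - ((q + u) * d1 - q * d2)\<bar> \<le> s0 * \<bar>d - ((q + u) * d1 - q * d2)\<bar>"
    using c by (intro mult_right_mono) auto
  ultimately have "\<bar>d - ((q + u) * d1 - q * d2)\<bar> \<le> \<bar>r\<bar>" by simp
  then show ?thesis using that[OF refl] q u by blast
qed

text \<open>All weights are first replaced by the largest one, \<open>E n\<close>; then the
  recursion is applied twice. The statement is per index \<open>n\<close>, so it can be evaluated
  where the weighted maximum is attained.\<close>

lemma bdf3_weighted_contraction:
  fixes d r E :: "nat \<Rightarrow> real"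
  assumes n: "1 \<le> n" and nn: "0 \<le> B" "0 \<le> X"
    and E: "\<And>j. 1 \<le> j \<Longrightarrow> j \<le> n \<Longrightarrow> 0 \<le> E j \<and> E j \<le> E n"
    and r: "\<And>j. 1 \<le> j \<Longrightarrow> j \<le> n \<Longrightarrow> \<bar>r j\<bar> \<le> B * E j"
    and d: "\<And>j. 1 \<le> j \<Longrightarrow> j \<le> n \<Longrightarrow> \<bar>d j\<bar> \<le> X * E j"
    and start: "\<And>j. 1 \<le> j \<Longrightarrow> j \<le> n \<Longrightarrow> j \<le> 2 \<Longrightarrow> d j = r j"
    and y: "\<And>j. 2 \<le> j \<Longrightarrow> j \<le> n \<Longrightarrow> y j \<in> {1..1.7319}"
    and rec: "\<And>j. 3 \<le> j \<Longrightarrow> j \<le> n \<Longrightarrow>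
      sigma0 (y j) (y (j - 1)) * d j + sigma1 (y j) (y (j - 1)) * d (j - 1) + sigma2 (y j) (y (j - 1)) * d (j - 2) = r j"
  shows "\<bar>d n\<bar> \<le> (0.98 * X + 4 * B) * E n"
proof -
  have rB: "\<bar>r j\<bar> \<le> B * E n" if "1 \<le> j" "j \<le> n" for j
    using r[OF that] mult_left_mono[OF conjunct2[OF E[OF that]] nn(1)] by linarith
  have dX: "\<bar>d j\<bar> \<le> X * E n" if "1 \<le> j" "j \<le> n" for j
    using d[OF that] mult_left_mono[OF conjunct2[OF E[OF that]] nn(2)] by linarith
  have E0: "0 \<le> E n" using E n by auto
  have XB: "0 \<le> X * E n" "0 \<le> B * E n" using nn E0 by auto
  have R: "\<exists>p q u. p = q + u \<and> 0 \<le> q \<and> q \<le> 0.455 \<and> 0 \<le> u \<and> u \<le> 0.5367 \<and>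
      \<bar>d j - (p * d (j - 1) - q * d (j - 2))\<bar> \<le> B * E n" if "3 \<le> j" "j \<le> n" for j
  proof -
    have "2 \<le> j" "2 \<le> j - 1" "j - 1 \<le> n" using that by auto
    from bdf3_recursion[OF y[OF this(1) that(2)] y[OF this(2,3)] rec[OF that]]
    obtain p q u where "p = q + u" "0 \<le> q" "q \<le> 0.455" "0 \<le> u" "u \<le> 0.5367"
      "\<bar>d j - (p * d (j - 1) - q * d (j - 2))\<bar> \<le> \<bar>r j\<bar>" by blast
    moreover have "\<bar>r j\<bar> \<le> B * E n" using rB[of j] that by simp
    ultimately show ?thesis by (meson order_trans)
  qed
  have crude: "\<bar>p * a - q * b\<bar> \<le> \<bar>a\<bar> + 0.455 * \<bar>b\<bar>"
    if "p = q + u" "0 \<le> q" "q \<le> 0.455" "0 \<le> u" "u \<le> 0.5367" for p q u a b :: real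
  proof -
    have "\<bar>p * a - q * b\<bar> \<le> p * \<bar>a\<bar> + q * \<bar>b\<bar>"
      using that abs_triangle_ineq4[of "p * a" "q * b"] by (simp add: abs_mult)
    also have "\<dots> \<le> 1 * \<bar>a\<bar> + 0.455 * \<bar>b\<bar>" using that by (intro add_mono mult_right_mono) auto
    finally show ?thesis by simp
  qed
  have goal: "(0.98 * X + 4 * B) * E n = 0.98 * (X * E n) + 4 * (B * E n)" by (simp add: algebra_simps)
  have d12: "\<bar>d j\<bar> \<le> B * E n" if "1 \<le> j" "j \<le> 2" "j \<le> n" for j
    using start[of j] rB[of j] that by simp
  \<comment> \<open>The first indices are controlled by the residuals alone: the bounds are 1, 1,
    2.455 and 3.955 times \<open>B * E n\<close> for \<open>n = 1, ..., 4\<close>, which is the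
    origin of the constant 4.\<close>
  have d3: "\<bar>d 3\<bar> \<le> 2.5 * (B * E n)" if n3: "3 \<le> n"
  proof -
    obtain p q u where "p = q + u" "0 \<le> q" "q \<le> 0.455" "0 \<le> u" "u \<le> 0.5367"
      "\<bar>d 3 - (p * d (3 - 1) - q * d (3 - 2))\<bar> \<le> B * E n" using R[of 3] n3 order_refl[of "3::nat"] by blast
    then show ?thesis using crude[of p q u "d 2" "d 1"] d12[of 1] d12[of 2] that XB by simp
  qed
  consider "n \<le> 2" | "n = 3" | "n = 4" | "5 \<le> n" by linarith
  then show ?thesis
  proof cases
    case 1
    then show ?thesis unfolding goal using d12[of n] n XB by simp
  next
    case 2
    then show ?thesis using d3 XB goal by simp
  next
    case 3
    then have "(3::nat) \<le> 4" "4 \<le> n" by auto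
    obtain p q u where "p = q + u" "0 \<le> q" "q \<le> 0.455" "0 \<le> u" "u \<le> 0.5367"
      "\<bar>d 4 - (p * d (4 - 1) - q * d (4 - 2))\<bar> \<le> B * E n" using R[of 4] \<open>(3::nat) \<le> 4\<close> \<open>4 \<le> n\<close> by blast
    then have "\<bar>d 4\<bar> \<le> 4 * (B * E n)"
      using crude[of p q u "d 3" "d 2"] d12[of 2] d3 3 XB by simp
    then show ?thesis using 3 XB goal by simp
  next
    case 4
    then have "3 \<le> n" "3 \<le> n - 1" "n - 1 \<le> n" by auto
    obtain p q u where p: "p = q + u" "0 \<le> q" "q \<le> 0.455" "0 \<le> u" "u \<le> 0.5367"
      "\<bar>d n - (p * d (n - 1) - q * d (n - 2))\<bar> \<le> B * E n" using R[of n] \<open>3 \<le> n\<close> by blast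
    obtain p' q' u' where p': "p' = q' + u'" "0 \<le> q'" "q' \<le> 0.455" "0 \<le> u'" "u' \<le> 0.5367"
      "\<bar>d (n - 1) - (p' * d (n - 1 - 1) - q' * d (n - 1 - 2))\<bar> \<le> B * E n"
      using R[of "n - 1"] \<open>3 \<le> n - 1\<close> \<open>n - 1 \<le> n\<close> by blast
    have "n - 1 - 1 = n - 2" "n - 1 - 2 = n - 3" using 4 by auto
    note p' = p'[unfolded this]
    define e where "e = d (n - 1) - (p' * d (n - 2) - q' * d (n - 3))"
    have p0: "0 \<le> p" "p \<le> 1" using p(1-5) by simp_all
    have e: "\<bar>e\<bar> \<le> B * E n" using p'(6) by (simp only: e_def)
    have pe: "p * \<bar>e\<bar> \<le> 1 * (B * E n)" by (rule mult_mono[OF p0(2) e]) simp_all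
    have pq: "0 \<le> p * q'" using p0(1) p'(2) by simp
    \<comment> \<open>The second recursion is inserted into the first. The older residual
      \<open>e\<close> is passed on with the factor \<open>p \<le> 1\<close>, so only two residuals
      accumulate.\<close>
    have "p * d (n - 1) - q * d (n - 2) = (p * p' - q) * d (n - 2) - p * q' * d (n - 3) + p * e"
      by (simp add: e_def algebra_simps)
    then have "\<bar>p * d (n - 1) - q * d (n - 2)\<bar>
        \<le> \<bar>(p * p' - q) * d (n - 2)\<bar> + \<bar>p * q' * d (n - 3)\<bar> + \<bar>p * e\<bar>" by linarith
    also have "\<dots> = \<bar>p * p' - q\<bar> * \<bar>d (n - 2)\<bar> + (p * q') * \<bar>d (n - 3)\<bar> + p * \<bar>e\<bar>"
      using p0 p'(2) by (simp only: abs_mult abs_of_nonneg)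
    also have "\<dots> \<le> \<bar>p * p' - q\<bar> * (X * E n) + (p * q') * (X * E n) + 1 * (B * E n)"
      by (intro add_mono mult_left_mono pe dX pq abs_ge_zero) (use 4 in simp_all)
    also have "\<dots> = (\<bar>p * p' - q\<bar> + p * q') * (X * E n) + B * E n" by (simp add: algebra_simps)
    also have "\<dots> \<le> 0.98 * (X * E n) + B * E n"
      by (intro add_mono mult_right_mono order_refl XB two_step_contraction[OF p(1) p'(1) p(2,3) p'(2,3) p(4,5) p'(4,5)])
    finally have "\<bar>d n\<bar> \<le> 0.98 * (X * E n) + 2 * (B * E n)" using p(6) by linarith
    also have "\<dots> \<le> 0.98 * (X * E n) + 4 * (B * E n)" using XB by simp
    finally show ?thesis unfolding goal .
  qed
qed

text \<open>A Chebyshev type argument: subtract the kernel value at the midpoint. The linear factor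
  has mean zero, and it has the same sign as the kernel minus its midpoint value, because the kernel
  increases in \<open>s\<close>.\<close>

lemma kernel_mult_odd_integral_nonneg:
  assumes \<alpha>: "0 < \<alpha>" "\<alpha> \<le> 1" and ab: "a < b" "b < u"
  shows "0 \<le> (LINT s:{a<..<b}|lborel. frac_kernel \<alpha> (u - s) * (2 * s - a - b))"
proof -
  define b0 where "b0 = frac_kernel \<alpha> (u - (a + b) / 2)"
  have der: "((\<lambda>s. (s - a) * (s - b)) has_vector_derivative (2 * s - a - b)) (at s within {a..b})" for s
    by (auto intro!: derivative_eq_intros simp: has_real_derivative_iff_has_vector_derivative[symmetric])
  have "((\<lambda>s. 2 * s - a - b) has_integral ((b - a) * (b - b) - (a - a) * (a - b))) {a..b}"
    by (rule fundamental_theorem_of_calculus) (use ab der in auto)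
  then have h: "((\<lambda>s. 2 * s - a - b) has_integral 0) {a<..<b}"
    by (simp add: has_integral_Icc_iff_Ioo)
  have "set_integrable lborel {a..b} (\<lambda>s. 2 * s - a - b)"
    by (rule borel_integrable_atLeastAtMost') (intro continuous_intros)
  then have i0: "set_integrable lborel {a<..<b} (\<lambda>s. 2 * s - a - b)"
    by (rule set_integrable_subset) auto
  then have z: "(LINT s:{a<..<b}|lborel. 2 * s - a - b) = 0"
    using set_borel_integral_eq_integral(2)[OF i0] integral_unique[OF h] by simp
  have i1: "set_integrable lborel {a<..<b} (\<lambda>s. frac_kernel \<alpha> (u - s) * (2 * s - a - b))"
    by (rule set_integrable_kernel_mult(1)[of _ _ _ _ _ "b - a"])
      (use \<alpha> ab in \<open>auto simp: set_borel_measurable_def\<close>)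
  have "0 = (LINT s:{a<..<b}|lborel. b0 * (2 * s - a - b))" using z by simp
  also have "\<dots> \<le> (LINT s:{a<..<b}|lborel. frac_kernel \<alpha> (u - s) * (2 * s - a - b))"
  proof (rule set_integral_mono[OF _ i1])
    show "set_integrable lborel {a<..<b} (\<lambda>s. b0 * (2 * s - a - b))"
      using i0 by (intro set_integrable_mult_right) simp
    fix s assume s: "s \<in> {a<..<b}"
    show "b0 * (2 * s - a - b) \<le> frac_kernel \<alpha> (u - s) * (2 * s - a - b)"
    proof (cases "2 * s - a - b \<ge> 0")
      case True
      have "b0 \<le> frac_kernel \<alpha> (u - s)"
        unfolding b0_def using s ab True \<alpha> by (intro frac_kernel_antimono) auto
      then show ?thesis using True by (rule mult_right_mono)
    next
      case False
      have "frac_kernel \<alpha> (u - s) \<le> b0"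
        unfolding b0_def using s ab False \<alpha> by (intro frac_kernel_antimono) auto
      then show ?thesis using False by (intro mult_right_mono_neg) auto
    qed
  qed
  finally show ?thesis .
qed

text \<open>This keeps the scheme stable for large steps, where the memory term is not a small
  perturbation.  The cell before the last one contributes with the right sign because the kernel
  increases towards \<open>t k\<close>.\<close>

lemma caputo_L2_diagonal:
  assumes mesh: "time_mesh T N t" and k: "1 \<le> k" "k \<le> N" and \<alpha>: "0 < \<alpha>" "\<alpha> \<le> 1"
  obtains a where "0 \<le> a"
    "\<And>w. caputo_L2 t (1 - \<alpha>) k w = a * diff_quot t w k + caputo_L2 t (1 - \<alpha>) k (w(k := w (k - 1)))"
proof
  \<comment> \<open>For the indices up to \<open>k\<close>, the sequence whose only nonzero
    difference quotient is the \<open>k\<close>-th one, equal to 1. Replacing \<open>w k\<close> by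
    \<open>w (k - 1)\<close> removes exactly this component of \<open>w\<close>.\<close>
  define u where "u = (\<lambda>i. if i = k then step t k else 0)"
  define a where "a = caputo_L2 t (1 - \<alpha>) k u"
  have sk: "0 < step t k" by (rule step_pos[OF mesh k])
  have uk: "diff_quot t u k = 1" using sk k by (simp add: diff_quot_def u_def)
  have uj: "diff_quot t u i = 0" if "i < k" for i using that by (simp add: diff_quot_def u_def)
  have lin: "interp_slope t k w j s = diff_quot t w k * interp_slope t k u j s
      + interp_slope t k (w(k := w (k - 1))) j s" for w j s
  proof -
    have wk: "diff_quot t (w(k := w (k - 1))) k = 0" using k by (simp add: diff_quot_def)
    have wj: "diff_quot t (w(k := w (k - 1))) i = diff_quot t w i" if "i < k" for i
    proof -
      have "i - 1 \<noteq> k" "i \<noteq> k" using that by auto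
      then show ?thesis by (simp add: diff_quot_def)
    qed
    show ?thesis
    proof (cases "k = 1")
      case True
      then show ?thesis using uk wk by (simp add: interp_slope_def)
    next
      case False
      define i where "i = min j (k - 1)"
      have i: "i < k" using False k by (auto simp: i_def)
      define \<theta> where "\<theta> = (2 * s - t (i - 1) - t i) / (t (i + 1) - t (i - 1))"
      have eq: "interp_slope t k v j s = diff_quot t v i + \<theta> * (diff_quot t v (i + 1) - diff_quot t v i)" for v
        unfolding interp_slope_def Let_def i_def \<theta>_def using False by simp
      show ?thesis
      proof (cases "i + 1 = k")
        case True
        have "A + \<theta> * (x - A) = x * (0 + \<theta> * (1 - 0)) + (A + \<theta> * (0 - A))" for A x
          by (simp add: algebra_simps)
        then show ?thesis unfolding eq True uk wk uj[OF i] wj[OF i] .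
      next
        case False
        then have "i + 1 < k" using i by simp
        then show ?thesis unfolding eq using uj[OF i] wj[OF i] uj[of "i + 1"] wj[of "i + 1"] by simp
      qed
    qed
  qed
  have int: "set_integrable lborel {t (j - 1)<..<t j} (\<lambda>s. frac_kernel \<alpha> (t k - s) * interp_slope t k w j s)"
    if "j \<in> {1..k}" for j w
    using that k by (intro interp_slope_integrable \<alpha> mesh_le[OF mesh]) auto
  show "caputo_L2 t (1 - \<alpha>) k w = a * diff_quot t w k + caputo_L2 t (1 - \<alpha>) k (w(k := w (k - 1)))" for w
  proof -
    have "(LINT s:{t (j - 1)<..<t j}|lborel. frac_kernel \<alpha> (t k - s) * interp_slope t k w j s)
      = (LINT s:{t (j - 1)<..<t j}|lborel. frac_kernel \<alpha> (t k - s) * interp_slope t k u j s) * diff_quot t w k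
      + (LINT s:{t (j - 1)<..<t j}|lborel. frac_kernel \<alpha> (t k - s) * interp_slope t k (w(k := w (k - 1))) j s)"
      if j: "j \<in> {1..k}" for j
    proof -
      have "(LINT s:{t (j - 1)<..<t j}|lborel. frac_kernel \<alpha> (t k - s) * interp_slope t k w j s)
        = (LINT s:{t (j - 1)<..<t j}|lborel. diff_quot t w k * (frac_kernel \<alpha> (t k - s) * interp_slope t k u j s)
          + frac_kernel \<alpha> (t k - s) * interp_slope t k (w(k := w (k - 1))) j s)"
        unfolding lin[of w j] by (intro set_lebesgue_integral_cong) (auto simp: algebra_simps)
      also have "\<dots> = (LINT s:{t (j - 1)<..<t j}|lborel. diff_quot t w k * (frac_kernel \<alpha> (t k - s) * interp_slope t k u j s))
          + (LINT s:{t (j - 1)<..<t j}|lborel. frac_kernel \<alpha> (t k - s) * interp_slope t k (w(k := w (k - 1))) j s)"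
        by (intro set_integral_add(2) set_integrable_mult_right int[OF j])
      finally show ?thesis by simp
    qed
    then show ?thesis
      unfolding a_def caputo_L2_eq_sum[OF mesh k \<alpha>(1)] by (simp add: sum.distrib sum_distrib_right)
  qed
  show "0 \<le> a"
    unfolding a_def caputo_L2_eq_sum[OF mesh k \<alpha>(1)]
  proof (rule sum_nonneg)
    fix j assume j: "j \<in> {1..k}"
    have nonneg: "0 \<le> (LINT s:{t (j - 1)<..<t j}|lborel. frac_kernel \<alpha> (t k - s) * interp_slope t k u j s)"
      if "\<And>s. s \<in> {t (j - 1)<..<t j} \<Longrightarrow> 0 \<le> interp_slope t k u j s"
      unfolding set_lebesgue_integral_def using that frac_kernel_nonneg[OF \<alpha>(1)]
      by (intro Bochner_Integration.integral_nonneg) (auto simp: indicator_def)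
    show "0 \<le> (LINT s:{t (j - 1)<..<t j}|lborel. frac_kernel \<alpha> (t k - s) * interp_slope t k u j s)"
    proof (cases "k = 1")
      case True
      then show ?thesis using uk by (intro nonneg) (simp add: interp_slope_def)
    next
      case False
      define i where "i = min j (k - 1)"
      have i: "1 \<le> i" "i + 1 \<le> k" "i = j \<or> j = k"
        unfolding i_def using False j k by (simp_all add: min_def) linarith+
      have lt: "t (i - 1) < t i" "t i < t (i + 1)" using i k by (auto intro!: mesh_less[OF mesh])
      have eq: "interp_slope t k u j s = (2 * s - t (i - 1) - t i) / (t (i + 1) - t (i - 1)) * diff_quot t u (i + 1)" for s
      proof -
        have "diff_quot t u i = 0" using i by (intro uj) simp
        then show ?thesis unfolding interp_slope_def Let_def i_def using False by simp
      qed
      \<comment> \<open>Either the stencil does not contain \<open>t k\<close>, or the cell is the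
        last one and lies to the right of the midpoint of its stencil's first cell, or it is the
        cell before, where the slope of \<open>u\<close> is odd about the midpoint.\<close>
      consider "i + 1 < k" | "i + 1 = k" "j = k" | "i + 1 = k" "j = i" using i by linarith
      then show ?thesis
      proof cases
        case 1
        have "interp_slope t k u j s = 0" for s unfolding eq uj[OF 1] by simp
        then show ?thesis by simp
      next
        case 2
        show ?thesis
        proof (rule nonneg)
          fix s assume s: "s \<in> {t (j - 1)<..<t j}"
          have "j - 1 = i" using 2 by simp
          then have "t i < s" using s by simp
          then show "0 \<le> interp_slope t k u j s"
            unfolding eq 2(1) uk using lt unfolding 2(1) by simp
        qed
      next
        case 3
        have "(LINT s:{t (j - 1)<..<t j}|lborel. frac_kernel \<alpha> (t k - s) * interp_slope t k u j s)
          = (LINT s:{t (j - 1)<..<t j}|lborel. (1 / (t (i + 1) - t (i - 1))) * (frac_kernel \<alpha> (t k - s) * (2 * s - t (j - 1) - t j)))"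
        proof -
          have "interp_slope t k u j s = (1 / (t (i + 1) - t (i - 1))) * (2 * s - t (j - 1) - t j)" for s
            using eq[of s] uk unfolding 3 by simp
          then show ?thesis by (simp add: mult_ac)
        qed
        also have "\<dots> = (1 / (t (i + 1) - t (i - 1))) * (LINT s:{t (j - 1)<..<t j}|lborel. frac_kernel \<alpha> (t k - s) * (2 * s - t (j - 1) - t j))"
          by (rule set_integral_mult_right)
        also have "0 \<le> \<dots>"
        proof (rule mult_nonneg_nonneg)
          show "0 \<le> (LINT s:{t (j - 1)<..<t j}|lborel. frac_kernel \<alpha> (t k - s) * (2 * s - t (j - 1) - t j))"
            using lt unfolding 3(1) unfolding 3(2) by (intro kernel_mult_odd_integral_nonneg \<alpha>) auto
          show "0 \<le> 1 / (t (i + 1) - t (i - 1))" using lt by simp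
        qed
        finally show ?thesis .
      qed
    qed
  qed
qed

lemma loc_bounded_const: "loc_bounded (\<lambda>_. c)"
  by (auto simp: loc_bounded_def intro!: exI[of _ "\<bar>c\<bar>"])

text \<open>Let \<open>X\<close> be the largest weighted difference quotient up to \<open>k\<close>.
  The memory term contributes at most \<open>X / 400\<close> in the weighted norm, and the
  contraction is applied at an index \<open>p\<close> where \<open>X\<close> is attained. Since
  steps do not decrease, smallness at \<open>k\<close> covers the whole past.\<close>

lemma bdf3_small_step_bound:
  assumes mesh: "time_mesh T N t" and rt: "\<forall>k\<in>{2..N}. ratio t k \<in> {1..1.7319}"
    and \<alpha>: "0 < \<alpha>" and lam: "0 \<le> lam" and \<omega>: "0 < \<omega>" "lam * (5 * exp 2 * \<omega> powr (- \<alpha>)) \<le> 1 / 400"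
    and k: "1 \<le> k" "k \<le> N" and small: "\<omega> * step t k \<le> 1"
    and R: "\<And>j. 1 \<le> j \<Longrightarrow> j \<le> k \<Longrightarrow>
      \<bar>(if j \<le> 2 then diff_quot t w j else bdf3 t w j) + lam * caputo_L2 t (1 - \<alpha>) j w\<bar> \<le> \<rho>"
  shows "\<bar>diff_quot t w k\<bar> \<le> 400 * \<rho> * exp (\<omega> * t k)"
proof -
  define d where "d = diff_quot t w"
  define D where "D = (\<lambda>j. caputo_L2 t (1 - \<alpha>) j w)"
  define r where "r = (\<lambda>j. if j \<le> 2 then d j else bdf3 t w j)"
  define E where "E = (\<lambda>j. exp (\<omega> * t j))"
  define X where "X = Max ((\<lambda>j. \<bar>d j\<bar> / E j) ` {1..k})"
  have rat: "\<And>k. k \<in> {2..N} \<Longrightarrow> 1 \<le> ratio t k" using rt by auto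
  have E0: "0 < E j" for j by (simp add: E_def)
  have \<rho>: "0 \<le> \<rho>" using order_trans[OF abs_ge_zero R[of 1]] k by simp
  have "X \<in> (\<lambda>j. \<bar>d j\<bar> / E j) ` {1..k}" unfolding X_def using k by (intro Max_in) auto
  then obtain p where p: "1 \<le> p" "p \<le> k" "X = \<bar>d p\<bar> / E p" by auto
  have X0: "0 \<le> X" using p E0[of p] by simp
  have dX: "\<bar>d j\<bar> \<le> X * E j" if "1 \<le> j" "j \<le> k" for j
  proof -
    have "\<bar>d j\<bar> / E j \<le> X" unfolding X_def using that by (intro Max_ge) auto
    then show ?thesis using E0[of j] by (simp add: divide_le_eq)
  qed
  have D: "\<bar>D j\<bar> \<le> 5 * exp 2 * X * (\<omega> powr (- \<alpha>) * E j)" if j: "1 \<le> j" "j \<le> k" for j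
  proof -
    have "\<bar>D j\<bar> \<le> frac_int \<alpha> (\<lambda>s. (5 * exp 2 * X) * exp (\<omega> * s)) (t j)"
      unfolding D_def
    proof (rule caputo_L2_abs_le[OF mesh])
      fix l s assume l: "1 \<le> l" "l \<le> j" and s: "t (l - 1) < s" "s < t l"
      have "\<bar>interp_slope t j w l s\<bar> \<le> 5 * (X * exp (\<omega> * s + 2))"
      proof (rule interp_slope_abs_le[OF mesh])
        fix i assume i: "1 \<le> i" "i \<le> j" "i \<le> l + 1"
        have sl: "step t l \<le> step t k" using l j k by (intro step_mono[OF mesh rat]) auto
        \<comment> \<open>The slope at \<open>s\<close> uses values up to the end of the next cell,
          at most two steps ahead. With \<open>\<omega> * step t k \<le> 1\<close> this costs the
          factor \<open>exp 2\<close>.\<close>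
        have "t i \<le> s + 2 * step t k"
        proof (cases "i \<le> l")
          case True
          then have "t i \<le> t l" using l j k by (intro mesh_le[OF mesh]) auto
          moreover have "t l = t (l - 1) + step t l" by (simp add: step_def)
          moreover have "0 < step t k" using k by (intro step_pos[OF mesh])
          ultimately show ?thesis using sl s by linarith
        next
          case False
          then have il: "i = l + 1" using i by simp
          have "step t i \<le> step t k" using i j k by (intro step_mono[OF mesh rat]) auto
          moreover have "t i = t (l - 1) + step t l + step t i" by (simp add: step_def il)
          ultimately show ?thesis using sl s by linarith
        qed
        then have "\<omega> * t i \<le> \<omega> * (s + 2 * step t k)" using \<omega> by (intro mult_left_mono) auto
        also have "\<dots> \<le> \<omega> * s + 2" using small by (simp add: algebra_simps)
        finally have "X * E i \<le> X * exp (\<omega> * s + 2)"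
          unfolding E_def using X0 by (intro mult_left_mono) auto
        then show "\<bar>diff_quot t w i\<bar> \<le> X * exp (\<omega> * s + 2)"
          using dX[of i] i j by (simp add: d_def)
      qed (use l s j k in auto)
      then show "\<bar>interp_slope t j w l s\<bar> \<le> (5 * exp 2 * X) * exp (\<omega> * s)"
        by (simp add: exp_add mult_ac)
    qed (use j k \<alpha> in \<open>auto intro!: loc_bounded_cmult loc_bounded_exp\<close>)
    also have "\<dots> \<le> (5 * exp 2 * X) * (\<omega> powr (- \<alpha>) * exp (\<omega> * t j))"
      unfolding frac_int_cmult using X0 by (intro mult_left_mono frac_int_exp_le \<alpha> \<omega>) auto
    finally show ?thesis by (simp add: E_def)
  qed
  have rB: "\<bar>r j\<bar> \<le> (\<rho> + X / 400) * E j" if j: "1 \<le> j" "j \<le> k" for j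
  proof -
    have "lam * \<bar>D j\<bar> \<le> lam * (5 * exp 2 * X * (\<omega> powr (- \<alpha>) * E j))"
      by (rule mult_left_mono[OF D[OF j] lam])
    also have "\<dots> = (lam * (5 * exp 2 * \<omega> powr (- \<alpha>))) * (X * E j)" by simp
    also have "\<dots> \<le> (1 / 400) * (X * E j)" using X0 E0[of j] by (intro mult_right_mono \<omega>) auto
    finally have "\<bar>lam * D j\<bar> \<le> (1 / 400) * (X * E j)" using lam by (simp add: abs_mult)
    moreover have "\<rho> * 1 \<le> \<rho> * E j"
      unfolding E_def using \<rho> \<omega> mesh_range[OF mesh, of j] j k by (intro mult_left_mono) auto
    moreover have "\<bar>r j + lam * D j\<bar> \<le> \<rho>" using R[OF j] unfolding r_def D_def d_def .
    ultimately have "\<bar>r j\<bar> \<le> \<rho> * E j + (1 / 400) * (X * E j)" by linarith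
    then show ?thesis by (simp add: algebra_simps)
  qed
  have "\<bar>d p\<bar> \<le> (0.98 * X + 4 * (\<rho> + X / 400)) * E p"
  proof (rule bdf3_weighted_contraction[where r = r and y = "ratio t"])
    fix j assume j: "1 \<le> j" "j \<le> p"
    show "0 \<le> E j \<and> E j \<le> E p"
      using mesh_le[OF mesh, of j p] j p k \<omega> by (simp add: E_def)
    show "\<bar>r j\<bar> \<le> (\<rho> + X / 400) * E j" "\<bar>d j\<bar> \<le> X * E j" using rB dX j p by auto
  next
    fix j assume "2 \<le> j" "j \<le> p"
    then show "ratio t j \<in> {1..1.7319}" using rt p k by auto
  next
    fix j assume "3 \<le> j" "j \<le> p"
    then show "sigma0 (ratio t j) (ratio t (j - 1)) * d j + sigma1 (ratio t j) (ratio t (j - 1)) * d (j - 1)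
        + sigma2 (ratio t j) (ratio t (j - 1)) * d (j - 2) = r j"
      by (simp add: r_def bdf3_def d_def)
  qed (use p X0 \<rho> in \<open>auto simp: r_def\<close>)
  then have "X \<le> 0.98 * X + 4 * (\<rho> + X / 400)" using p(3) E0[of p] by (simp add: divide_le_eq)
  \<comment> \<open>Since \<open>0.98 + 4 / 400 = 0.99\<close>, one hundredth of \<open>X\<close> is
    left to be bounded by \<open>4 * \<rho>\<close>.\<close>
  then have "X \<le> 400 * \<rho>" by simp
  then have "X * E k \<le> 400 * \<rho> * E k" using E0[of k] by (intro mult_right_mono) auto
  then have "\<bar>d k\<bar> \<le> 400 * \<rho> * E k" using dX[of k] k by linarith
  then show ?thesis by (simp only: d_def E_def)
qed

text \<open>For a large step the memory term cannot be treated as small. Its diagonal part is kept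
  on the left: \<open>lam * a \<ge> 0\<close> only increases a leading coefficient that is already
  at least 1. The rest of the memory involves earlier quotients only and is bounded over the fixed
  interval \<open>{0..T}\<close>.\<close>

lemma bdf3_any_step_bound:
  assumes mesh: "time_mesh T N t" and rt: "\<forall>k\<in>{2..N}. ratio t k \<in> {1..1.7319}"
    and \<alpha>: "0 < \<alpha>" "\<alpha> \<le> 1" and lam: "0 \<le> lam" and k: "1 \<le> k" "k \<le> N"
    and R: "\<bar>(if k \<le> 2 then diff_quot t w k else bdf3 t w k) + lam * caputo_L2 t (1 - \<alpha>) k w\<bar> \<le> E"
    and d: "\<And>j. 1 \<le> j \<Longrightarrow> j < k \<Longrightarrow> \<bar>diff_quot t w j\<bar> \<le> E"
  shows "\<bar>diff_quot t w k\<bar> \<le> (6 + lam * (5 * T powr \<alpha> / Gamma (\<alpha> + 1))) * E"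
proof -
  have E0: "0 \<le> E" using R by linarith
  obtain a where a: "0 \<le> a" and split:
    "\<And>w. caputo_L2 t (1 - \<alpha>) k w = a * diff_quot t w k + caputo_L2 t (1 - \<alpha>) k (w(k := w (k - 1)))"
    using caputo_L2_diagonal[OF mesh k \<alpha>] by blast
  define v where "v = w(k := w (k - 1))"
  have G: "0 < Gamma (\<alpha> + 1)" using \<alpha> by (intro Gamma_real_pos) simp
  have dv: "\<bar>diff_quot t v i\<bar> \<le> E" if "1 \<le> i" "i \<le> k" for i
  proof (cases "i = k")
    case True
    then show ?thesis using E0 k by (simp add: v_def diff_quot_def)
  next
    case False
    then have "i - 1 \<noteq> k" "i < k" using that by auto
    then show ?thesis using d[of i] that by (simp add: v_def diff_quot_def)
  qed
  have tk: "0 \<le> t k" "t k \<le> T" using mesh_range[OF mesh k(2)] by auto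
  have "\<bar>caputo_L2 t (1 - \<alpha>) k v\<bar> \<le> frac_int \<alpha> (\<lambda>_. 5 * E) (t k)"
    using k by (intro caputo_L2_abs_le[OF mesh] loc_bounded_const interp_slope_abs_le[OF mesh] dv \<alpha>) auto
  also have "\<dots> \<le> \<bar>frac_int \<alpha> (\<lambda>_. 5 * E) (t k)\<bar>" by simp
  also have "\<dots> \<le> 5 * E * t k powr \<alpha> / Gamma (\<alpha> + 1)"
    using tk E0 by (intro frac_int_bound \<alpha> loc_bounded_const) auto
  also have "\<dots> \<le> 5 * E * T powr \<alpha> / Gamma (\<alpha> + 1)"
    using tk E0 G \<alpha> by (intro divide_right_mono mult_left_mono powr_mono2) auto
  finally have Dv: "\<bar>caputo_L2 t (1 - \<alpha>) k v\<bar> \<le> 5 * E * T powr \<alpha> / Gamma (\<alpha> + 1)" .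
  define M where "M = lam * caputo_L2 t (1 - \<alpha>) k v"
  have M: "\<bar>M\<bar> \<le> lam * (5 * T powr \<alpha> / Gamma (\<alpha> + 1)) * E"
    using mult_left_mono[OF Dv lam] lam by (simp add: M_def abs_mult mult_ac)
  define b where "b = lam * a"
  have b: "0 \<le> b" using lam a by (simp add: b_def)
  have D: "lam * caputo_L2 t (1 - \<alpha>) k w = b * diff_quot t w k + M"
    unfolding split[of w] by (simp add: v_def M_def b_def algebra_simps)
  have key: "\<bar>diff_quot t w k\<bar> \<le> \<bar>s * diff_quot t w k + b * diff_quot t w k\<bar>" if "1 \<le> s" for s
  proof -
    have "1 * \<bar>diff_quot t w k\<bar> \<le> (s + b) * \<bar>diff_quot t w k\<bar>" using that b by (intro mult_right_mono) auto
    also have "\<dots> = \<bar>s * diff_quot t w k + b * diff_quot t w k\<bar>"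
      using that b by (simp add: abs_mult flip: distrib_right)
    finally show ?thesis by simp
  qed
  have "\<bar>diff_quot t w k\<bar> \<le> \<bar>M\<bar> + 6 * E"
  proof (cases "k \<le> 2")
    case True
    then show ?thesis using key[of 1] R E0 unfolding D by simp
  next
    case False
    define y z where "y = ratio t k" and "z = ratio t (k - 1)"
    have "y \<in> {1..1.7319}" "z \<in> {1..1.7319}"
    proof -
      have "k \<in> {2..N}" "k - 1 \<in> {2..N}" using k False by auto
      then show "y \<in> {1..1.7319}" "z \<in> {1..1.7319}" unfolding y_def z_def using rt by blast+
    qed
    then have c: "sigma0 y z + sigma1 y z + sigma2 y z = 1" "1 \<le> sigma0 y z" "sigma0 y z \<le> 2.158"
      "0 \<le> sigma2 y z" "sigma2 y z \<le> 0.455 * sigma0 y z"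
      using bdf3_coefficients[of y z] by auto
    \<comment> \<open>From the sum rule, \<open>- sigma1 = sigma0 + sigma2 - 1\<close>, which is at
      most \<open>1.455 * 2.158 - 1\<close>. Together with the residual these give
      \<open>6 * E\<close>.\<close>
    have "\<bar>sigma1 y z\<bar> \<le> 3" "\<bar>sigma2 y z\<bar> \<le> 2" using c by auto
    then have "\<bar>sigma1 y z * diff_quot t w (k - 1)\<bar> \<le> 3 * E" "\<bar>sigma2 y z * diff_quot t w (k - 2)\<bar> \<le> 2 * E"
      unfolding abs_mult using d[of "k - 1"] d[of "k - 2"] False by (auto intro!: mult_mono)
    moreover have "\<bar>(sigma0 y z * diff_quot t w k + sigma1 y z * diff_quot t w (k - 1)
        + sigma2 y z * diff_quot t w (k - 2)) + (b * diff_quot t w k + M)\<bar> \<le> E"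
      using R False unfolding D by (simp add: bdf3_def y_def z_def)
    ultimately show ?thesis using key[OF c(2)] by linarith
  qed
  then show ?thesis using M by (simp add: algebra_simps)
qed

text \<open>The constant depends on \<open>\<alpha>\<close>, \<open>lam\<close> and \<open>T\<close>
  but is fixed before the mesh. Induction on \<open>k\<close> proves a bound that grows like
  \<open>exp (\<kappa> * t k)\<close>: a small step is bounded directly, and a large step may
  multiply the previous bound by \<open>C1\<close>, which the exponential pays for because that step
  is longer than \<open>1 / \<omega>\<close>.\<close>

theorem bdf3_L2_stability:
  assumes \<alpha>: "0 < \<alpha>" "\<alpha> \<le> 1" and lam: "0 \<le> lam" and T: "0 < T"
  shows "\<exists>C\<ge>0. \<forall>N t w \<rho> n. time_mesh T N t \<longrightarrow> (\<forall>k\<in>{2..N}. ratio t k \<in> {1..1.7319}) \<longrightarrow> n \<le> N \<longrightarrow>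
      (\<forall>k\<in>{1..n}. \<bar>(if k \<le> 2 then diff_quot t w k else bdf3 t w k) + lam * caputo_L2 t (1 - \<alpha>) k w\<bar> \<le> \<rho>) \<longrightarrow>
      (\<forall>k\<in>{1..n}. \<bar>diff_quot t w k\<bar> \<le> C * \<rho>)"
proof -
  \<comment> \<open>The number 2000 is 400 times the factor 5 of the slope bound;
    \<open>lam + 1\<close> keeps the quotient defined when \<open>lam = 0\<close>.\<close>
  define \<epsilon> where "\<epsilon> = 1 / (2000 * exp 2 * (lam + 1))"
  have "0 < \<epsilon>" using lam by (simp add: \<epsilon>_def)
  then obtain \<omega> where \<omega>: "0 < \<omega>" "\<omega> powr (- \<alpha>) \<le> \<epsilon>" using exists_weight \<alpha>(1) by blast
  have \<omega>': "lam * (5 * exp 2 * \<omega> powr (- \<alpha>)) \<le> 1 / 400"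
  proof -
    have "lam * (5 * exp 2 * \<omega> powr (- \<alpha>)) \<le> lam * (5 * exp 2 * \<epsilon>)"
      using lam \<omega> by (intro mult_left_mono) auto
    also have "\<dots> = 5 * lam / (2000 * (lam + 1))" by (simp add: \<epsilon>_def)
    also have "\<dots> \<le> 1 / 400" using lam by (subst pos_divide_le_eq) auto
    finally show ?thesis .
  qed
  define C0 where "C0 = 400 * exp (\<omega> * T)"
  define C1 where "C1 = 6 + lam * (5 * T powr \<alpha> / Gamma (\<alpha> + 1))"
  have "0 < Gamma (\<alpha> + 1)" using \<alpha> by (intro Gamma_real_pos) simp
  then have C1: "1 \<le> C1" using lam T by (simp add: C1_def)
  \<comment> \<open>Chosen so that \<open>exp (\<kappa> * (1 / \<omega>)) = C1\<close>.\<close>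
  define \<kappa> where "\<kappa> = \<omega> * ln C1"
  have \<kappa>: "0 \<le> \<kappa>" using \<omega> C1 by (simp add: \<kappa>_def)
  have "1 \<le> exp (\<omega> * T)" using \<omega> T by simp
  then have C0: "1 \<le> C0" unfolding C0_def by linarith
  show ?thesis
  proof (intro exI[of _ "C0 * exp (\<kappa> * T)"] conjI allI impI ballI)
    show "0 \<le> C0 * exp (\<kappa> * T)" using C0 by simp
    fix N t w \<rho> n k
    assume mesh: "time_mesh T N t" and rt: "\<forall>k\<in>{2..N}. ratio t k \<in> {1..1.7319}" and n: "n \<le> N"
      and R0: "\<forall>k\<in>{1..n}. \<bar>(if k \<le> 2 then diff_quot t w k else bdf3 t w k) + lam * caputo_L2 t (1 - \<alpha>) k w\<bar> \<le> \<rho>"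
      and k0: "k \<in> {1..n}"
    have k: "1 \<le> k" "k \<le> n" using k0 by auto
    have R: "\<bar>(if k \<le> 2 then diff_quot t w k else bdf3 t w k) + lam * caputo_L2 t (1 - \<alpha>) k w\<bar> \<le> \<rho>"
      if "1 \<le> k" "k \<le> n" for k using R0 that by (simp only: atLeastAtMost_iff)
    have \<rho>: "0 \<le> \<rho>" using R[OF k] by linarith
    have bound: "\<bar>diff_quot t w k\<bar> \<le> C0 * \<rho> * exp (\<kappa> * t k)" if "1 \<le> k" "k \<le> n" for k
      using that
    proof (induction k rule: less_induct)
      case (less k)
      have tk: "0 \<le> t k" "t k \<le> T" using mesh_range[OF mesh, of k] less n by auto
      show ?case
      proof (cases "\<omega> * step t k \<le> 1")
        case True
        have "\<bar>diff_quot t w k\<bar> \<le> 400 * \<rho> * exp (\<omega> * t k)"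
          using less n by (intro bdf3_small_step_bound[OF mesh rt \<alpha>(1) lam \<omega>(1) \<omega>' _ _ True] R) auto
        also have "\<dots> \<le> 400 * \<rho> * exp (\<omega> * T)" using tk \<omega> \<rho> by (intro mult_left_mono) auto
        also have "\<dots> = C0 * \<rho> * 1" by (simp add: C0_def)
        also have "\<dots> \<le> C0 * \<rho> * exp (\<kappa> * t k)" using C0 \<rho> \<kappa> tk by (intro mult_left_mono) auto
        finally show ?thesis .
      next
        case False
        define E where "E = C0 * \<rho> * exp (\<kappa> * t (k - 1))"
        have tk1: "0 \<le> t (k - 1)" using mesh_range[OF mesh, of "k - 1"] less n by auto
        have "1 * \<rho> * 1 \<le> E" unfolding E_def using C0 \<rho> \<kappa> tk1 by (intro mult_mono) auto
        then have "\<bar>(if k \<le> 2 then diff_quot t w k else bdf3 t w k) + lam * caputo_L2 t (1 - \<alpha>) k w\<bar> \<le> E"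
          using R[OF less.prems] by simp
        moreover have "\<bar>diff_quot t w j\<bar> \<le> E" if j: "1 \<le> j" "j < k" for j
        proof -
          have "t j \<le> t (k - 1)" using j less n by (intro mesh_le[OF mesh]) auto
          then have "C0 * \<rho> * exp (\<kappa> * t j) \<le> E"
            unfolding E_def using C0 \<rho> \<kappa> by (intro mult_left_mono) (auto intro: mult_left_mono)
          then show ?thesis using less.IH[of j] j less.prems by simp
        qed
        ultimately have "\<bar>diff_quot t w k\<bar> \<le> C1 * E"
          unfolding C1_def using less n by (intro bdf3_any_step_bound[OF mesh rt \<alpha> lam]) auto
        also have "C1 = exp (\<kappa> * (1 / \<omega>))" using \<omega> C1 by (simp add: \<kappa>_def)
        \<comment> \<open>A large step advances time by more than \<open>1 / \<omega>\<close>; the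
          exponential therefore absorbs \<open>C1\<close>, and no counting of large steps is
          required.\<close>
        also have "exp (\<kappa> * (1 / \<omega>)) * E \<le> exp (\<kappa> * step t k) * E"
        proof -
          have "1 / \<omega> \<le> step t k"
            unfolding pos_divide_le_eq[OF \<omega>(1)] using False by (simp only: mult.commute not_le less_imp_le)
          then have "\<kappa> * (1 / \<omega>) \<le> \<kappa> * step t k" using \<kappa> by (rule mult_left_mono)
          then have "exp (\<kappa> * (1 / \<omega>)) \<le> exp (\<kappa> * step t k)" by (simp only: exp_le_cancel_iff)
          then show ?thesis using \<open>1 * \<rho> * 1 \<le> E\<close> \<rho> by (intro mult_right_mono) linarith+
        qed
        also have "\<dots> = C0 * \<rho> * exp (\<kappa> * t k)"
          by (simp add: E_def step_def algebra_simps flip: exp_add)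
        finally show ?thesis .
      qed
    qed
    have "\<kappa> * t k \<le> \<kappa> * T" using mesh_range[OF mesh, of k] k n \<kappa> by (intro mult_left_mono) auto
    then have "C0 * \<rho> * exp (\<kappa> * t k) \<le> C0 * \<rho> * exp (\<kappa> * T)"
      using C0 \<rho> by (intro mult_left_mono) auto
    then show "\<bar>diff_quot t w k\<bar> \<le> C0 * exp (\<kappa> * T) * \<rho>"
      using bound[OF k] by (simp add: mult_ac)
  qed
qed

subsection \<open>Truncation errors\<close>

lemma zero_derivative_bound:
  fixes f f' :: "real \<Rightarrow> real"
  assumes der: "\<And>s. (f has_real_derivative f' s) (at s)" and z: "x \<in> {a..c}" "f x = 0"
    and K: "\<And>s. s \<in> {a..c} \<Longrightarrow> \<bar>f' s\<bar> \<le> K" and s: "s \<in> {a..c}"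
  shows "\<bar>f s\<bar> \<le> K * (c - a)"
proof -
  have K0: "0 \<le> K" using K[OF s] by linarith
  have "norm (f s - f x) \<le> K * norm (s - x)"
    by (rule field_differentiable_bound[of "{a..c}" f f'])
      (use der K z s in \<open>auto intro: has_field_derivative_at_within\<close>)
  also have "\<dots> \<le> K * (c - a)" using K0 z s by (intro mult_left_mono) auto
  finally show ?thesis using z by simp
qed

lemma Rolle_derivative:
  fixes f f' :: "real \<Rightarrow> real"
  assumes "\<And>s. (f has_real_derivative f' s) (at s)" "a < b" "f a = f b"
  obtains z where "a < z" "z < b" "f' z = 0"
proof -
  have "\<exists>z. a < z \<and> z < b \<and> DERIV f z :> 0"
    by (rule Rolle[OF assms(2,3)])
      (use assms(1) in \<open>auto intro: DERIV_continuous_on has_field_derivative_at_within simp: real_differentiable_def\<close>)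
  then show ?thesis using that assms(1) DERIV_unique by blast
qed

text \<open>By Rolle \<open>e1\<close> has two zeros and \<open>e2\<close> has one; the bound on
  \<open>e3\<close> is then integrated back from these zeros, each time at the cost of one interval
  length.\<close>

lemma three_zeros_bound:
  fixes e e1 e2 e3 :: "real \<Rightarrow> real"
  assumes d: "\<And>s. (e has_real_derivative e1 s) (at s)" "\<And>s. (e1 has_real_derivative e2 s) (at s)"
      "\<And>s. (e2 has_real_derivative e3 s) (at s)"
    and z: "a < b" "b < c" "e a = 0" "e b = 0" "e c = 0"
    and M: "\<And>s. s \<in> {a..c} \<Longrightarrow> \<bar>e3 s\<bar> \<le> M" and s: "s \<in> {a..c}"
  shows "\<bar>e1 s\<bar> \<le> M * (c - a) * (c - a)" "\<bar>e s\<bar> \<le> M * (c - a) * (c - a) * (c - a)"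
proof -
  obtain x where x: "a < x" "x < b" "e1 x = 0" using Rolle_derivative[OF d(1) z(1)] z by auto
  obtain x' where x': "b < x'" "x' < c" "e1 x' = 0" using Rolle_derivative[OF d(1) z(2)] z by auto
  obtain \<xi> where \<xi>: "x < \<xi>" "\<xi> < x'" "e2 \<xi> = 0"
    using Rolle_derivative[OF d(2), of x x'] x x' by auto
  have b2: "\<bar>e2 s\<bar> \<le> M * (c - a)" if "s \<in> {a..c}" for s
    by (rule zero_derivative_bound[OF d(3) _ \<xi>(3) M that]) (use x x' \<xi> in auto)
  have b1: "\<bar>e1 s\<bar> \<le> M * (c - a) * (c - a)" if "s \<in> {a..c}" for s
    by (rule zero_derivative_bound[OF d(2) _ x(3) b2 that]) (use x z in auto)
  show "\<bar>e1 s\<bar> \<le> M * (c - a) * (c - a)" by (rule b1[OF s])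
  show "\<bar>e s\<bar> \<le> M * (c - a) * (c - a) * (c - a)"
    by (rule zero_derivative_bound[OF d(1) _ z(3) b1 s]) (use z in auto)
qed

text \<open>There is no fourth derivative to bound. The fourth zero of \<open>e\<close> instead
  produces a zero of \<open>e3\<close>, so \<open>e3\<close> is bounded by its own oscillation. For
  a cubic interpolation error the constant third derivative of the cubic drops out of that
  oscillation, which leaves the Hoelder modulus of \<open>y3\<close>.\<close>

lemma four_zeros_bound:
  fixes e e1 e2 e3 :: "real \<Rightarrow> real"
  assumes d: "\<And>s. (e has_real_derivative e1 s) (at s)" "\<And>s. (e1 has_real_derivative e2 s) (at s)"
      "\<And>s. (e2 has_real_derivative e3 s) (at s)"
    and z: "a < b" "b < c" "c < h" "e a = 0" "e b = 0" "e c = 0" "e h = 0"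
    and osc: "\<And>s s'. s \<in> {a..h} \<Longrightarrow> s' \<in> {a..h} \<Longrightarrow> \<bar>e3 s - e3 s'\<bar> \<le> K"
  shows "\<bar>e1 h\<bar> \<le> K * (h - a) * (h - a)"
proof -
  obtain x where x: "a < x" "x < b" "e1 x = 0" using Rolle_derivative[OF d(1) z(1)] z by auto
  obtain x' where x': "b < x'" "x' < c" "e1 x' = 0" using Rolle_derivative[OF d(1) z(2)] z by auto
  obtain x'' where x'': "c < x''" "x'' < h" "e1 x'' = 0" using Rolle_derivative[OF d(1) z(3)] z by auto
  obtain \<xi> where \<xi>: "x < \<xi>" "\<xi> < x'" "e2 \<xi> = 0"
    using Rolle_derivative[OF d(2), of x x'] x x' by auto
  obtain \<xi>' where \<xi>': "x' < \<xi>'" "\<xi>' < x''" "e2 \<xi>' = 0"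
    using Rolle_derivative[OF d(2), of x' x''] x' x'' by auto
  obtain \<zeta> where \<zeta>: "\<xi> < \<zeta>" "\<zeta> < \<xi>'" "e3 \<zeta> = 0"
    using Rolle_derivative[OF d(3), of \<xi> \<xi>'] \<xi> \<xi>' by auto
  have b3: "\<bar>e3 s\<bar> \<le> K" if "s \<in> {a..h}" for s
    using osc[OF that, of \<zeta>] \<zeta> \<xi> \<xi>' x x' x'' by auto
  have b2: "\<bar>e2 s\<bar> \<le> K * (h - a)" if "s \<in> {a..h}" for s
    by (rule zero_derivative_bound[OF d(3) _ \<xi>(3) b3 that]) (use x x' x'' \<xi> in auto)
  show ?thesis
    by (rule zero_derivative_bound[OF d(2) _ x(3) b2]) (use x z in auto)
qed

text \<open>With \<open>a\<close>, \<open>b\<close>, \<open>c\<close> three consecutive steps,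
  \<open>D2\<close> and \<open>D3\<close> are the divided differences at \<open>t k\<close> of the
  cubic Newton interpolant. The first claim identifies the BDF3 formula with the derivative of this
  cubic; the other two are needed to check that it interpolates at the two oldest nodes.\<close>

lemma bdf3_newton_algebra:
  fixes a b c d0 d1 d2 :: real
  assumes "0 < a" "0 < b" "0 < c"
  defines "D2 \<equiv> (d0 - d1) / (b + c)" and "D2' \<equiv> (d1 - d2) / (a + b)"
  defines "D3 \<equiv> (D2 - D2') / (a + b + c)"
  shows "sigma0 (c / b) (b / a) * d0 + sigma1 (c / b) (b / a) * d1 + sigma2 (c / b) (b / a) * d2
      = d0 + D2 * c + D3 * (c * (b + c))"
    and "D2 * ((b + c) * b) = b * (d0 - d1)"
    and "D2 * ((a + b + c) * (a + b)) - D3 * ((a + b + c) * (a + b) * a) = (a + b) * (d0 - d1) + a * (d1 - d2)"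
proof -
  have e2: "(b + c) * D2 = d0 - d1" and e2': "(a + b) * D2' = d1 - d2" and e3: "(a + b + c) * D3 = D2 - D2'"
    using assms(1-3) by (simp_all add: D2_def D2'_def D3_def)
  show "D2 * ((b + c) * b) = b * (d0 - d1)" using e2 by algebra
  show "D2 * ((a + b + c) * (a + b)) - D3 * ((a + b + c) * (a + b) * a) = (a + b) * (d0 - d1) + a * (d1 - d2)"
    using e2 e2' e3 by algebra
  \<comment> \<open>The three denominators are named so that the coefficient identities become
    polynomial.\<close>
  define u where "u = 1 / (b + c)"
  define v where "v = 1 / (a + b + c)"
  define x where "x = 1 / (a + b)"
  have s0: "sigma0 (c / b) (b / a) = 1 + c * u + c * v"
  proof -
    have "(2 * (c / b) + 1) / (c / b + 1) = 1 + c * u"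
      using assms(1-3) by (simp add: u_def divide_simps)
    moreover have "c / b * (b / a) / (c / b * (b / a) + b / a + 1) = c * v"
      using assms(1-3) by (simp add: v_def divide_simps)
    ultimately show ?thesis unfolding sigma0_def by simp
  qed
  have s2: "sigma2 (c / b) (b / a) = c * (b + c) * v * x"
  proof -
    have "c / b * (b / a)\<^sup>2 / (c / b * (b / a) + b / a + 1) = c * b / a * v"
      using assms(1-3) by (simp add: v_def power2_eq_square divide_simps)
    moreover have "(c / b + 1) / (b / a + 1) = (b + c) * a / b * x"
      using assms(1-3) by (simp add: x_def divide_simps) (simp add: algebra_simps)
    ultimately show ?thesis unfolding sigma2_def using assms(1-3) by simp
  qed
  have s1: "sigma1 (c / b) (b / a) = - c * u - c * v - c * (b + c) * v * x"
  proof -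
    have "- (c / b) / (c / b + 1) = - c * u"
      using assms(1-3) by (simp add: u_def divide_simps)
    moreover have "c / b * (b / a) / (c / b * (b / a) + b / a + 1) = c * v"
      using assms(1-3) by (simp add: v_def divide_simps)
    moreover have "c / b * (b / a)\<^sup>2 / (c / b * (b / a) + b / a + 1) * ((c / b + 1) / (b / a + 1)) = c * (b + c) * v * x"
      using s2 unfolding sigma2_def .
    ultimately show ?thesis unfolding sigma1_def by simp
  qed
  have i: "u * (b + c) = 1" "v * (a + b + c) = 1" "x * (a + b) = 1"
    using assms(1-3) by (simp_all add: u_def v_def x_def)
  show "sigma0 (c / b) (b / a) * d0 + sigma1 (c / b) (b / a) * d1 + sigma2 (c / b) (b / a) * d2
      = d0 + D2 * c + D3 * (c * (b + c))"
    unfolding s0 s1 s2 using i e2 e2' e3 by algebra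
qed

text \<open>The error of the cubic interpolant vanishes at four mesh points, and the BDF3 error is
  its derivative at the last of them. The oscillation of \<open>y3\<close> over at most three steps
  supplies the fractional part of the order.\<close>

lemma bdf3_truncation:
  fixes y y1 y2 y3 :: "real \<Rightarrow> real"
  assumes mesh: "time_mesh T N t" and rat: "\<And>k. k \<in> {2..N} \<Longrightarrow> 1 \<le> ratio t k" and k: "3 \<le> k" "k \<le> N"
    and dy: "\<And>s. (y has_real_derivative y1 s) (at s)" "\<And>s. (y1 has_real_derivative y2 s) (at s)"
      "\<And>s. (y2 has_real_derivative y3 s) (at s)"
    and hol: "\<And>a b. a \<le> b \<Longrightarrow> b \<le> T \<Longrightarrow> \<bar>y3 b - y3 a\<bar> \<le> C * (b - a) powr \<alpha>" and C: "0 \<le> C"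
    and \<alpha>: "0 < \<alpha>" "\<alpha> \<le> 1"
  shows "\<bar>bdf3 t (\<lambda>j. y (t j)) k - y1 (t k)\<bar> \<le> 27 * C * step t k powr (2 + \<alpha>)"
proof -
  define w where "w = (\<lambda>j. y (t j))"
  define a b c where "a = step t (k - 2)" and "b = step t (k - 1)" and "c = step t k"
  have pos: "0 < a" "0 < b" "0 < c"
    unfolding a_def b_def c_def using k by (auto intro!: step_pos[OF mesh])
  have le: "a \<le> c" "b \<le> c"
    unfolding a_def b_def c_def using k by (auto intro!: step_mono[OF mesh rat])
  define d0 d1 d2 where "d0 = diff_quot t w k" and "d1 = diff_quot t w (k - 1)" and "d2 = diff_quot t w (k - 2)"
  have kk: "k - 1 - 1 = k - 2" "k - 2 - 1 = k - 3" using k by auto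
  have tt: "t (k - 1) = t k - c" "t (k - 2) = t k - c - b" "t (k - 3) = t k - c - b - a"
    unfolding a_def b_def c_def step_def kk by simp_all
  have ww: "w (k - 1) = w k - c * d0" "w (k - 2) = w k - c * d0 - b * d1" "w (k - 3) = w k - c * d0 - b * d1 - a * d2"
    using pos unfolding d0_def d1_def d2_def diff_quot_def kk a_def[symmetric] b_def[symmetric] c_def[symmetric]
    by (simp_all)
  define D2 D2' where "D2 = (d0 - d1) / (b + c)" and "D2' = (d1 - d2) / (a + b)"
  define D3 where "D3 = (D2 - D2') / (a + b + c)"
  note alg = bdf3_newton_algebra(1)[OF pos, of d0 d1 d2, folded D2_def D2'_def, folded D3_def]
    bdf3_newton_algebra(2)[OF pos(1,2,3), of d0 d1, folded D2_def]
    bdf3_newton_algebra(3)[OF pos, of d0 d1 d2, folded D2_def D2'_def, folded D3_def]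
  have "ratio t k = c / b" "ratio t (k - 1) = b / a"
    unfolding ratio_def a_def b_def c_def kk by simp_all
  then have bdf: "bdf3 t w k = d0 + D2 * c + D3 * (c * (b + c))"
    using alg(1) by (simp add: bdf3_def d0_def d1_def d2_def)
  define p q r where "p = t k" and "q = t (k - 1)" and "r = t (k - 2)"
  define P where "P = (\<lambda>s. w k + d0 * (s - p) + D2 * ((s - p) * (s - q)) + D3 * ((s - p) * (s - q) * (s - r)))"
  define P1 where "P1 = (\<lambda>s. d0 + D2 * (2 * s - p - q) + D3 * ((s - q) * (s - r) + (s - p) * (s - r) + (s - p) * (s - q)))"
  define P2 where "P2 = (\<lambda>s. D2 * 2 + D3 * (6 * s - 2 * p - 2 * q - 2 * r))"
  have dP: "(P has_real_derivative P1 s) (at s)" "(P1 has_real_derivative P2 s) (at s)"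
    "(P2 has_real_derivative D3 * 6) (at s)" for s
    unfolding P_def P1_def P2_def by (auto intro!: derivative_eq_intros simp: algebra_simps)
  have "\<bar>y1 (t k) - P1 (t k)\<bar> \<le> C * (3 * c) powr \<alpha> * (t k - t (k - 3)) * (t k - t (k - 3))"
  proof (rule four_zeros_bound[of "\<lambda>s. y s - P s" "\<lambda>s. y1 s - P1 s" "\<lambda>s. y2 s - P2 s" "\<lambda>s. y3 s - D3 * 6"
        "t (k - 3)" "t (k - 2)" "t (k - 1)" "t k"])
    show "t (k - 3) < t (k - 2)" "t (k - 2) < t (k - 1)" "t (k - 1) < t k" using tt pos by auto
    show "y (t k) - P (t k) = 0" by (simp add: P_def p_def w_def)
    show "y (t (k - 1)) - P (t (k - 1)) = 0"
    proof -
      have "P (t (k - 1)) = w k - c * d0" unfolding P_def p_def q_def tt by (simp add: algebra_simps)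
      then show ?thesis using ww(1) by (simp add: w_def)
    qed
    have "y (t (k - 2)) = w k - c * d0 - b * d1" using ww(2) by (simp add: w_def)
    moreover have "P (t (k - 2)) = w k - (b + c) * d0 + D2 * ((b + c) * b)"
      unfolding P_def p_def q_def r_def tt by (simp add: algebra_simps)
    ultimately show "y (t (k - 2)) - P (t (k - 2)) = 0" unfolding alg(2) by (simp add: algebra_simps)
    have "y (t (k - 3)) = w k - c * d0 - b * d1 - a * d2" using ww(3) by (simp add: w_def)
    moreover have "P (t (k - 3)) = w k - (a + b + c) * d0
        + (D2 * ((a + b + c) * (a + b)) - D3 * ((a + b + c) * (a + b) * a))"
      unfolding P_def p_def q_def r_def tt by (simp add: algebra_simps)
    ultimately show "y (t (k - 3)) - P (t (k - 3)) = 0" unfolding alg(3) by (simp add: algebra_simps)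
  next
    fix s s' assume s: "s \<in> {t (k - 3)..t k}" "s' \<in> {t (k - 3)..t k}"
    have tk: "t k \<le> T" using mesh_range[OF mesh k(2)] by simp
    have d: "\<bar>s - s'\<bar> \<le> 3 * c" using s tt pos le by (auto simp: abs_le_iff)
    have "\<bar>y3 s - y3 s'\<bar> \<le> C * \<bar>s - s'\<bar> powr \<alpha>"
      using hol[of s s'] hol[of s' s] s tk by (cases "s \<le> s'") (auto simp: abs_minus_commute)
    also have "\<dots> \<le> C * (3 * c) powr \<alpha>" using C d \<alpha> by (intro mult_left_mono powr_mono2) auto
    finally show "\<bar>(y3 s - D3 * 6) - (y3 s' - D3 * 6)\<bar> \<le> C * (3 * c) powr \<alpha>" by simp
  qed (use dP dy in \<open>auto intro!: derivative_intros\<close>)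
  \<comment> \<open>The stencil is at most \<open>3 * c\<close> wide and
    \<open>3 powr \<alpha> \<le> 3\<close>, hence \<open>27 = 3 * 3 * 3\<close>.\<close>
  also have "\<dots> \<le> C * (3 * c powr \<alpha>) * (3 * c) * (3 * c)"
  proof -
    have "3 powr \<alpha> \<le> 3 powr 1" using \<alpha> by (intro powr_mono) auto
    then have "(3 * c) powr \<alpha> \<le> 3 * c powr \<alpha>" using pos by (simp add: powr_mult)
    then show ?thesis using C tt pos le by (intro mult_mono) auto
  qed
  also have "\<dots> = 27 * C * (c powr \<alpha> * c powr 2)" using pos by (simp add: power2_eq_square)
  also have "c powr \<alpha> * c powr 2 = c powr (2 + \<alpha>)" by (simp add: powr_add)
  finally have "\<bar>y1 (t k) - P1 (t k)\<bar> \<le> 27 * C * c powr (2 + \<alpha>)" .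
  moreover have "P1 (t k) = bdf3 t w k"
    unfolding bdf P1_def p_def q_def r_def tt by (simp add: algebra_simps)
  ultimately show ?thesis by (simp add: w_def c_def abs_minus_commute)
qed

text \<open>Integration by parts has no boundary terms and replaces the slope error
  \<open>e1\<close> by the interpolation error \<open>e\<close>, which is one order smaller. The
  derivative of the kernel in \<open>s\<close> is nonnegative, so its integral is the kernel
  difference, and such differences telescope over the cells. The condition \<open>b < u\<close>
  keeps the singularity away.\<close>

lemma kernel_by_parts_bound:
  fixes e e1 :: "real \<Rightarrow> real"
  assumes \<alpha>: "0 < \<alpha>" "\<alpha> \<le> 1" and ab: "a < b" "b < u"
    and de: "\<And>s. (e has_real_derivative e1 s) (at s)" and cont: "continuous_on {a..b} e1"
    and z: "e a = 0" "e b = 0" and K: "\<And>s. s \<in> {a..b} \<Longrightarrow> \<bar>e s\<bar> \<le> K"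
  shows "\<bar>LINT s:{a<..<b}|lborel. frac_kernel \<alpha> (u - s) * e1 s\<bar>
    \<le> K * (frac_kernel \<alpha> (u - b) - frac_kernel \<alpha> (u - a))"
proof -
  have G: "0 < Gamma \<alpha>" using \<alpha> by (simp add: Gamma_real_pos)
  define f where "f = (\<lambda>s. frac_kernel \<alpha> (u - s))"
  define f' where "f' = (\<lambda>s. (1 - \<alpha>) * (u - s) powr (\<alpha> - 2) / Gamma \<alpha>)"
  have df: "(f has_real_derivative f' s) (at s)" if "s \<in> {a..b}" for s
  proof -
    have "((\<lambda>s. (u - s) powr (\<alpha> - 1) / Gamma \<alpha>) has_real_derivative
        ((\<alpha> - 1) * (u - s) powr (\<alpha> - 1 - 1) * (-1)) / Gamma \<alpha>) (at s)"
      using that ab G by (auto intro!: derivative_eq_intros)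
    moreover have "((\<alpha> - 1) * (u - s) powr (\<alpha> - 1 - 1) * (-1)) / Gamma \<alpha> = f' s"
      by (simp add: f'_def left_diff_distrib diff_divide_distrib)
    ultimately show ?thesis by (simp add: f_def frac_kernel_def)
  qed
  have f'0: "0 \<le> f' s" for s using \<alpha> G by (simp add: f'_def)
  have i2: "(f' has_integral (f b - f a)) {a..b}"
    using ab df by (intro fundamental_theorem_of_calculus)
      (auto simp: has_real_derivative_iff_has_vector_derivative[symmetric] intro: has_field_derivative_at_within)
  have "((\<lambda>s. f s * e1 s + f' s * e s) has_integral (f b * e b - f a * e a)) {a..b}"
  proof (rule fundamental_theorem_of_calculus)
    fix s assume s: "s \<in> {a..b}"
    have "((\<lambda>s. f s * e s) has_real_derivative (f' s * e s + e1 s * f s)) (at s)"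
      by (rule DERIV_mult[OF df[OF s] de])
    then show "((\<lambda>s. f s * e s) has_vector_derivative f s * e1 s + f' s * e s) (at s within {a..b})"
      by (auto simp: has_real_derivative_iff_has_vector_derivative[symmetric] algebra_simps
          intro: has_field_derivative_at_within)
  qed (use ab in simp)
  then have i0: "((\<lambda>s. f s * e1 s + f' s * e s) has_integral 0) {a..b}" by (simp add: z)
  have cf: "continuous_on {a..b} f"
    using df by (meson DERIV_continuous_on has_field_derivative_at_within)
  have cfe: "continuous_on {a..b} (\<lambda>s. f s * e1 s)" by (intro continuous_intros cf cont)
  define I where "I = integral {a..b} (\<lambda>s. f s * e1 s)"
  have i1: "((\<lambda>s. f s * e1 s) has_integral I) {a..b}"
    unfolding I_def by (intro integrable_integral integrable_continuous_interval cfe)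
  have i3: "((\<lambda>s. f' s * e s) has_integral - I) {a..b}"
    using has_integral_diff[OF i0 i1] by simp
  have i4: "((\<lambda>s. f' s * K) has_integral (f b - f a) * K) {a..b}"
    by (rule has_integral_mult_left[OF i2])
  have "norm (integral {a..b} (\<lambda>s. f' s * e s)) \<le> integral {a..b} (\<lambda>s. f' s * K)"
  proof (rule Henstock_Kurzweil_Integration.integral_norm_bound_integral)
    fix s assume "s \<in> {a..b}"
    then show "norm (f' s * e s) \<le> f' s * K"
      using K f'0[of s] by (simp add: abs_mult mult_left_mono)
  qed (use i3 i4 in blast)+
  then have "\<bar>I\<bar> \<le> K * (f b - f a)" unfolding integral_unique[OF i3] integral_unique[OF i4] by (simp add: mult.commute)
  moreover have "(LINT s:{a<..<b}|lborel. f s * e1 s) = I"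
  proof -
    have "set_integrable lborel {a..b} (\<lambda>s. f s * e1 s)" by (rule borel_integrable_atLeastAtMost'[OF cfe])
    then have "set_integrable lborel {a<..<b} (\<lambda>s. f s * e1 s)" by (rule set_integrable_subset) auto
    then show ?thesis
      using set_borel_integral_eq_integral(2) i1 by (metis has_integral_Icc_iff_Ioo integral_unique)
  qed
  ultimately show ?thesis by (simp add: f_def)
qed

lemma continuous_imp_loc_bounded:
  assumes "continuous_on UNIV (f :: real \<Rightarrow> real)"
  shows "loc_bounded f"
  unfolding loc_bounded_def
proof (intro conjI allI)
  show "f \<in> borel_measurable borel" by (rule borel_measurable_continuous_onI[OF assms])
  fix T
  have "bounded (f ` {0..T})"
    by (intro compact_imp_bounded compact_continuous_image continuous_on_subset[OF assms] compact_Icc) auto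
  then obtain B where "0 < B" "\<forall>s\<in>{0..T}. \<bar>f s\<bar> \<le> B" by (auto simp: bounded_pos)
  then show "\<exists>B\<ge>0. \<forall>s\<in>{0<..<T}. \<bar>f s\<bar> \<le> B" by (intro exI[of _ B]) auto
qed

lemma derivative_imp_loc_bounded:
  assumes "\<And>s. (f has_real_derivative f' s) (at s)"
  shows "loc_bounded f"
  by (intro continuous_imp_loc_bounded continuous_at_imp_continuous_on ballI DERIV_isCont[OF assms])

section \<open>Linearity and consistency of the discrete Caputo derivative\<close>

lemma interp_slope_lincomb:
  "interp_slope t k (\<lambda>i. a * u i + b * v i) j s = a * interp_slope t k u j s + b * interp_slope t k v j s"
proof -
  have d: "diff_quot t (\<lambda>i. a * u i + b * v i) i = a * diff_quot t u i + b * diff_quot t v i" for i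
    unfolding diff_quot_def times_divide_eq_right add_divide_distrib[symmetric] by (simp add: algebra_simps)
  show ?thesis
  proof (cases "k = 1")
    case True
    then show ?thesis by (simp add: interp_slope_def d)
  next
    case False
    define i where "i = min j (k - 1)"
    define \<theta> where "\<theta> = (2 * s - t (i - 1) - t i) / (t (i + 1) - t (i - 1))"
    have eq: "interp_slope t k w j s = diff_quot t w i + \<theta> * (diff_quot t w (i + 1) - diff_quot t w i)" for w
      unfolding interp_slope_def Let_def i_def \<theta>_def using False by simp
    show ?thesis unfolding eq d by (simp add: algebra_simps)
  qed
qed

lemma caputo_L2_lincomb:
  assumes mesh: "time_mesh T N t" and k: "1 \<le> k" "k \<le> N" and \<alpha>: "0 < \<alpha>"
  shows "caputo_L2 t (1 - \<alpha>) k (\<lambda>i. a * u i + b * v i)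
    = a * caputo_L2 t (1 - \<alpha>) k u + b * caputo_L2 t (1 - \<alpha>) k v"
proof -
  have int: "set_integrable lborel {t (j - 1)<..<t j} (\<lambda>s. frac_kernel \<alpha> (t k - s) * interp_slope t k w j s)"
    if "j \<in> {1..k}" for j w
    using that k by (intro interp_slope_integrable \<alpha> mesh_le[OF mesh]) auto
  have "(LINT s:{t (j - 1)<..<t j}|lborel. frac_kernel \<alpha> (t k - s) * interp_slope t k (\<lambda>i. a * u i + b * v i) j s)
      = a * (LINT s:{t (j - 1)<..<t j}|lborel. frac_kernel \<alpha> (t k - s) * interp_slope t k u j s)
      + b * (LINT s:{t (j - 1)<..<t j}|lborel. frac_kernel \<alpha> (t k - s) * interp_slope t k v j s)"
    if j: "j \<in> {1..k}" for j
  proof -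
    have "(LINT s:{t (j - 1)<..<t j}|lborel. frac_kernel \<alpha> (t k - s) * interp_slope t k (\<lambda>i. a * u i + b * v i) j s)
      = (LINT s:{t (j - 1)<..<t j}|lborel. a * (frac_kernel \<alpha> (t k - s) * interp_slope t k u j s)
          + b * (frac_kernel \<alpha> (t k - s) * interp_slope t k v j s))"
      unfolding interp_slope_lincomb by (simp add: algebra_simps)
    also have "\<dots> = (LINT s:{t (j - 1)<..<t j}|lborel. a * (frac_kernel \<alpha> (t k - s) * interp_slope t k u j s))
        + (LINT s:{t (j - 1)<..<t j}|lborel. b * (frac_kernel \<alpha> (t k - s) * interp_slope t k v j s))"
      by (intro set_integral_add(2) set_integrable_mult_right int[OF j])
    finally show ?thesis by simp
  qed
  then show ?thesis
    unfolding caputo_L2_eq_sum[OF mesh k \<alpha>] by (simp add: sum.distrib sum_distrib_left)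
qed

lemma interp_slope_cong:
  assumes "1 \<le> k" "1 \<le> j" "j \<le> k" "\<And>i. i \<le> k \<Longrightarrow> u i = v i"
  shows "interp_slope t k u j s = interp_slope t k v j s"
proof -
  have d: "diff_quot t u i = diff_quot t v i" if "i \<le> k" for i
    using assms(4)[of i] assms(4)[of "i - 1"] that by (simp add: diff_quot_def)
  show ?thesis
  proof (cases "k = 1")
    case True
    then show ?thesis using d[of 1] by (simp add: interp_slope_def)
  next
    case False
    define i where "i = min j (k - 1)"
    have i: "i \<le> k" "i + 1 \<le> k" using False assms unfolding i_def by auto
    show ?thesis
      using d[OF i(1)] d[OF i(2)] unfolding interp_slope_def Let_def i_def using False by simp
  qed
qed

text \<open>The scheme applies the discrete derivative separately at each \<open>x\<close>. As a
  finite sum with weights that depend on the mesh alone, it can be interchanged with the inner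
  product in space.\<close>

lemma caputo_L2_eq_coeff_sum:
  assumes mesh: "time_mesh T N t" and k: "1 \<le> k" "k \<le> N" and \<alpha>: "0 < \<alpha>"
  shows "caputo_L2 t (1 - \<alpha>) k w = (\<Sum>i\<le>k. w i * caputo_L2 t (1 - \<alpha>) k (\<lambda>j. if j = i then 1 else 0))"
proof -
  define e :: "nat \<Rightarrow> nat \<Rightarrow> real" where "e = (\<lambda>i j. if j = i then 1 else 0)"
  have zero: "caputo_L2 t (1 - \<alpha>) k (\<lambda>j. 0) = 0"
    using caputo_L2_lincomb[OF mesh k \<alpha>, of 0 "\<lambda>_. 0" 0 "\<lambda>_. 0"] by simp
  have sum: "caputo_L2 t (1 - \<alpha>) k (\<lambda>j. \<Sum>i\<in>I. w i * e i j) = (\<Sum>i\<in>I. w i * caputo_L2 t (1 - \<alpha>) k (e i))"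
    if "finite I" for I
    using that
  proof (induction I)
    case (insert x I)
    have "caputo_L2 t (1 - \<alpha>) k (\<lambda>j. \<Sum>i\<in>insert x I. w i * e i j)
       = caputo_L2 t (1 - \<alpha>) k (\<lambda>j. w x * e x j + 1 * (\<Sum>i\<in>I. w i * e i j))" using insert by simp
    also have "\<dots> = w x * caputo_L2 t (1 - \<alpha>) k (e x) + 1 * caputo_L2 t (1 - \<alpha>) k (\<lambda>j. \<Sum>i\<in>I. w i * e i j)"
      by (rule caputo_L2_lincomb[OF mesh k \<alpha>])
    finally show ?case using insert by simp
  qed (simp add: zero)
  define v where "v = (\<lambda>j. \<Sum>i\<le>k. w i * e i j)"
  have wv: "w j = v j" if "j \<le> k" for j
  proof -
    have "v j = (\<Sum>i\<le>k. if j = i then w i else 0)" unfolding v_def e_def by (intro sum.cong) auto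
    also have "\<dots> = w j" using that by simp
    finally show ?thesis by simp
  qed
  have "interp_slope t k w j = interp_slope t k v j" if "j \<in> {1..k}" for j
    using that k wv by (intro ext interp_slope_cong) auto
  then have "caputo_L2 t (1 - \<alpha>) k w = caputo_L2 t (1 - \<alpha>) k v"
    unfolding caputo_L2_eq_sum[OF mesh k \<alpha>] by (intro sum.cong) auto
  then show ?thesis using sum[of "{..k}"] by (simp add: v_def e_def)
qed

lemma caputo_L2_truncation_sum:
  assumes mesh: "time_mesh T N t" and k: "1 \<le> k" "k \<le> N" and \<alpha>: "0 < \<alpha>" and g: "loc_bounded g"
  shows "\<bar>caputo_L2 t (1 - \<alpha>) k w - frac_int \<alpha> g (t k)\<bar>
    \<le> (\<Sum>j=1..k. \<bar>LINT s:{t (j - 1)<..<t j}|lborel. frac_kernel \<alpha> (t k - s) * (interp_slope t k w j s - g s)\<bar>)"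
proof -
  have t0: "t 0 = 0" using mesh by (simp add: time_mesh_def)
  have intg: "set_integrable lborel {t (j - 1)<..<t j} (\<lambda>s. frac_kernel \<alpha> (t k - s) * g s)"
    if "1 \<le> j" "j \<le> k" for j
  proof (rule set_integrable_subset[OF frac_int_integrable[OF \<alpha> g, of "t k"]])
    have "j - 1 \<le> N" using that k by simp
    then have "0 \<le> t (j - 1)" "t j \<le> t k"
      using mesh_range[OF mesh] mesh_le[OF mesh] that k by auto
    then show "{t (j - 1)<..<t j} \<subseteq> {0<..<t k}" by auto
  qed simp
  have "frac_int \<alpha> g (t k) = (\<Sum>j=1..k. LINT s:{t (j - 1)<..<t j}|lborel. frac_kernel \<alpha> (t k - s) * g s)"
    unfolding frac_int_def
    using set_integral_mesh[of k t "\<lambda>s. frac_kernel \<alpha> (t k - s) * g s"] mesh_less[OF mesh] intg k t0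
    by auto
  then have "caputo_L2 t (1 - \<alpha>) k w - frac_int \<alpha> g (t k)
      = (\<Sum>j=1..k. (LINT s:{t (j - 1)<..<t j}|lborel. frac_kernel \<alpha> (t k - s) * interp_slope t k w j s)
        - (LINT s:{t (j - 1)<..<t j}|lborel. frac_kernel \<alpha> (t k - s) * g s))"
    unfolding caputo_L2_eq_sum[OF mesh k \<alpha>] by (simp add: sum_subtractf)
  also have "\<dots> = (\<Sum>j=1..k. LINT s:{t (j - 1)<..<t j}|lborel. frac_kernel \<alpha> (t k - s) * (interp_slope t k w j s - g s))"
  proof (rule sum.cong[OF refl])
    fix j assume j: "j \<in> {1..k}"
    have i: "set_integrable lborel {t (j - 1)<..<t j} (\<lambda>s. frac_kernel \<alpha> (t k - s) * interp_slope t k w j s)"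
      using j k by (intro interp_slope_integrable \<alpha> mesh_le[OF mesh]) auto
    show "(LINT s:{t (j - 1)<..<t j}|lborel. frac_kernel \<alpha> (t k - s) * interp_slope t k w j s)
        - (LINT s:{t (j - 1)<..<t j}|lborel. frac_kernel \<alpha> (t k - s) * g s)
      = (LINT s:{t (j - 1)<..<t j}|lborel. frac_kernel \<alpha> (t k - s) * (interp_slope t k w j s - g s))"
      using set_integral_diff(2)[OF i intg[of j]] j by (simp add: right_diff_distrib)
  qed
  finally show ?thesis by (simp only: sum_abs)
qed

text \<open>On all cells but the last the error is integrated by parts; the kernel differences add
  up to at most the kernel value at distance \<open>c\<close>. On the last cell, where the kernel is
  singular, the slope error of order 2 meets the kernel integral of order \<open>\<alpha>\<close>.
  Both contributions have order \<open>2 + \<alpha>\<close>.\<close>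

lemma caputo_L2_truncation:
  fixes y y1 y2 y3 :: "real \<Rightarrow> real"
  assumes mesh: "time_mesh T N t" and rat: "\<And>k. k \<in> {2..N} \<Longrightarrow> 1 \<le> ratio t k" and k: "2 \<le> k" "k \<le> N"
    and dy: "\<And>s. (y has_real_derivative y1 s) (at s)" "\<And>s. (y1 has_real_derivative y2 s) (at s)"
      "\<And>s. (y2 has_real_derivative y3 s) (at s)"
    and M: "\<And>s. s \<in> {0..T} \<Longrightarrow> \<bar>y3 s\<bar> \<le> M"
    and \<alpha>: "0 < \<alpha>" "\<alpha> \<le> 1"
  shows "\<bar>caputo_L2 t (1 - \<alpha>) k (\<lambda>j. y (t j)) - frac_int \<alpha> y1 (t k)\<bar>
    \<le> (8 / Gamma \<alpha> + 4 / Gamma (\<alpha> + 1)) * M * step t k powr (2 + \<alpha>)"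
proof -
  define w where "w = (\<lambda>j. y (t j))"
  define c where "c = step t k"
  define b where "b = frac_kernel \<alpha>"
  have c: "0 < c" unfolding c_def using k by (intro step_pos[OF mesh]) auto
  have M0: "0 \<le> M" using M[of 0] mesh_range[OF mesh, of 0] by (smt (verit) atLeastAtMost_iff zero_le)
  have est: "\<bar>interp_slope t k w j s - y1 s\<bar> \<le> 4 * M * c\<^sup>2" and est': "\<exists>e. (\<forall>s. (e has_real_derivative (interp_slope t k w j s - y1 s)) (at s))
      \<and> e (t (j - 1)) = 0 \<and> e (t j) = 0 \<and> (\<forall>s\<in>{t (j - 1)..t j}. \<bar>e s\<bar> \<le> 8 * M * c ^ 3)"
    if j: "1 \<le> j" "j \<le> k" and s: "s \<in> {t (j - 1)..t j}" for j s
  proof -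
    define i where "i = min j (k - 1)"
    have i: "1 \<le> i" "i + 1 \<le> k" "i = j \<or> j = i + 1" "i \<le> j"
      unfolding i_def using k j by (simp_all add: min_def) linarith+
    have lt: "t (i - 1) < t i" "t i < t (i + 1)" using i k by (auto intro!: mesh_less[OF mesh])
    have st: "step t i \<le> c" "step t (i + 1) \<le> c" unfolding c_def using i k by (auto intro!: step_mono[OF mesh rat])
    have H: "t (i + 1) - t (i - 1) \<le> 2 * c" using st by (simp add: step_def)
    define K where "K = (diff_quot t w (i + 1) - diff_quot t w i) / (t (i + 1) - t (i - 1))"
    define P where "P = (\<lambda>s. w i + diff_quot t w i * (s - t i) + K * ((s - t i) * (s - t (i - 1))))"
    define P1 where "P1 = (\<lambda>s. diff_quot t w i + K * (2 * s - t (i - 1) - t i))"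
    have slope: "interp_slope t k w j s = P1 s" for s
      unfolding interp_slope_def Let_def P1_def K_def i_def using k by simp
    have dP: "(P has_real_derivative P1 s) (at s)" "(P1 has_real_derivative K * 2) (at s)"
      "((\<lambda>s. K * 2) has_real_derivative 0) (at s)" for s
      unfolding P_def P1_def by (auto intro!: derivative_eq_intros simp: algebra_simps)
    have z: "P (t (i - 1)) = w (i - 1)" "P (t i) = w i" "P (t (i + 1)) = w (i + 1)"
    proof -
      have d: "diff_quot t w i * (t i - t (i - 1)) = w i - w (i - 1)"
        "diff_quot t w (i + 1) * (t (i + 1) - t i) = w (i + 1) - w i"
        using lt by (simp_all add: diff_quot_def step_def)
      have K: "K * (t (i + 1) - t (i - 1)) = diff_quot t w (i + 1) - diff_quot t w i"
        using lt by (simp add: K_def)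
      show "P (t i) = w i" by (simp add: P_def)
      show "P (t (i - 1)) = w (i - 1)" unfolding P_def using d(1) by algebra
      show "P (t (i + 1)) = w (i + 1)" unfolding P_def using d(2) K by algebra
    qed
    have ze: "P (t (i - 1)) - y (t (i - 1)) = 0" "P (t i) - y (t i) = 0" "P (t (i + 1)) - y (t (i + 1)) = 0"
      using z by (simp_all add: w_def)
    have rng: "0 \<le> t (i - 1)" "t (i + 1) \<le> T" using mesh_range[OF mesh, of "i - 1"] mesh_range[OF mesh, of "i + 1"] i k by auto
    have de: "((\<lambda>s. P s - y s) has_real_derivative P1 s - y1 s) (at s)"
      "((\<lambda>s. P1 s - y1 s) has_real_derivative K * 2 - y2 s) (at s)"
      "((\<lambda>s. K * 2 - y2 s) has_real_derivative 0 - y3 s) (at s)" for s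
      by (intro derivative_intros dP dy)+
    have M3: "\<bar>0 - y3 s\<bar> \<le> M" if "s \<in> {t (i - 1)..t (i + 1)}" for s
      using M[of s] rng that by auto
    have tb: "\<bar>P1 s - y1 s\<bar> \<le> M * (t (i + 1) - t (i - 1)) * (t (i + 1) - t (i - 1))"
      "\<bar>P s - y s\<bar> \<le> M * (t (i + 1) - t (i - 1)) * (t (i + 1) - t (i - 1)) * (t (i + 1) - t (i - 1))"
      if "s \<in> {t (i - 1)..t (i + 1)}" for s
      using three_zeros_bound[of "\<lambda>s. P s - y s" "\<lambda>s. P1 s - y1 s" "\<lambda>s. K * 2 - y2 s" "\<lambda>s. 0 - y3 s", OF de lt ze M3 that]
      by auto
    \<comment> \<open>The stencil has width at most \<open>2 * c\<close>; this produces the factor 4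
      for the slope and 8 for the value.\<close>
    have q2: "M * (t (i + 1) - t (i - 1)) * (t (i + 1) - t (i - 1)) \<le> M * (2 * c) * (2 * c)"
      using M0 lt H c by (intro mult_mono) auto
    have q3: "M * (t (i + 1) - t (i - 1)) * (t (i + 1) - t (i - 1)) * (t (i + 1) - t (i - 1)) \<le> M * (2 * c) * (2 * c) * (2 * c)"
      using M0 lt H c q2 by (intro mult_mono) auto
    have sub: "{t (j - 1)..t j} \<subseteq> {t (i - 1)..t (i + 1)}" using i(3) lt by auto
    show "\<bar>interp_slope t k w j s - y1 s\<bar> \<le> 4 * M * c\<^sup>2"
      using tb(1)[of s] q2 sub s unfolding slope by (auto simp: power2_eq_square)
    show "\<exists>e. (\<forall>s. (e has_real_derivative (interp_slope t k w j s - y1 s)) (at s))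
      \<and> e (t (j - 1)) = 0 \<and> e (t j) = 0 \<and> (\<forall>s\<in>{t (j - 1)..t j}. \<bar>e s\<bar> \<le> 8 * M * c ^ 3)"
    proof (intro exI[of _ "\<lambda>s. P s - y s"] conjI allI ballI)
      fix s assume "s \<in> {t (j - 1)..t j}"
      then show "\<bar>P s - y s\<bar> \<le> 8 * M * c ^ 3"
        using tb(2)[of s] q3 sub by (auto simp: power3_eq_cube)
    qed (use i(3) ze de slope in auto)
  qed
  have c1: "continuous_on S y1" for S
    by (intro continuous_at_imp_continuous_on ballI DERIV_isCont[OF dy(2)])
  have early: "\<bar>LINT s:{t (j - 1)<..<t j}|lborel. b (t k - s) * (interp_slope t k w j s - y1 s)\<bar>
      \<le> 8 * M * c ^ 3 * (b (t k - t j) - b (t k - t (j - 1)))" if j: "1 \<le> j" "j < k" for j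
  proof -
    have tj: "t (j - 1) < t j" "t j < t k" using j k by (auto intro: mesh_less[OF mesh])
    obtain e where "\<forall>s. (e has_real_derivative (interp_slope t k w j s - y1 s)) (at s)"
      "e (t (j - 1)) = 0" "e (t j) = 0" "\<forall>s\<in>{t (j - 1)..t j}. \<bar>e s\<bar> \<le> 8 * M * c ^ 3"
      using est'[of j "t j"] j tj by auto
    then show ?thesis
      unfolding b_def using tj
      by (intro kernel_by_parts_bound[OF \<alpha>, of _ _ _ e] continuous_intros interp_slope_continuous c1) auto
  qed
  have last: "\<bar>LINT s:{t (k - 1)<..<t k}|lborel. b (t k - s) * (interp_slope t k w k s - y1 s)\<bar>
      \<le> 4 / Gamma (\<alpha> + 1) * M * c powr (2 + \<alpha>)"
  proof -
    have tk: "t (k - 1) < t k" using k by (auto intro: mesh_less[OF mesh])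
    have "(\<lambda>s. interp_slope t k w k s - y1 s) \<in> borel_measurable borel"
      by (intro borel_measurable_continuous_onI continuous_intros interp_slope_continuous c1)
    then have "set_borel_measurable lborel {t (k - 1)<..<t k} (\<lambda>s. interp_slope t k w k s - y1 s)"
      by (simp add: set_borel_measurable_def)
    then have "\<bar>LINT s:{t (k - 1)<..<t k}|lborel. b (t k - s) * (interp_slope t k w k s - y1 s)\<bar>
      \<le> 4 * M * c\<^sup>2 * ((t k - t (k - 1)) powr \<alpha> - (t k - t k) powr \<alpha>) / Gamma (\<alpha> + 1)"
      unfolding b_def using tk k by (intro set_integrable_kernel_mult(2) \<alpha> est) auto
    also have "\<dots> = 4 / Gamma (\<alpha> + 1) * M * (c\<^sup>2 * c powr \<alpha>)"
      using \<alpha> by (simp add: c_def step_def)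
    also have "c\<^sup>2 * c powr \<alpha> = c powr (2 + \<alpha>)" using c by (simp add: powr_add)
    finally show ?thesis .
  qed
  have tel: "(\<Sum>j=1..n. b (t k - t j) - b (t k - t (j - 1))) = b (t k - t n) - b (t k - t 0)" for n
    by (induction n) auto
  have "\<bar>caputo_L2 t (1 - \<alpha>) k w - frac_int \<alpha> y1 (t k)\<bar>
      \<le> (\<Sum>j=1..k. \<bar>LINT s:{t (j - 1)<..<t j}|lborel. b (t k - s) * (interp_slope t k w j s - y1 s)\<bar>)"
    unfolding b_def using k by (intro caputo_L2_truncation_sum[OF mesh] \<alpha> derivative_imp_loc_bounded[OF dy(2)]) auto
  also have "\<dots> = (\<Sum>j=1..k - 1. \<bar>LINT s:{t (j - 1)<..<t j}|lborel. b (t k - s) * (interp_slope t k w j s - y1 s)\<bar>)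
      + \<bar>LINT s:{t (k - 1)<..<t k}|lborel. b (t k - s) * (interp_slope t k w k s - y1 s)\<bar>"
  proof -
    obtain n where "k = Suc n" using k by (cases k) auto
    then show ?thesis by simp
  qed
  also have "\<dots> \<le> (\<Sum>j=1..k - 1. 8 * M * c ^ 3 * (b (t k - t j) - b (t k - t (j - 1))))
      + 4 / Gamma (\<alpha> + 1) * M * c powr (2 + \<alpha>)"
  proof (intro add_mono sum_mono last)
    fix j assume j: "j \<in> {1..k - 1}"
    show "\<bar>LINT s:{t (j - 1)<..<t j}|lborel. b (t k - s) * (interp_slope t k w j s - y1 s)\<bar>
      \<le> 8 * M * c ^ 3 * (b (t k - t j) - b (t k - t (j - 1)))"
      using j k by (intro early) auto
  qed
  also have "(\<Sum>j=1..k - 1. 8 * M * c ^ 3 * (b (t k - t j) - b (t k - t (j - 1))))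
      = 8 * M * c ^ 3 * (b (t k - t (k - 1)) - b (t k - t 0))"
    by (simp only: sum_distrib_left[symmetric] tel)
  \<comment> \<open>Only the kernel value nearest to the singularity survives; the one at
    \<open>t 0\<close> enters with a negative sign.\<close>
  also have "\<dots> \<le> 8 * M * c ^ 3 * (c powr (\<alpha> - 1) / Gamma \<alpha>)"
  proof (rule mult_left_mono)
    have "b (t k - t (k - 1)) = c powr (\<alpha> - 1) / Gamma \<alpha>" by (simp add: b_def frac_kernel_def c_def step_def)
    then show "b (t k - t (k - 1)) - b (t k - t 0) \<le> c powr (\<alpha> - 1) / Gamma \<alpha>"
      using frac_kernel_nonneg[OF \<alpha>(1), of "t k - t 0"] by (simp add: b_def)
  qed (use M0 c in simp)
  also have "\<dots> = 8 / Gamma \<alpha> * M * (c powr 3 * c powr (\<alpha> - 1))"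
    using c by (simp add: powr_numeral)
  also have "c powr 3 * c powr (\<alpha> - 1) = c powr (2 + \<alpha>)" by (simp add: powr_add[symmetric])
  finally show ?thesis by (simp add: w_def c_def algebra_simps)
qed


text \<open>Consistency bounds the residual of the error sequence, stability bounds its difference
  quotients, and summing these over the steps bounds the error by the final time times their
  maximum. No order is lost in the summation because the step lengths add up to at most
  \<open>T\<close>.\<close>

theorem scalar_convergence:
  fixes y y1 y2 y3 :: "real \<Rightarrow> real"
  assumes \<alpha>: "0 < \<alpha>" "\<alpha> \<le> 1" and lam: "0 \<le> lam" and T: "0 < T"
    and dy: "\<And>s. (y has_real_derivative y1 s) (at s)" "\<And>s. (y1 has_real_derivative y2 s) (at s)"
      "\<And>s. (y2 has_real_derivative y3 s) (at s)"
    and z: "y 0 = 0" "y1 0 = 0" "y2 0 = 0" "y3 0 = 0"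
    and hol0: "\<forall>a b. a \<le> b \<longrightarrow> b \<le> T \<longrightarrow> \<bar>y3 b - y3 a\<bar> \<le> C * (b - a) powr \<alpha>" and C: "0 \<le> C"
  shows "\<exists>Q\<ge>0. \<forall>N t Y. time_mesh T N t \<longrightarrow> (\<forall>k\<in>{2..N}. ratio t k \<in> {1..1.7319}) \<longrightarrow> Y 0 = 0 \<longrightarrow>
      (\<forall>k\<in>{1..N}. (if k \<le> 2 then diff_quot t Y k else bdf3 t Y k) + lam * caputo_L2 t (1 - \<alpha>) k Y
          = y1 (t k) + lam * frac_int \<alpha> y1 (t k)) \<longrightarrow>
      (\<forall>n\<in>{1..N}. \<bar>y (t n) - Y n\<bar> \<le> Q * step t n powr (2 + \<alpha>))"
proof -
  have hol: "\<bar>y3 b - y3 a\<bar> \<le> C * (b - a) powr \<alpha>" if "a \<le> b" "b \<le> T" for a b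
    using hol0 that by blast
  obtain S where S: "0 \<le> S" and stab0: "\<forall>N t w \<rho> n. time_mesh T N t \<longrightarrow>
      (\<forall>k\<in>{2..N}. ratio t k \<in> {1..1.7319}) \<longrightarrow> n \<le> N \<longrightarrow>
      (\<forall>k\<in>{1..n}. \<bar>(if k \<le> 2 then diff_quot t w k else bdf3 t w k) + lam * caputo_L2 t (1 - \<alpha>) k w\<bar> \<le> \<rho>) \<longrightarrow>
      (\<forall>k\<in>{1..n}. \<bar>diff_quot t w k\<bar> \<le> S * \<rho>)"
    using bdf3_L2_stability[OF \<alpha> lam T] by (elim exE conjE)
  have G: "0 < Gamma \<alpha>" "0 < Gamma (\<alpha> + 1)" using \<alpha> by (auto intro: Gamma_real_pos)
  have b3: "\<bar>y3 s\<bar> \<le> C * s powr \<alpha>" if "0 \<le> s" "s \<le> T" for s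
    using hol[of 0 s] that z by simp
  have mono: "C * u powr r \<le> C * s powr r" if "0 \<le> u" "u \<le> s" "0 \<le> r" for r s u
    using that C by (intro mult_left_mono powr_mono2) auto
  \<comment> \<open>Integrating the Hoelder bound of \<open>y3\<close> from 0, where all derivatives
    vanish, gains one power each time.\<close>
  have b2: "\<bar>y2 s\<bar> \<le> C * s powr (1 + \<alpha>)" if s: "0 \<le> s" "s \<le> T" for s
  proof -
    have "\<bar>y2 s\<bar> \<le> C * s powr \<alpha> * (s - 0)"
    proof (rule zero_derivative_bound[OF dy(3)])
      fix u assume "u \<in> {0..s}"
      then show "\<bar>y3 u\<bar> \<le> C * s powr \<alpha>" using b3[of u] mono[of u s \<alpha>] s \<alpha> by auto
    qed (use s z in auto)
    also have "\<dots> = C * s powr (1 + \<alpha>)" using s by (cases "s = 0") (simp_all add: powr_add)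
    finally show ?thesis .
  qed
  have b1: "\<bar>y1 s\<bar> \<le> C * s powr (2 + \<alpha>)" if s: "0 \<le> s" "s \<le> T" for s
  proof -
    have "\<bar>y1 s\<bar> \<le> C * s powr (1 + \<alpha>) * (s - 0)"
    proof (rule zero_derivative_bound[OF dy(2)])
      fix u assume "u \<in> {0..s}"
      then show "\<bar>y2 u\<bar> \<le> C * s powr (1 + \<alpha>)" using b2[of u] mono[of u s "1 + \<alpha>"] s \<alpha> by auto
    qed (use s z in auto)
    also have "\<dots> = C * s powr (2 + \<alpha>)"
      using s powr_add[of s "1 + \<alpha>" 1] by (cases "s = 0") (simp_all add: add.commute)
    finally show ?thesis .
  qed
  define M where "M = C * T powr \<alpha>"
  have M: "\<bar>y3 s\<bar> \<le> M" if "s \<in> {0..T}" for s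
    using b3[of s] mono[of s T \<alpha>] that \<alpha> by (auto simp: M_def)
  have M0: "0 \<le> M" using C by (simp add: M_def)
  define B1 where "B1 = (8 / Gamma \<alpha> + 4 / Gamma (\<alpha> + 1)) * M"
  define B2 where "B2 = 2 * C * T powr \<alpha> / Gamma (\<alpha> + 1)"
  have B0: "0 \<le> B1" "0 \<le> B2" using G M0 C by (simp_all add: B1_def B2_def)
  define K where "K = 27 * C + lam * (B1 + B2)"
  have K0: "0 \<le> K" using B0 C lam by (simp add: K_def)
  show ?thesis
  proof (intro exI[of _ "T * (S * K)"] conjI allI impI ballI)
    show "0 \<le> T * (S * K)" using T S K0 by simp
    fix N :: nat and t Y :: "nat \<Rightarrow> real" and n
    assume mesh: "time_mesh T N t" and rt: "\<forall>k\<in>{2..N}. ratio t k \<in> {1..1.7319}" and Y0: "Y 0 = 0"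
      and sch0: "\<forall>k\<in>{1..N}. (if k \<le> 2 then diff_quot t Y k else bdf3 t Y k) + lam * caputo_L2 t (1 - \<alpha>) k Y
          = y1 (t k) + lam * frac_int \<alpha> y1 (t k)" and n0: "n \<in> {1..N}"
    have n: "1 \<le> n" "n \<le> N" using n0 by auto
    have sch: "(if k \<le> 2 then diff_quot t Y k else bdf3 t Y k) + lam * caputo_L2 t (1 - \<alpha>) k Y
          = y1 (t k) + lam * frac_int \<alpha> y1 (t k)" if "1 \<le> k" "k \<le> N" for k
      using sch0 that by (simp only: atLeastAtMost_iff)
    have rat: "\<And>k. k \<in> {2..N} \<Longrightarrow> 1 \<le> ratio t k" using rt by auto
    have t0: "t 0 = 0" using mesh by (simp add: time_mesh_def)
    define w where "w = (\<lambda>j. y (t j))"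
    define e where "e = (\<lambda>j. 1 * w j + (-1) * Y j)"
    define \<delta> where "\<delta> = (\<lambda>v k. if k \<le> 2 then diff_quot t v k else bdf3 t v k)"
    have dq: "diff_quot t e k = diff_quot t w k - diff_quot t Y k" for k
      by (simp add: e_def diff_quot_def flip: diff_divide_distrib)
    have \<delta>e: "\<delta> e k = \<delta> w k - \<delta> Y k" for k
      by (simp add: \<delta>_def bdf3_def dq algebra_simps)
    have mvt: "\<exists>\<xi>. t (k - 1) < \<xi> \<and> \<xi> < t k \<and> diff_quot t w k = y1 \<xi>" if k: "1 \<le> k" "k \<le> N" for k
    proof -
      have lt: "t (k - 1) < t k" using k by (auto intro: mesh_less[OF mesh])
      obtain \<xi> where "t (k - 1) < \<xi>" "\<xi> < t k" "y (t k) - y (t (k - 1)) = (t k - t (k - 1)) * y1 \<xi>"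
        using MVT2[OF lt, of y y1] dy(1) by blast
      then show ?thesis using lt by (intro exI[of _ \<xi>]) (simp add: diff_quot_def step_def w_def)
    qed
    \<comment> \<open>For \<open>k \<le> 2\<close> the backward difference equals \<open>y1\<close>
      at an intermediate point. This value and \<open>y1 (t k)\<close> are both of the full order in
      \<open>t k \<le> 2 * step t k\<close>; \<open>16 = 2 * 8\<close> arises from the two terms and
      from \<open>2 powr (2 + \<alpha>) \<le> 8\<close>.\<close>
    have R1: "\<bar>\<delta> w k - y1 (t k)\<bar> \<le> 27 * C * step t k powr (2 + \<alpha>)" if k: "1 \<le> k" "k \<le> N" for k
    proof (cases "k \<le> 2")
      case True
      have sk: "0 < step t k" by (rule step_pos[OF mesh k])
      have tk: "t k \<le> 2 * step t k"
      proof (cases "k = 1")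
        case True
        then show ?thesis using t0 sk by (simp add: step_def)
      next
        case False
        then have "k = 2" using True k by simp
        then show ?thesis using step_mono[OF mesh rat, of 1 2] k t0 by (simp add: step_def)
      qed
      obtain \<xi> where \<xi>: "t (k - 1) < \<xi>" "\<xi> < t k" "diff_quot t w k = y1 \<xi>" using mvt[OF k] by blast
      have r: "0 \<le> t (k - 1)" "t k \<le> T" "0 \<le> t k"
        using mesh_range[OF mesh, of "k - 1"] mesh_range[OF mesh, of k] k by auto
      have "\<bar>y1 \<xi>\<bar> \<le> C * t k powr (2 + \<alpha>)" "\<bar>y1 (t k)\<bar> \<le> C * t k powr (2 + \<alpha>)"
        using b1[of \<xi>] b1[of "t k"] mono[of \<xi> "t k" "2 + \<alpha>"] \<xi> r \<alpha> by auto
      then have "\<bar>\<delta> w k - y1 (t k)\<bar> \<le> 2 * (C * t k powr (2 + \<alpha>))"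
        using True \<xi>(3) by (simp add: \<delta>_def)
      also have "C * t k powr (2 + \<alpha>) \<le> C * (2 * step t k) powr (2 + \<alpha>)"
        using tk r \<alpha> by (intro mono) auto
      also have "C * (2 * step t k) powr (2 + \<alpha>) \<le> C * (8 * step t k powr (2 + \<alpha>))"
      proof -
        have "2 powr (2 + \<alpha>) \<le> 2 powr (3::real)" using \<alpha> by (intro powr_mono) auto
        then have "2 powr (2 + \<alpha>) * step t k powr (2 + \<alpha>) \<le> 8 * step t k powr (2 + \<alpha>)"
          by (intro mult_right_mono) (simp_all add: powr_numeral)
        then show ?thesis using sk C by (intro mult_left_mono) (simp_all add: powr_mult)
      qed
      finally have "\<bar>\<delta> w k - y1 (t k)\<bar> \<le> 16 * (C * step t k powr (2 + \<alpha>))" by simp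
      also have "\<dots> \<le> 27 * (C * step t k powr (2 + \<alpha>))" using C by (intro mult_right_mono) auto
      finally show ?thesis by simp
    next
      case False
      then show ?thesis
        using bdf3_truncation[OF mesh rat _ k(2) dy hol C \<alpha>] by (simp add: \<delta>_def w_def)
    qed
    have R2: "\<bar>caputo_L2 t (1 - \<alpha>) k w - frac_int \<alpha> y1 (t k)\<bar> \<le> (B1 + B2) * step t k powr (2 + \<alpha>)"
      if k: "1 \<le> k" "k \<le> N" for k
    proof (cases "k = 1")
      case False
      then have "\<bar>caputo_L2 t (1 - \<alpha>) k w - frac_int \<alpha> y1 (t k)\<bar> \<le> B1 * step t k powr (2 + \<alpha>)"
        unfolding w_def B1_def using k by (intro caputo_L2_truncation[OF mesh rat _ _ dy M \<alpha>]) auto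
      also have "\<dots> \<le> (B1 + B2) * step t k powr (2 + \<alpha>)" using B0 by (intro mult_right_mono) auto
      finally show ?thesis .
    next
      \<comment> \<open>The first step has only the linear interpolant. Its slope and
        \<open>y1\<close> are each of order \<open>2 + \<alpha>\<close> on the first cell, so their
        difference may be estimated term by term.\<close>
      case True
      obtain \<xi> where \<xi>: "t 0 < \<xi>" "\<xi> < t 1" "diff_quot t w 1 = y1 \<xi>" using mvt[of 1] k True by auto
      have r: "0 < t 1" "t 1 \<le> T" using mesh_range[OF mesh, of 1] k True \<xi> t0 by auto
      have est: "\<bar>interp_slope t 1 w 1 s - y1 s\<bar> \<le> 2 * C * t 1 powr (2 + \<alpha>)" if "s \<in> {t 0<..<t 1}" for s
        using b1[of \<xi>] b1[of s] mono[of \<xi> "t 1" "2 + \<alpha>"] mono[of s "t 1" "2 + \<alpha>"] \<xi> r that t0 \<alpha>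
        by (auto simp: interp_slope_def)
      have "continuous_on UNIV y1"
        by (intro continuous_at_imp_continuous_on ballI DERIV_isCont[OF dy(2)])
      then have "(\<lambda>s. interp_slope t 1 w 1 s - y1 s) \<in> borel_measurable borel"
        by (intro borel_measurable_continuous_onI continuous_intros interp_slope_continuous)
      then have meas: "set_borel_measurable lborel {t 0<..<t 1} (\<lambda>s. interp_slope t 1 w 1 s - y1 s)"
        by (simp add: set_borel_measurable_def)
      have "\<bar>caputo_L2 t (1 - \<alpha>) 1 w - frac_int \<alpha> y1 (t 1)\<bar>
        \<le> \<bar>LINT s:{t 0<..<t 1}|lborel. frac_kernel \<alpha> (t 1 - s) * (interp_slope t 1 w 1 s - y1 s)\<bar>"
        using caputo_L2_truncation_sum[OF mesh _ _ \<alpha>(1) derivative_imp_loc_bounded[OF dy(2)], of 1 w] k True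
        by simp
      also have "\<dots> \<le> 2 * C * t 1 powr (2 + \<alpha>) * ((t 1 - t 0) powr \<alpha> - (t 1 - t 1) powr \<alpha>) / Gamma (\<alpha> + 1)"
        using r t0 by (intro set_integrable_kernel_mult(2) \<alpha> meas est) auto
      also have "\<dots> = 2 * C * t 1 powr (2 + \<alpha>) * t 1 powr \<alpha> / Gamma (\<alpha> + 1)" using t0 \<alpha> by simp
      also have "\<dots> \<le> 2 * C * t 1 powr (2 + \<alpha>) * T powr \<alpha> / Gamma (\<alpha> + 1)"
        using r C G \<alpha> by (intro divide_right_mono mult_left_mono powr_mono2) auto
      also have "\<dots> = B2 * step t 1 powr (2 + \<alpha>)" using t0 by (simp add: B2_def step_def)
      also have "\<dots> \<le> (B1 + B2) * step t 1 powr (2 + \<alpha>)" using B0 by (intro mult_right_mono) auto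
      finally show ?thesis using True by simp
    qed
    have res: "\<bar>\<delta> e k + lam * caputo_L2 t (1 - \<alpha>) k e\<bar> \<le> K * step t n powr (2 + \<alpha>)" if k: "1 \<le> k" "k \<le> n" for k
    proof -
      have kN: "k \<le> N" using k n by simp
      have cap: "caputo_L2 t (1 - \<alpha>) k e = caputo_L2 t (1 - \<alpha>) k w - caputo_L2 t (1 - \<alpha>) k Y"
        unfolding e_def using caputo_L2_lincomb[OF mesh k(1) kN \<alpha>(1), of 1 w "-1" Y] by simp
      moreover have "\<delta> Y k + lam * caputo_L2 t (1 - \<alpha>) k Y = y1 (t k) + lam * frac_int \<alpha> y1 (t k)"
        unfolding \<delta>_def by (rule sch[OF k(1) kN])
      ultimately have eq: "\<delta> e k + lam * caputo_L2 t (1 - \<alpha>) k e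
          = (\<delta> w k - y1 (t k)) + lam * (caputo_L2 t (1 - \<alpha>) k w - frac_int \<alpha> y1 (t k))"
        unfolding \<delta>e cap by (simp only: right_diff_distrib)
      have "\<bar>lam * (caputo_L2 t (1 - \<alpha>) k w - frac_int \<alpha> y1 (t k))\<bar> \<le> lam * ((B1 + B2) * step t k powr (2 + \<alpha>))"
        using mult_left_mono[OF R2[OF k(1) kN] lam] lam by (simp add: abs_mult)
      then have "\<bar>\<delta> e k + lam * caputo_L2 t (1 - \<alpha>) k e\<bar>
          \<le> 27 * C * step t k powr (2 + \<alpha>) + lam * ((B1 + B2) * step t k powr (2 + \<alpha>))"
        unfolding eq using R1[OF k(1) kN] by linarith
      also have "\<dots> = K * step t k powr (2 + \<alpha>)" by (simp add: K_def algebra_simps)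
      \<comment> \<open>Nondecreasing steps bring all residuals up to \<open>n\<close> to the common
        size given by the last step.\<close>
      also have "\<dots> \<le> K * step t n powr (2 + \<alpha>)"
        using K0 \<alpha> step_pos[OF mesh k(1) kN] step_mono[OF mesh rat k n(2)]
        by (intro mult_left_mono powr_mono2) auto
      finally show ?thesis .
    qed
    define \<rho> where "\<rho> = S * (K * step t n powr (2 + \<alpha>))"
    have d: "\<bar>diff_quot t e k\<bar> \<le> \<rho>" if "1 \<le> k" "k \<le> n" for k
    proof -
      have "\<forall>k\<in>{1..n}. \<bar>(if k \<le> 2 then diff_quot t e k else bdf3 t e k) + lam * caputo_L2 t (1 - \<alpha>) k e\<bar>
          \<le> K * step t n powr (2 + \<alpha>)"
      proof
        fix k assume "k \<in> {1..n}"
        then have "1 \<le> k" "k \<le> n" by auto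
        then show "\<bar>(if k \<le> 2 then diff_quot t e k else bdf3 t e k) + lam * caputo_L2 t (1 - \<alpha>) k e\<bar>
          \<le> K * step t n powr (2 + \<alpha>)" using res[of k] unfolding \<delta>_def by blast
      qed
      then have "\<forall>k\<in>{1..n}. \<bar>diff_quot t e k\<bar> \<le> S * (K * step t n powr (2 + \<alpha>))"
        using stab0 mesh rt n(2) by blast
      then show ?thesis using that by (simp add: \<rho>_def)
    qed
    \<comment> \<open>The error starts at 0 and grows in each step by at most \<open>\<rho>\<close>
      times the step length.\<close>
    have e_le: "\<bar>e k\<bar> \<le> t k * \<rho>" if "k \<le> n" for k
      using that
    proof (induction k)
      case 0
      then show ?case using t0 z Y0 by (simp add: e_def w_def)
    next
      case (Suc k)
      have "0 < step t (Suc k)" using Suc.prems n by (intro step_pos[OF mesh]) auto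
      then have "e (Suc k) = e k + step t (Suc k) * diff_quot t e (Suc k)" by (simp add: diff_quot_def)
      moreover have "\<bar>step t (Suc k) * diff_quot t e (Suc k)\<bar> \<le> step t (Suc k) * \<rho>"
        unfolding abs_mult using \<open>0 < step t (Suc k)\<close> d[of "Suc k"] Suc.prems by (intro mult_mono) auto
      ultimately have "\<bar>e (Suc k)\<bar> \<le> t k * \<rho> + step t (Suc k) * \<rho>" using Suc by simp
      also have "\<dots> = t (Suc k) * \<rho>" by (simp add: step_def algebra_simps)
      finally show ?case .
    qed
    have "0 \<le> \<rho>" using d[of n] n by (meson abs_ge_zero order_refl order_trans)
    then have "t n * \<rho> \<le> T * \<rho>" using mesh_range[OF mesh n(2)] by (intro mult_right_mono) auto
    then have "\<bar>e n\<bar> \<le> T * \<rho>" using e_le[of n] by linarith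
    then show "\<bar>y (t n) - Y n\<bar> \<le> T * (S * K) * step t n powr (2 + \<alpha>)"
      by (simp add: e_def w_def \<rho>_def mult.assoc)
  qed
qed

subsection \<open>Reduction to the eigenmodes\<close>

text \<open>The chosen weak Laplacian and the explicit sum of weak derivatives represent the same
  distribution, so no element of \<open>Sobolev10 \<Omega>\<close> can distinguish them.\<close>

lemma L2_inner_weak_lap_Sobolev10:
  assumes "open \<Omega>" "u \<in> Sobolev \<Omega> (2 * m)" "w \<in> Sobolev10 \<Omega>"
  shows "L2_inner \<Omega> (weak_lap \<Omega> m u) w = (\<Sum>bs\<in>doubled_lists m. L2_inner \<Omega> (weak_deriv \<Omega> bs u) w)"
proof -
  note h1 = Sobolev_weak_lap[OF assms(1,2)] and h2 = has_weak_lap_sum_weak_deriv[OF assms(1,2)]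
  have w: "w \<in> L2_space \<Omega>" using assms(3) by (auto simp: Sobolev10_def Sobolev_def)
  have "L2_inner \<Omega> (weak_lap \<Omega> m u) w = L2_inner \<Omega> (\<lambda>x. \<Sum>bs\<in>doubled_lists m. weak_deriv \<Omega> bs u x) w"
    by (rule L2_inner_Sobolev10_eqI[OF assms(1,3)]) (use h1 h2 in \<open>auto simp: has_weak_lap_def\<close>)
  also have "\<dots> = (\<Sum>bs\<in>doubled_lists m. L2_inner \<Omega> (weak_deriv \<Omega> bs u) w)"
  proof (rule L2_inner_sum_left[OF _ w])
    fix bs :: "'a list" assume "bs \<in> doubled_lists m"
    then show "weak_deriv \<Omega> bs u \<in> L2_space \<Omega>"
      using has_weak_deriv_weak_deriv[OF assms(2), of bs] doubled_lists_basis[of bs m]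
      by (auto simp: has_weak_deriv_def)
  qed
  finally show ?thesis .
qed

text \<open>The choice operator behind \<open>weak_deriv\<close> is not linear in the function.
  Linearity is recovered after testing, since both sides represent the weak derivative of
  \<open>u - v\<close>; this is needed because continuity in time is formulated through norms of
  differences.\<close>

lemma L2_inner_weak_deriv_diff:
  assumes "open \<Omega>" "u \<in> Sobolev \<Omega> k" "v \<in> Sobolev \<Omega> k" "w \<in> Sobolev10 \<Omega>" "set bs \<subseteq> Basis" "length bs \<le> k"
  shows "weak_deriv \<Omega> bs (\<lambda>x. u x - v x) \<in> L2_space \<Omega>"
    and "L2_inner \<Omega> (weak_deriv \<Omega> bs u) w - L2_inner \<Omega> (weak_deriv \<Omega> bs v) w
      = L2_inner \<Omega> (weak_deriv \<Omega> bs (\<lambda>x. u x - v x)) w"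
proof -
  have hu: "has_weak_deriv \<Omega> bs u (weak_deriv \<Omega> bs u)" and hv: "has_weak_deriv \<Omega> bs v (weak_deriv \<Omega> bs v)"
    using has_weak_deriv_weak_deriv assms by blast+
  define D where "D = (\<lambda>x. weak_deriv \<Omega> bs u x - weak_deriv \<Omega> bs v x)"
  have uv: "u \<in> L2_space \<Omega>" "v \<in> L2_space \<Omega>" using assms by (auto simp: Sobolev_def)
  have dd: "weak_deriv \<Omega> bs u \<in> L2_space \<Omega>" "weak_deriv \<Omega> bs v \<in> L2_space \<Omega>"
    using hu hv by (auto simp: has_weak_deriv_def)
  have w: "w \<in> L2_space \<Omega>" using assms(4) by (auto simp: Sobolev10_def Sobolev_def)
  have D: "has_weak_deriv \<Omega> bs (\<lambda>x. u x - v x) D"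
    unfolding has_weak_deriv_def
  proof (intro conjI ballI)
    show "D \<in> L2_space \<Omega>" unfolding D_def by (rule L2_space_diff[OF dd])
    fix \<psi> assume \<psi>: "\<psi> \<in> test_functions \<Omega>"
    note t = test_functions_L2[OF assms(1) \<psi>]
      and p = test_functions_L2[OF assms(1) test_functions_partials[OF \<psi> assms(5)]]
    show "L2_inner \<Omega> (\<lambda>x. u x - v x) (partials bs \<psi>) = (-1) ^ length bs * L2_inner \<Omega> D \<psi>"
      unfolding D_def L2_inner_diff_left[OF uv p] L2_inner_diff_left[OF dd t]
      using hu hv \<psi> by (simp add: has_weak_deriv_def right_diff_distrib)
  qed
  then have W: "has_weak_deriv \<Omega> bs (\<lambda>x. u x - v x) (weak_deriv \<Omega> bs (\<lambda>x. u x - v x))"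
    unfolding weak_deriv_def by (rule someI[of "has_weak_deriv \<Omega> bs (\<lambda>x. u x - v x)"])
  then show L: "weak_deriv \<Omega> bs (\<lambda>x. u x - v x) \<in> L2_space \<Omega>" by (simp add: has_weak_deriv_def)
  have eq: "L2_inner \<Omega> D \<psi> = L2_inner \<Omega> (weak_deriv \<Omega> bs (\<lambda>x. u x - v x)) \<psi>" if \<psi>: "\<psi> \<in> test_functions \<Omega>" for \<psi>
  proof -
    have "(-1) ^ length bs * L2_inner \<Omega> D \<psi> = (-1) ^ length bs * L2_inner \<Omega> (weak_deriv \<Omega> bs (\<lambda>x. u x - v x)) \<psi>"
      using D W \<psi> unfolding has_weak_deriv_def by metis
    then show ?thesis by simp
  qed
  have "L2_inner \<Omega> D w = L2_inner \<Omega> (weak_deriv \<Omega> bs (\<lambda>x. u x - v x)) w"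
    using D by (intro L2_inner_Sobolev10_eqI[OF assms(1,4) _ L eq]) (simp add: has_weak_deriv_def)
  then show "L2_inner \<Omega> (weak_deriv \<Omega> bs u) w - L2_inner \<Omega> (weak_deriv \<Omega> bs v) w
      = L2_inner \<Omega> (weak_deriv \<Omega> bs (\<lambda>x. u x - v x)) w"
    unfolding D_def L2_inner_diff_left[OF dd w] .
qed

lemma L2_norm_weak_deriv_le_frac_Sobolev:
  assumes "set bs \<subseteq> Basis" "length bs \<le> k"
  shows "ennreal ((L2_norm \<Omega> (weak_deriv \<Omega> bs u))\<^sup>2) \<le> frac_Sobolev_sq \<Omega> k \<theta> u"
proof -
  have "finite {bs :: 'a list. set bs \<subseteq> Basis \<and> length bs \<le> k}"
    by (rule finite_lists_length_le) simp
  then have "ennreal ((L2_norm \<Omega> (weak_deriv \<Omega> bs u))\<^sup>2)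
      \<le> (\<Sum>bs\<in>{bs. set bs \<subseteq> Basis \<and> length bs \<le> k}. ennreal ((L2_norm \<Omega> (weak_deriv \<Omega> bs u))\<^sup>2))"
    using assms by (intro member_le_sum) auto
  also have "\<dots> \<le> frac_Sobolev_sq \<Omega> k \<theta> u"
    unfolding frac_Sobolev_sq_def by (rule add_increasing2) auto
  finally show ?thesis .
qed

text \<open>The fractional Sobolev norm dominates the \<open>L\<^sup>2\<close> norm of each weak
  derivative up to order \<open>2 * m\<close>, and the pairing of the weak Laplacian is a finite sum
  of pairings with such derivatives.\<close>

lemma continuous_on_L2_inner_weak_lap:
  assumes op: "open \<Omega>" and \<phi>: "\<phi> \<in> Sobolev10 \<Omega>" and w: "continuous_into_frac_Sobolev \<Omega> S (2 * m) \<theta> w"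
  shows "continuous_on S (\<lambda>s. L2_inner \<Omega> (weak_lap \<Omega> m (w s)) \<phi>)"
  unfolding continuous_on_def
proof
  fix t assume t: "t \<in> S"
  have \<phi>2: "\<phi> \<in> L2_space \<Omega>" using \<phi> by (auto simp: Sobolev10_def Sobolev_def)
  have sob: "w s \<in> Sobolev \<Omega> (2 * m)" if "s \<in> S" for s
    using w that by (auto simp: continuous_into_frac_Sobolev_def frac_Sobolev_def)
  have S: "\<forall>\<^sub>F s in at t within S. s \<in> S" by (auto simp: eventually_at_filter)
  define N where "N = (\<lambda>bs s. L2_norm \<Omega> (weak_deriv \<Omega> bs (\<lambda>x. w s x - w t x)))"
  have N: "(N bs \<longlongrightarrow> 0) (at t within S)" if bs: "bs \<in> doubled_lists m" for bs
  proof -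
    have lim: "((\<lambda>s. frac_Sobolev_sq \<Omega> (2 * m) \<theta> (\<lambda>x. w s x - w t x)) \<longlongrightarrow> 0) (at t within S)"
      using w t by (auto simp: continuous_into_frac_Sobolev_def)
    have "((\<lambda>s. ennreal ((N bs s)\<^sup>2)) \<longlongrightarrow> ennreal 0) (at t within S)"
    proof (rule tendsto_sandwich[OF _ _ tendsto_const])
      show "((\<lambda>s. frac_Sobolev_sq \<Omega> (2 * m) \<theta> (\<lambda>x. w s x - w t x)) \<longlongrightarrow> ennreal 0) (at t within S)"
        using lim by simp
      show "\<forall>\<^sub>F s in at t within S. ennreal ((N bs s)\<^sup>2) \<le> frac_Sobolev_sq \<Omega> (2 * m) \<theta> (\<lambda>x. w s x - w t x)"
        unfolding N_def using doubled_lists_basis[OF bs]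
        by (intro always_eventually allI L2_norm_weak_deriv_le_frac_Sobolev) auto
    qed auto
    then have "((\<lambda>s. (N bs s)\<^sup>2) \<longlongrightarrow> 0) (at t within S)" by (rule tendsto_ennrealD) auto
    then have "((\<lambda>s. sqrt ((N bs s)\<^sup>2)) \<longlongrightarrow> sqrt 0) (at t within S)" by (rule tendsto_real_sqrt)
    moreover have "sqrt ((N bs s)\<^sup>2) = N bs s" for s by (simp add: N_def L2_norm_nonneg)
    ultimately show ?thesis by simp
  qed
  have "((\<lambda>s. \<Sum>bs\<in>doubled_lists m. N bs s * L2_norm \<Omega> \<phi>) \<longlongrightarrow> (\<Sum>bs\<in>(doubled_lists m :: 'a list set). 0 * L2_norm \<Omega> \<phi>)) (at t within S)"
    by (intro tendsto_sum tendsto_mult N tendsto_const)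
  then have lim: "((\<lambda>s. \<Sum>bs\<in>doubled_lists m. N bs s * L2_norm \<Omega> \<phi>) \<longlongrightarrow> 0) (at t within S)" by simp
  have "((\<lambda>s. L2_inner \<Omega> (weak_lap \<Omega> m (w s)) \<phi> - L2_inner \<Omega> (weak_lap \<Omega> m (w t)) \<phi>) \<longlongrightarrow> 0) (at t within S)"
  proof (rule Lim_null_comparison[OF _ lim])
    show "\<forall>\<^sub>F s in at t within S. norm (L2_inner \<Omega> (weak_lap \<Omega> m (w s)) \<phi> - L2_inner \<Omega> (weak_lap \<Omega> m (w t)) \<phi>)
        \<le> (\<Sum>bs\<in>doubled_lists m. N bs s * L2_norm \<Omega> \<phi>)"
      using S
    proof eventually_elim
      case (elim s)
      have "L2_inner \<Omega> (weak_lap \<Omega> m (w s)) \<phi> - L2_inner \<Omega> (weak_lap \<Omega> m (w t)) \<phi>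
        = (\<Sum>bs\<in>doubled_lists m. L2_inner \<Omega> (weak_deriv \<Omega> bs (w s)) \<phi> - L2_inner \<Omega> (weak_deriv \<Omega> bs (w t)) \<phi>)"
        by (simp add: L2_inner_weak_lap_Sobolev10[OF op sob[OF elim] \<phi>] L2_inner_weak_lap_Sobolev10[OF op sob[OF t] \<phi>] sum_subtractf)
      also have "\<dots> = (\<Sum>bs\<in>doubled_lists m. L2_inner \<Omega> (weak_deriv \<Omega> bs (\<lambda>x. w s x - w t x)) \<phi>)"
        using doubled_lists_basis[of _ m]
        by (intro sum.cong L2_inner_weak_deriv_diff(2)[OF op sob[OF elim] sob[OF t] \<phi>]) auto
      finally have "norm (L2_inner \<Omega> (weak_lap \<Omega> m (w s)) \<phi> - L2_inner \<Omega> (weak_lap \<Omega> m (w t)) \<phi>)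
          \<le> (\<Sum>bs\<in>doubled_lists m. \<bar>L2_inner \<Omega> (weak_deriv \<Omega> bs (\<lambda>x. w s x - w t x)) \<phi>\<bar>)"
        by (simp add: sum_abs)
      also have "\<dots> \<le> (\<Sum>bs\<in>doubled_lists m. N bs s * L2_norm \<Omega> \<phi>)"
        unfolding N_def using doubled_lists_basis[of _ m]
        by (intro sum_mono L2_Cauchy_Schwarz \<phi>2 L2_inner_weak_deriv_diff(1)[OF op sob[OF elim] sob[OF t] \<phi>]) auto
      finally show ?case .
    qed
  qed
  then show "((\<lambda>s. L2_inner \<Omega> (weak_lap \<Omega> m (w s)) \<phi>) \<longlongrightarrow> L2_inner \<Omega> (weak_lap \<Omega> m (w t)) \<phi>) (at t within S)"
    by (simp add: LIM_zero_iff)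
qed

section \<open>Coefficients of functions of time and finite expansions\<close>

lemma continuous_on_L2_inner:
  assumes "L2_continuous_on \<Omega> S w" "\<phi> \<in> L2_space \<Omega>"
  shows "continuous_on S (\<lambda>s. L2_inner \<Omega> (w s) \<phi>)"
  unfolding continuous_on_def
proof
  fix t assume t: "t \<in> S"
  have w: "w s \<in> L2_space \<Omega>" if "s \<in> S" for s using assms(1) that by (simp add: L2_continuous_on_def)
  have lim: "((\<lambda>s. L2_norm \<Omega> (\<lambda>x. w s x - w t x) * L2_norm \<Omega> \<phi>) \<longlongrightarrow> 0 * L2_norm \<Omega> \<phi>) (at t within S)"
    using assms(1) t by (intro tendsto_mult tendsto_const) (simp add: L2_continuous_on_def)
  have "((\<lambda>s. L2_inner \<Omega> (w s) \<phi> - L2_inner \<Omega> (w t) \<phi>) \<longlongrightarrow> 0) (at t within S)"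
  proof (rule Lim_null_comparison[OF _ lim[simplified]])
    have "\<forall>\<^sub>F s in at t within S. s \<in> S" by (auto simp: eventually_at_filter)
    then show "\<forall>\<^sub>F s in at t within S. norm (L2_inner \<Omega> (w s) \<phi> - L2_inner \<Omega> (w t) \<phi>)
        \<le> L2_norm \<Omega> (\<lambda>x. w s x - w t x) * L2_norm \<Omega> \<phi>"
    proof eventually_elim
      case (elim s)
      show ?case
        using L2_Cauchy_Schwarz[OF L2_space_diff[OF w[OF elim] w[OF t]] assms(2)]
        by (simp add: L2_inner_diff_left[OF w[OF elim] w[OF t] assms(2)])
    qed
  qed
  then show "((\<lambda>s. L2_inner \<Omega> (w s) \<phi>) \<longlongrightarrow> L2_inner \<Omega> (w t) \<phi>) (at t within S)"
    by (simp add: LIM_zero_iff)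
qed

lemma has_derivative_L2_inner:
  assumes d: "has_L2_tderiv \<Omega> S w d t" and t: "t \<in> S" and \<phi>: "\<phi> \<in> L2_space \<Omega>"
  shows "((\<lambda>s. L2_inner \<Omega> (w s) \<phi>) has_real_derivative L2_inner \<Omega> d \<phi>) (at t within S)"
  unfolding has_field_derivative_iff
proof -
  have w: "w s \<in> L2_space \<Omega>" if "s \<in> S" for s using d that by (simp add: has_L2_tderiv_def)
  have d2: "d \<in> L2_space \<Omega>" using d by (simp add: has_L2_tderiv_def)
  have lim: "((\<lambda>s. L2_norm \<Omega> (\<lambda>x. (w s x - w t x) / (s - t) - d x) * L2_norm \<Omega> \<phi>) \<longlongrightarrow> 0 * L2_norm \<Omega> \<phi>) (at t within S)"
    using d by (intro tendsto_mult tendsto_const) (simp add: has_L2_tderiv_def)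
  have "((\<lambda>s. (L2_inner \<Omega> (w s) \<phi> - L2_inner \<Omega> (w t) \<phi>) / (s - t) - L2_inner \<Omega> d \<phi>) \<longlongrightarrow> 0) (at t within S)"
  proof (rule Lim_null_comparison[OF _ lim[simplified]])
    have "\<forall>\<^sub>F s in at t within S. s \<in> S" by (auto simp: eventually_at_filter)
    then show "\<forall>\<^sub>F s in at t within S. norm ((L2_inner \<Omega> (w s) \<phi> - L2_inner \<Omega> (w t) \<phi>) / (s - t) - L2_inner \<Omega> d \<phi>)
        \<le> L2_norm \<Omega> (\<lambda>x. (w s x - w t x) / (s - t) - d x) * L2_norm \<Omega> \<phi>"
    proof eventually_elim
      case (elim s)
      have a: "(\<lambda>x. w s x - w t x) \<in> L2_space \<Omega>" by (rule L2_space_diff[OF w[OF elim] w[OF t]])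
      have b: "(\<lambda>x. (w s x - w t x) / (s - t)) \<in> L2_space \<Omega>"
        using L2_space_cmult[OF a, of "1 / (s - t)"] by simp
      have "L2_inner \<Omega> (\<lambda>x. (w s x - w t x) / (s - t) - d x) \<phi>
        = L2_inner \<Omega> (\<lambda>x. (1 / (s - t)) * (w s x - w t x)) \<phi> - L2_inner \<Omega> d \<phi>"
        using L2_inner_diff_left[OF b d2 \<phi>] by simp
      also have "\<dots> = (L2_inner \<Omega> (w s) \<phi> - L2_inner \<Omega> (w t) \<phi>) / (s - t) - L2_inner \<Omega> d \<phi>"
        unfolding L2_inner_cmult_left L2_inner_diff_left[OF w[OF elim] w[OF t] \<phi>] by simp
      finally show ?case
        using L2_Cauchy_Schwarz[OF L2_space_diff[OF b d2] \<phi>] by simp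
    qed
  qed
  then show "((\<lambda>s. (L2_inner \<Omega> (w s) \<phi> - L2_inner \<Omega> (w t) \<phi>) / (s - t)) \<longlongrightarrow> L2_inner \<Omega> d \<phi>) (at t within S)"
    by (simp add: LIM_zero_iff)
qed

lemma frac_int_sum:
  assumes "finite I" "0 < \<nu>" "\<And>i. i \<in> I \<Longrightarrow> loc_bounded (G i)"
  shows "frac_int \<nu> (\<lambda>s. \<Sum>i\<in>I. c i * G i s) t = (\<Sum>i\<in>I. c i * frac_int \<nu> (G i) t)"
    and "loc_bounded (\<lambda>s. \<Sum>i\<in>I. c i * G i s)"
proof -
  have "frac_int \<nu> (\<lambda>s. \<Sum>i\<in>I. c i * G i s) t = (\<Sum>i\<in>I. c i * frac_int \<nu> (G i) t)
      \<and> loc_bounded (\<lambda>s. \<Sum>i\<in>I. c i * G i s)"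
    using assms(1,3)
  proof (induction I)
    case empty
    then show ?case by (auto simp: frac_int_def loc_bounded_def)
  next
    case (insert i I)
    then have IH: "frac_int \<nu> (\<lambda>s. \<Sum>i\<in>I. c i * G i s) t = (\<Sum>i\<in>I. c i * frac_int \<nu> (G i) t)"
      "loc_bounded (\<lambda>s. \<Sum>i\<in>I. c i * G i s)" by auto
    have eq: "(\<lambda>s. \<Sum>i\<in>insert i I. c i * G i s) = (\<lambda>s. (\<Sum>i\<in>I. c i * G i s) + c i * G i s)"
      using insert by (simp add: add.commute)
    have Gi: "loc_bounded (G i)" using insert by simp
    show ?case
      unfolding eq frac_int_lincomb[OF assms(2) IH(2) Gi] IH(1)
      using insert loc_bounded_lincomb[OF IH(2) Gi] by (simp add: add.commute)
  qed
  then show "frac_int \<nu> (\<lambda>s. \<Sum>i\<in>I. c i * G i s) t = (\<Sum>i\<in>I. c i * frac_int \<nu> (G i) t)"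
    and "loc_bounded (\<lambda>s. \<Sum>i\<in>I. c i * G i s)" by auto
qed

lemma eigen_sum_L2:
  assumes "dirichlet_eigensystem \<Omega> lam \<phi>"
  shows "(\<lambda>x. \<Sum>q=1..L. c q * \<phi> q x) \<in> L2_space \<Omega>"
    and "1 \<le> p \<Longrightarrow> L2_inner \<Omega> (\<lambda>x. \<Sum>q=1..L. c q * \<phi> q x) (\<phi> p) = (if p \<le> L then c p else 0)"
proof -
  have m: "(\<lambda>x. c q * \<phi> q x) \<in> L2_space \<Omega>" if "q \<in> {1..L}" for q
    using dirichlet_eigensystem_L2[OF assms] that by (intro L2_space_cmult) auto
  then show "(\<lambda>x. \<Sum>q=1..L. c q * \<phi> q x) \<in> L2_space \<Omega>" by (rule L2_space_sum)
  assume p: "1 \<le> p"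
  have "L2_inner \<Omega> (\<lambda>x. \<Sum>q=1..L. c q * \<phi> q x) (\<phi> p) = (\<Sum>q=1..L. c q * L2_inner \<Omega> (\<phi> q) (\<phi> p))"
    using L2_inner_sum_left[where I = "{1..L}" and u = "\<lambda>q x. c q * \<phi> q x",
        OF m dirichlet_eigensystem_L2[OF assms p]] by (simp add: L2_inner_cmult_left)
  also have "\<dots> = (\<Sum>q=1..L. if q = p then c q else 0)"
    using assms p by (intro sum.cong) (auto simp: dirichlet_eigensystem_def)
  also have "\<dots> = (if p \<le> L then c p else 0)" using p by (simp add: sum.delta)
  finally show "L2_inner \<Omega> (\<lambda>x. \<Sum>q=1..L. c q * \<phi> q x) (\<phi> p) = (if p \<le> L then c p else 0)" .
qed

text \<open>Parseval's identity without an infinite series: \<open>h\<close> minus its finite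
  expansion is orthogonal to every eigenfunction, and completeness makes it zero almost
  everywhere.\<close>

lemma L2_norm_finite_expansion:
  assumes e: "dirichlet_eigensystem \<Omega> lam \<phi>" and h: "h \<in> L2_space \<Omega>"
    and z: "\<And>q. L < q \<Longrightarrow> L2_inner \<Omega> h (\<phi> q) = 0"
  shows "(L2_norm \<Omega> h)\<^sup>2 = (\<Sum>q=1..L. (L2_inner \<Omega> h (\<phi> q))\<^sup>2)"
proof -
  define c where "c = (\<lambda>q. L2_inner \<Omega> h (\<phi> q))"
  define S where "S = (\<lambda>x. \<Sum>q=1..L. c q * \<phi> q x)"
  have S: "S \<in> L2_space \<Omega>" unfolding S_def by (rule eigen_sum_L2(1)[OF e])
  have "L2_inner \<Omega> (\<lambda>x. h x - S x) (\<phi> p) = 0" if p: "1 \<le> p" for p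
    using L2_inner_diff_left[OF h S dirichlet_eigensystem_L2[OF e p]] eigen_sum_L2(2)[OF e p, where L = L and c = c] z[of p]
    by (simp add: S_def c_def)
  then have "AE x in lebesgue_on \<Omega>. h x - S x = 0"
    using e L2_space_diff[OF h S] by (auto simp: dirichlet_eigensystem_def)
  then have ae: "AE x in lebesgue_on \<Omega>. h x = S x" by eventually_elim simp
  have "(L2_norm \<Omega> h)\<^sup>2 = L2_inner \<Omega> S h"
    unfolding L2_norm_power2 by (rule L2_inner_cong_AE[OF h S h ae])
  also have "\<dots> = (\<Sum>q=1..L. c q * L2_inner \<Omega> (\<phi> q) h)"
    unfolding S_def using dirichlet_eigensystem_L2[OF e]
    by (subst L2_inner_sum_left) (auto simp: L2_inner_cmult_left h intro!: L2_space_cmult)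
  also have "\<dots> = (\<Sum>q=1..L. (c q)\<^sup>2)"
    by (simp add: c_def L2_inner_commute power2_eq_square)
  finally show ?thesis by (simp add: c_def)
qed

text \<open>The cut-off outside \<open>{0..T}\<close> makes the coefficient
  \<open>loc_bounded\<close>, since nothing is known about \<open>g\<close> at other times.
  Fractional integrals at times up to \<open>T\<close> are unaffected.\<close>

definition mode_source ::
  "'a::euclidean_space set \<Rightarrow> real \<Rightarrow> nat \<Rightarrow> (nat \<Rightarrow> 'a \<Rightarrow> real) \<Rightarrow> (real \<Rightarrow> 'a \<Rightarrow> real) \<Rightarrow> nat \<Rightarrow> real \<Rightarrow> real" where
  "mode_source \<Omega> T m \<phi> g q s = (if s \<in> {0..T} then L2_inner \<Omega> (weak_lap \<Omega> m (g s)) (\<phi> q) else 0)"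

lemma loc_bounded_mode_source:
  assumes "open \<Omega>" "dirichlet_eigensystem \<Omega> lam \<phi>" "1 \<le> q"
    "continuous_into_frac_Sobolev \<Omega> {0..T} (2 * m) \<theta> g"
  shows "loc_bounded (mode_source \<Omega> T m \<phi> g q)"
  unfolding mode_source_def[abs_def]
  using assms by (intro continuous_on_loc_bounded continuous_on_L2_inner_weak_lap)
    (auto simp: dirichlet_eigensystem_def)

lemma proj_source_eq:
  assumes "0 < \<nu>" "t \<le> T" "\<forall>q\<ge>1. loc_bounded (mode_source \<Omega> T m \<phi> g q)"
  shows "proj_source \<Omega> \<phi> L \<nu> m g t x = (\<Sum>q=1..L. frac_int \<nu> (mode_source \<Omega> T m \<phi> g q) t * \<phi> q x)"
proof -
  have "proj_source \<Omega> \<phi> L \<nu> m g t x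
      = frac_int \<nu> (\<lambda>s. \<Sum>q=1..L. \<phi> q x * mode_source \<Omega> T m \<phi> g q s) t"
    unfolding proj_source_def using assms(2)
    by (intro frac_int_cong) (auto simp: spectral_proj_def mode_source_def mult.commute)
  also have "\<dots> = (\<Sum>q=1..L. \<phi> q x * frac_int \<nu> (mode_source \<Omega> T m \<phi> g q) t)"
    using assms by (intro frac_int_sum(1)) auto
  finally show ?thesis by (simp add: mult.commute)
qed

text \<open>Differentiation lowers the order of the fractional integral by one. At \<open>T\<close>
  the derivative is one-sided, and it is determined because \<open>T\<close> is a limit point of
  \<open>{0..T}\<close>.\<close>

lemma source_F_eq:
  assumes t: "t \<in> {0<..T}" and \<mu>: "1 < real (m + 1) * \<alpha>"
    and lb0: "\<forall>q\<ge>1. loc_bounded (mode_source \<Omega> T m \<phi> g q)"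
  shows "source_F \<Omega> T \<alpha> m L \<phi> g t x
    = (\<Sum>q=1..L. frac_int (real (m + 1) * \<alpha> - 1) (mode_source \<Omega> T m \<phi> g q) t * \<phi> q x)"
proof -
  note lb = lb0[rule_format]
  define \<mu> where "\<mu> = real (m + 1) * \<alpha>"
  have \<mu>1: "1 < \<mu>" using \<mu> by (simp add: \<mu>_def)
  have "((\<lambda>s. \<Sum>q=1..L. frac_int \<mu> (mode_source \<Omega> T m \<phi> g q) s * \<phi> q x) has_real_derivative
      (\<Sum>q=1..L. frac_int (\<mu> - 1) (mode_source \<Omega> T m \<phi> g q) t * \<phi> q x)) (at t)"
  proof (rule DERIV_sum)
    fix q assume "q \<in> {1..L}"
    then have "(frac_int (\<mu> - 1 + 1) (mode_source \<Omega> T m \<phi> g q) has_real_derivative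
        frac_int (\<mu> - 1) (mode_source \<Omega> T m \<phi> g q) t) (at t)"
      using \<mu>1 by (intro frac_int_has_derivative lb) auto
    then show "((\<lambda>s. frac_int \<mu> (mode_source \<Omega> T m \<phi> g q) s * \<phi> q x) has_real_derivative
        frac_int (\<mu> - 1) (mode_source \<Omega> T m \<phi> g q) t * \<phi> q x) (at t)"
      by (intro DERIV_cmult_right) simp
  qed
  then have "((\<lambda>s. \<Sum>q=1..L. frac_int \<mu> (mode_source \<Omega> T m \<phi> g q) s * \<phi> q x) has_real_derivative
      (\<Sum>q=1..L. frac_int (\<mu> - 1) (mode_source \<Omega> T m \<phi> g q) t * \<phi> q x)) (at t within {0..T})"
    by (rule has_field_derivative_at_within)
  then have "((\<lambda>s. proj_source \<Omega> \<phi> L \<mu> m g s x) has_real_derivative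
      (\<Sum>q=1..L. frac_int (\<mu> - 1) (mode_source \<Omega> T m \<phi> g q) t * \<phi> q x)) (at t within {0..T})"
  proof (rule has_field_derivative_transform_within[OF _ zero_less_one])
    fix s assume "s \<in> {0..T}"
    then show "(\<Sum>q=1..L. frac_int \<mu> (mode_source \<Omega> T m \<phi> g q) s * \<phi> q x) = proj_source \<Omega> \<phi> L \<mu> m g s x"
      using \<mu>1 by (intro proj_source_eq[symmetric] lb0) auto
  qed (use t in auto)
  moreover have "at t within {0..T} \<noteq> bot" using t by (simp add: trivial_limit_within)
  ultimately show ?thesis
    unfolding source_F_def \<mu>_def[symmetric]
    by (intro vector_derivative_within) (simp_all add: has_real_derivative_iff_has_vector_derivative)
qed

text \<open>Pairing the model with an eigenfunction replaces the Laplacian by its eigenvalue; the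
  duality definition of the vector-valued fractional integral gives precisely the scalar Caputo
  equation. The spectral projection makes the source zero for \<open>q > L\<close>, which
  \<open>h\<close> records.\<close>

lemma truncated_mode_volterra:
  assumes op: "open \<Omega>" and eig: "dirichlet_eigensystem \<Omega> lam \<phi>" and q: "1 \<le> q"
    and \<alpha>: "0 < \<alpha>" "\<alpha> < 1" and m: "0 < m"
    and lb0: "\<forall>q\<ge>1. loc_bounded (mode_source \<Omega> T m \<phi> g q)"
    and v: "truncated_solution \<Omega> T \<alpha> m L \<phi> g v"
  defines "w \<equiv> \<lambda>s. if s \<in> {0..T} then L2_inner \<Omega> (v s) (\<phi> q) else 0"
    and "h \<equiv> if q \<le> L then mode_source \<Omega> T m \<phi> g q else (\<lambda>_. 0)"
  shows "loc_bounded w" "loc_bounded h"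
    and "t \<in> {0<..T} \<Longrightarrow> w t = frac_int (real (Suc m) * \<alpha>) h t - lam q * frac_int \<alpha> w t"
proof -
  have \<phi>: "\<phi> q \<in> L2_space \<Omega>" by (rule dirichlet_eigensystem_L2[OF eig q])
  have vc: "L2_continuous_on \<Omega> {0..T} v" and v0: "AE x in lebesgue_on \<Omega>. v 0 x = 0"
    and vt: "\<And>t. t \<in> {0<..T} \<Longrightarrow> v t \<in> Sobolev \<Omega> 2 \<inter> Sobolev10 \<Omega>"
    and vG: "\<And>t. t \<in> {0<..T} \<Longrightarrow> \<exists>G. has_L2_caputo \<Omega> T \<alpha> v t G \<and>
           (AE x in lebesgue_on \<Omega>. G x - weak_lap \<Omega> 1 (v t) x = proj_source \<Omega> \<phi> L (real m * \<alpha>) m g t x)"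
    using v by (auto simp: truncated_solution_def)
  have cont: "continuous_on {0..T} (\<lambda>s. L2_inner \<Omega> (v s) (\<phi> q))"
    by (rule continuous_on_L2_inner[OF vc \<phi>])
  show "loc_bounded w" unfolding w_def by (rule continuous_on_loc_bounded[OF cont])
  show h: "loc_bounded h" unfolding h_def using lb0 q loc_bounded_const by auto
  have y0: "L2_inner \<Omega> (v 0) (\<phi> q) = 0"
  proof -
    have "AE x in lebesgue_on \<Omega>. v 0 x * \<phi> q x = 0" using v0 by eventually_elim simp
    then show ?thesis unfolding L2_inner_def by (rule integral_eq_zero_AE)
  qed
  define y' where "y' = (\<lambda>s. L2_inner \<Omega> (L2_tderiv \<Omega> {0<..T} v s) (\<phi> q))"
  assume t: "t \<in> {0<..T}"
  show "w t = frac_int (real (Suc m) * \<alpha>) h t - lam q * frac_int \<alpha> w t"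
  proof -
    have "L2_inner \<Omega> (v t) (\<phi> q) = frac_int (real (Suc m) * \<alpha>) h t
        - lam q * frac_int \<alpha> (\<lambda>s. if s \<in> {0..T} then L2_inner \<Omega> (v s) (\<phi> q) else 0) t"
    proof (rule caputo_imp_volterra[OF \<alpha> m h cont y0 _ _ _ t, of y'])
      fix s assume s: "s \<in> {0<..T}"
      obtain G where G: "has_L2_caputo \<Omega> T \<alpha> v s G"
        and eq: "AE x in lebesgue_on \<Omega>. G x - weak_lap \<Omega> 1 (v s) x = proj_source \<Omega> \<phi> L (real m * \<alpha>) m g s x"
        using vG[OF s] by blast
      have "\<exists>d. has_L2_tderiv \<Omega> {0<..T} v d s"
        using G s by (auto simp: has_L2_caputo_def L2_differentiable_on_def)
      then have "has_L2_tderiv \<Omega> {0<..T} v (L2_tderiv \<Omega> {0<..T} v s) s"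
        unfolding L2_tderiv_def by (rule someI_ex)
      then show "((\<lambda>s. L2_inner \<Omega> (v s) (\<phi> q)) has_real_derivative y' s) (at s within {0<..T})"
        unfolding y'_def by (rule has_derivative_L2_inner[OF _ s \<phi>])
      have GF: "has_L2_frac_int \<Omega> (1 - \<alpha>) (L2_tderiv \<Omega> {0<..T} v) s G"
        using G by (simp add: has_L2_caputo_def)
      then show "set_integrable lborel {0<..<s} (\<lambda>u. frac_kernel (1 - \<alpha>) (s - u) * y' u)"
        using \<phi> by (auto simp: has_L2_frac_int_def y'_def)
      have Gy: "L2_inner \<Omega> G (\<phi> q) = frac_int (1 - \<alpha>) y' s" and G2: "G \<in> L2_space \<Omega>"
        using GF \<phi> by (auto simp: has_L2_frac_int_def y'_def)
      define c where "c = (\<lambda>p. frac_int (real m * \<alpha>) (mode_source \<Omega> T m \<phi> g p) s)"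
      have src: "proj_source \<Omega> \<phi> L (real m * \<alpha>) m g s x = (\<Sum>p=1..L. c p * \<phi> p x)" for x
        unfolding c_def using s \<alpha> m by (intro proj_source_eq lb0) auto
      have wl: "weak_lap \<Omega> 1 (v s) \<in> L2_space \<Omega>" using vt[OF s] by (intro weak_lap_L2[OF op]) auto
      have "L2_inner \<Omega> (\<lambda>x. G x - weak_lap \<Omega> 1 (v s) x) (\<phi> q) = L2_inner \<Omega> (\<lambda>x. \<Sum>p=1..L. c p * \<phi> p x) (\<phi> q)"
        by (rule L2_inner_cong_AE[OF L2_space_diff[OF G2 wl] eigen_sum_L2(1)[OF eig] \<phi>]) (use eq in \<open>simp add: src\<close>)
      also have "\<dots> = (if q \<le> L then c q else 0)" by (rule eigen_sum_L2(2)[OF eig q])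
      also have "\<dots> = frac_int (real m * \<alpha>) h s" by (simp add: c_def h_def frac_int_def)
      finally show "frac_int (1 - \<alpha>) y' s + lam q * L2_inner \<Omega> (v s) (\<phi> q) = frac_int (real m * \<alpha>) h s"
        unfolding L2_inner_diff_left[OF G2 wl \<phi>] Gy L2_inner_weak_lap_eigen[OF op eig q vt[OF s]] by simp
    qed
    then show ?thesis using t by (simp add: w_def)
  qed
qed

section \<open>The modal equations of the scheme and the final assembly\<close>

lemma L2_inner_diff_quot:
  assumes "\<And>j. V j \<in> L2_space \<Omega>" "\<phi> \<in> L2_space \<Omega>"
  shows "(\<lambda>x. diff_quot t (\<lambda>j. V j x) k) \<in> L2_space \<Omega>"
    and "L2_inner \<Omega> (\<lambda>x. diff_quot t (\<lambda>j. V j x) k) \<phi> = diff_quot t (\<lambda>j. L2_inner \<Omega> (V j) \<phi>) k"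
proof -
  have eq: "(\<lambda>x. diff_quot t (\<lambda>j. V j x) k) = (\<lambda>x. (1 / step t k) * (V k x - V (k - 1) x))"
    by (simp add: diff_quot_def)
  show "(\<lambda>x. diff_quot t (\<lambda>j. V j x) k) \<in> L2_space \<Omega>"
    unfolding eq using assms by (intro L2_space_cmult L2_space_diff)
  show "L2_inner \<Omega> (\<lambda>x. diff_quot t (\<lambda>j. V j x) k) \<phi> = diff_quot t (\<lambda>j. L2_inner \<Omega> (V j) \<phi>) k"
    unfolding eq L2_inner_cmult_left L2_inner_diff_left[OF assms(1,1,2)] by (simp add: diff_quot_def)
qed

lemma L2_inner_bdf3:
  assumes V: "\<And>j. V j \<in> L2_space \<Omega>" and \<phi>: "\<phi> \<in> L2_space \<Omega>"
  shows "(\<lambda>x. bdf3 t (\<lambda>j. V j x) k) \<in> L2_space \<Omega>"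
    and "L2_inner \<Omega> (\<lambda>x. bdf3 t (\<lambda>j. V j x) k) \<phi> = bdf3 t (\<lambda>j. L2_inner \<Omega> (V j) \<phi>) k"
proof -
  note d = L2_inner_diff_quot(1)[of V \<Omega> \<phi> t, OF V \<phi>]
  have c: "(\<lambda>x. a * diff_quot t (\<lambda>j. V j x) i) \<in> L2_space \<Omega>" for a i by (rule L2_space_cmult[OF d])
  have c2: "(\<lambda>x. a * diff_quot t (\<lambda>j. V j x) i + b * diff_quot t (\<lambda>j. V j x) j) \<in> L2_space \<Omega>" for a i b j
    by (rule L2_space_add[OF c c])
  show "(\<lambda>x. bdf3 t (\<lambda>j. V j x) k) \<in> L2_space \<Omega>"
    unfolding bdf3_def by (rule L2_space_add[OF c2 c])
  show "L2_inner \<Omega> (\<lambda>x. bdf3 t (\<lambda>j. V j x) k) \<phi> = bdf3 t (\<lambda>j. L2_inner \<Omega> (V j) \<phi>) k"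
    unfolding bdf3_def L2_inner_add_left[OF c2 c \<phi>] L2_inner_add_left[OF c c \<phi>] L2_inner_cmult_left
      L2_inner_diff_quot(2)[of V \<Omega> \<phi> t, OF V \<phi>] ..
qed

text \<open>All operators in time are finite linear combinations with weights independent of
  \<open>x\<close>, so pairing with an eigenfunction passes through them and yields the scalar
  scheme with parameter \<open>lam q\<close>.\<close>

lemma scheme_mode:
  assumes op: "open \<Omega>" and eig: "dirichlet_eigensystem \<Omega> lam \<phi>" and q: "1 \<le> q"
    and \<alpha>: "0 < \<alpha>" and \<mu>: "1 < real (m + 1) * \<alpha>"
    and lb0: "\<forall>q\<ge>1. loc_bounded (mode_source \<Omega> T m \<phi> g q)"
    and mesh: "time_mesh T N t" and V: "scheme_V \<Omega> T \<alpha> m L \<phi> g N t V"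
    and k: "1 \<le> k" "k \<le> N"
  defines "h \<equiv> if q \<le> L then mode_source \<Omega> T m \<phi> g q else (\<lambda>_. 0)"
    and "Y \<equiv> \<lambda>j. if j \<in> {1..N} then L2_inner \<Omega> (V j) (\<phi> q) else 0"
  shows "(if k \<le> 2 then diff_quot t Y k else bdf3 t Y k) + lam q * caputo_L2 t (1 - \<alpha>) k Y
    = frac_int (real (m + 1) * \<alpha> - 1) h (t k)"
proof -
  have \<phi>: "\<phi> q \<in> L2_space \<Omega>" by (rule dirichlet_eigensystem_L2[OF eig q])
  \<comment> \<open>\<open>V 0\<close> is zero only almost everywhere, and \<open>V j\<close> is
    unrestricted beyond \<open>N\<close>. Replacing both by the zero function makes every index
    square-integrable and changes the equation only on a null set.\<close>
  define V' where "V' = (\<lambda>j. if j \<in> {1..N} then V j else (\<lambda>x. 0))"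
  define W where "W = (\<lambda>j. if j \<in> {1..N} then weak_lap \<Omega> 1 (V j) else (\<lambda>x. 0))"
  have V0: "AE x in lebesgue_on \<Omega>. V 0 x = 0" and Vk: "\<And>k. k \<in> {1..N} \<Longrightarrow> V k \<in> Sobolev \<Omega> 2 \<inter> Sobolev10 \<Omega>"
    using V by (auto simp: scheme_V_def)
  have V'2: "V' j \<in> L2_space \<Omega>" for j
    using Vk[of j] L2_space_zero by (auto simp: V'_def Sobolev_def)
  have W2: "W j \<in> L2_space \<Omega>" for j
    using Vk[of j] L2_space_zero weak_lap_L2[OF op] by (auto simp: W_def)
  have Y: "(\<lambda>j. L2_inner \<Omega> (V' j) (\<phi> q)) = Y"
    by (auto simp: Y_def V'_def L2_inner_def)
  have WY: "L2_inner \<Omega> (W j) (\<phi> q) = - lam q * Y j" for j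
    using L2_inner_weak_lap_eigen[OF op eig q Vk[of j]] by (auto simp: W_def Y_def L2_inner_def)
  define \<delta> where "\<delta> = (\<lambda>w. if k \<le> 2 then diff_quot t w k else bdf3 t w k)"
  define a where "a = (\<lambda>i. caputo_L2 t (1 - \<alpha>) k (\<lambda>j. if j = i then 1 else 0))"
  have cap: "caputo_L2 t (1 - \<alpha>) k w = (\<Sum>i\<le>k. w i * a i)" for w
    unfolding a_def by (rule caputo_L2_eq_coeff_sum[OF mesh k \<alpha>])
  have \<delta>_cong: "\<delta> u = \<delta> w" if "\<And>j. j \<le> k \<Longrightarrow> u j = w j" for u w
    using that[of k] that[of "k - 1"] that[of "k - 2"] that[of "k - 3"] that[of "k - 1 - 1"] that[of "k - 2 - 1"]
    by (simp add: \<delta>_def bdf3_def diff_quot_def)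
  define c where "c = (\<lambda>p. frac_int (real (m + 1) * \<alpha> - 1) (mode_source \<Omega> T m \<phi> g p) (t k))"
  have tk: "t k \<in> {0<..T}" using mesh_less[OF mesh, of 0 k] mesh_range[OF mesh, of k] k mesh by (auto simp: time_mesh_def)
  have src: "source_F \<Omega> T \<alpha> m L \<phi> g (t k) x = (\<Sum>p=1..L. c p * \<phi> p x)" for x
    unfolding c_def by (rule source_F_eq[OF tk \<mu> lb0])
  have eq: "AE x in lebesgue_on \<Omega>. \<delta> (\<lambda>j. V j x) - caputo_L2 t (1 - \<alpha>) k (\<lambda>j. weak_lap \<Omega> 1 (V j) x)
           = (\<Sum>p=1..L. c p * \<phi> p x)"
    using V k unfolding scheme_V_def \<delta>_def src[symmetric] by simp
  have L0: "AE x in lebesgue_on \<Omega>. weak_lap \<Omega> 1 (V 0) x = 0" by (rule weak_lap_AE_zero[OF op eig V0])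
  have eq': "AE x in lebesgue_on \<Omega>. \<delta> (\<lambda>j. V' j x) - (\<Sum>i\<le>k. a i * W i x) = (\<Sum>p=1..L. c p * \<phi> p x)"
    using eq V0 L0
  proof eventually_elim
    case (elim x)
    have "\<delta> (\<lambda>j. V j x) = \<delta> (\<lambda>j. V' j x)"
      by (rule \<delta>_cong) (use k elim in \<open>auto simp: V'_def Suc_le_eq\<close>)
    moreover have "caputo_L2 t (1 - \<alpha>) k (\<lambda>j. weak_lap \<Omega> 1 (V j) x) = (\<Sum>i\<le>k. a i * W i x)"
      unfolding cap by (intro sum.cong) (use k elim in \<open>auto simp: W_def Suc_le_eq\<close>)
    ultimately show ?case using elim by simp
  qed
  have d1: "(\<lambda>x. \<delta> (\<lambda>j. V' j x)) \<in> L2_space \<Omega>"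
    using L2_inner_diff_quot(1)[of V' \<Omega> "\<phi> q" t k, OF V'2 \<phi>] L2_inner_bdf3(1)[of V' \<Omega> "\<phi> q" t k, OF V'2 \<phi>]
    by (cases "k \<le> 2") (simp_all add: \<delta>_def)
  have d2: "L2_inner \<Omega> (\<lambda>x. \<delta> (\<lambda>j. V' j x)) (\<phi> q) = \<delta> Y"
    using L2_inner_diff_quot(2)[of V' \<Omega> "\<phi> q" t k, OF V'2 \<phi>] L2_inner_bdf3(2)[of V' \<Omega> "\<phi> q" t k, OF V'2 \<phi>]
    unfolding Y by (cases "k \<le> 2") (simp_all add: \<delta>_def)
  have w1: "(\<lambda>x. \<Sum>i\<le>k. a i * W i x) \<in> L2_space \<Omega>" by (intro L2_space_sum L2_space_cmult W2)
  have w2: "L2_inner \<Omega> (\<lambda>x. \<Sum>i\<le>k. a i * W i x) (\<phi> q) = - lam q * caputo_L2 t (1 - \<alpha>) k Y"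
  proof -
    have "L2_inner \<Omega> (\<lambda>x. \<Sum>i\<le>k. a i * W i x) (\<phi> q) = (\<Sum>i\<le>k. L2_inner \<Omega> (\<lambda>x. a i * W i x) (\<phi> q))"
      by (rule L2_inner_sum_left[OF L2_space_cmult[OF W2] \<phi>])
    also have "\<dots> = (\<Sum>i\<le>k. - lam q * (Y i * a i))" by (simp add: L2_inner_cmult_left WY mult_ac)
    finally show ?thesis unfolding cap by (simp only: sum_distrib_left)
  qed
  have "\<delta> Y + lam q * caputo_L2 t (1 - \<alpha>) k Y
      = L2_inner \<Omega> (\<lambda>x. \<delta> (\<lambda>j. V' j x) - (\<Sum>i\<le>k. a i * W i x)) (\<phi> q)"
    unfolding L2_inner_diff_left[OF d1 w1 \<phi>] d2 w2 by simp
  also have "\<dots> = L2_inner \<Omega> (\<lambda>x. \<Sum>p=1..L. c p * \<phi> p x) (\<phi> q)"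
    by (rule L2_inner_cong_AE[OF L2_space_diff[OF d1 w1] eigen_sum_L2(1)[OF eig] \<phi> eq'])
  also have "\<dots> = (if q \<le> L then c q else 0)" by (rule eigen_sum_L2(2)[OF eig q])
  also have "\<dots> = frac_int (real (m + 1) * \<alpha> - 1) h (t k)" by (simp add: c_def h_def frac_int_def)
  finally show ?thesis by (simp add: \<delta>_def)
qed


text \<open>The regular solution of the Volterra equation is fed into the scalar convergence result.
  The constant depends on the mode, through its eigenvalue and its regularity, but is chosen before
  mesh and discrete solution.\<close>

lemma mode_convergence:
  assumes op: "open \<Omega>" and eig: "dirichlet_eigensystem \<Omega> lam \<phi>" and q: "1 \<le> q"
    and \<alpha>: "0 < \<alpha>" "\<alpha> < 1" and T: "0 < T" and m: "3 \<le> real m * \<alpha>"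
    and lb0: "\<forall>q\<ge>1. loc_bounded (mode_source \<Omega> T m \<phi> g q)"
    and v: "truncated_solution \<Omega> T \<alpha> m L \<phi> g v"
  shows "\<exists>Q\<ge>0. \<forall>N t V. time_mesh T N t \<longrightarrow> (\<forall>k\<in>{2..N}. ratio t k \<in> {1..1.7319}) \<longrightarrow>
      scheme_V \<Omega> T \<alpha> m L \<phi> g N t V \<longrightarrow>
      (\<forall>n\<in>{1..N}. \<bar>L2_inner \<Omega> (v (t n)) (\<phi> q) - L2_inner \<Omega> (V n) (\<phi> q)\<bar> \<le> Q * step t n powr (2 + \<alpha>))"
proof -
  define w where "w = (\<lambda>s. if s \<in> {0..T} then L2_inner \<Omega> (v s) (\<phi> q) else 0)"
  define h where "h = (if q \<le> L then mode_source \<Omega> T m \<phi> g q else (\<lambda>_. 0))"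
  define \<mu> where "\<mu> = real (Suc m) * \<alpha>"
  have \<mu>: "3 + \<alpha> \<le> \<mu>" using m by (simp add: \<mu>_def algebra_simps)
  have m0: "0 < m" using m by (cases m) auto
  note vol = truncated_mode_volterra[OF op eig q \<alpha> m0 lb0 v, folded w_def h_def, folded \<mu>_def]
  have "\<forall>t\<in>{0<..T}. w t = frac_int \<mu> h t - lam q * frac_int \<alpha> w t"
  proof
    fix t assume that: "t \<in> {0<..T}"
    have "w t = L2_inner \<Omega> (v t) (\<phi> q)" using that by (simp add: w_def)
    then show "w t = frac_int \<mu> h t - lam q * frac_int \<alpha> w t" using vol(3)[of t] that by simp
  qed
  from volterra_smooth[OF \<alpha> T vol(2,1) \<mu>_def \<mu> this]
  obtain y y1 y2 y3 C where wy: "\<forall>t\<in>{0<..T}. w t = y t"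
    and y: "y 0 = 0" "y1 0 = 0" "y2 0 = 0" "y3 0 = 0"
      "\<forall>t. (y has_real_derivative y1 t) (at t)" "\<forall>t. (y1 has_real_derivative y2 t) (at t)"
      "\<forall>t. (y2 has_real_derivative y3 t) (at t)"
      "\<forall>a b. a \<le> b \<longrightarrow> b \<le> T \<longrightarrow> \<bar>y3 b - y3 a\<bar> \<le> C * (b - a) powr \<alpha>" "0 \<le> C"
    and src: "\<forall>t\<in>{0<..T}. frac_int (\<mu> - 1) h t = y1 t + lam q * frac_int \<alpha> y1 t"
    by (elim exE conjE)
  obtain Q where Q: "0 \<le> Q" and conv: "\<forall>N t Y. time_mesh T N t \<longrightarrow> (\<forall>k\<in>{2..N}. ratio t k \<in> {1..1.7319}) \<longrightarrow> Y 0 = 0 \<longrightarrow>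
      (\<forall>k\<in>{1..N}. (if k \<le> 2 then diff_quot t Y k else bdf3 t Y k) + lam q * caputo_L2 t (1 - \<alpha>) k Y
          = y1 (t k) + lam q * frac_int \<alpha> y1 (t k)) \<longrightarrow>
      (\<forall>n\<in>{1..N}. \<bar>y (t n) - Y n\<bar> \<le> Q * step t n powr (2 + \<alpha>))"
    using scalar_convergence[OF \<alpha>(1) less_imp_le[OF \<alpha>(2)] dirichlet_eigenvalue_nonneg[OF op eig q] T
        y(5,6,7)[rule_format] y(1,2,3,4) y(8) y(9)] by (elim exE conjE)
  show ?thesis
  proof (intro exI[of _ Q] conjI allI impI ballI Q)
    fix N t V n
    assume mesh: "time_mesh T N t" and rt: "\<forall>k\<in>{2..N}. ratio t k \<in> {1..1.7319}"
      and V: "scheme_V \<Omega> T \<alpha> m L \<phi> g N t V" and n: "n \<in> {1..N}"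
    define Y where "Y = (\<lambda>j. if j \<in> {1..N} then L2_inner \<Omega> (V j) (\<phi> q) else 0)"
    have tk: "t k \<in> {0<..T}" if "k \<in> {1..N}" for k
      using mesh_less[OF mesh, of 0 k] mesh_range[OF mesh, of k] that mesh by (auto simp: time_mesh_def)
    have \<mu>1: "1 < real (m + 1) * \<alpha>" using \<mu> \<alpha> by (simp add: \<mu>_def)
    have sch: "\<forall>k\<in>{1..N}. (if k \<le> 2 then diff_quot t Y k else bdf3 t Y k) + lam q * caputo_L2 t (1 - \<alpha>) k Y
          = y1 (t k) + lam q * frac_int \<alpha> y1 (t k)"
    proof
      fix k assume k: "k \<in> {1..N}"
      then have "(if k \<le> 2 then diff_quot t Y k else bdf3 t Y k) + lam q * caputo_L2 t (1 - \<alpha>) k Y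
          = frac_int (\<mu> - 1) h (t k)"
        using scheme_mode[OF op eig q \<alpha>(1) \<mu>1 lb0 mesh V, of k, folded Y_def h_def] by (simp add: \<mu>_def)
      then show "(if k \<le> 2 then diff_quot t Y k else bdf3 t Y k) + lam q * caputo_L2 t (1 - \<alpha>) k Y
          = y1 (t k) + lam q * frac_int \<alpha> y1 (t k)" using src tk[OF k] by simp
    qed
    have Y0: "Y 0 = 0" by (simp add: Y_def)
    have "\<bar>y (t n) - Y n\<bar> \<le> Q * step t n powr (2 + \<alpha>)"
      by (rule bspec[OF mp[OF mp[OF mp[OF mp[OF spec[OF spec[OF spec[OF conv, of N], of t], of Y] mesh] rt] Y0] sch] n])
    moreover have "y (t n) = L2_inner \<Omega> (v (t n)) (\<phi> q)" using wy tk[OF n] by (auto simp: w_def)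
    ultimately show "\<bar>L2_inner \<Omega> (v (t n)) (\<phi> q) - L2_inner \<Omega> (V n) (\<phi> q)\<bar> \<le> Q * step t n powr (2 + \<alpha>)"
      using n by (simp add: Y_def)
  qed
qed

lemma sum_squares_le_square_sum:
  fixes f :: "'b \<Rightarrow> real"
  assumes "\<And>i. i \<in> I \<Longrightarrow> 0 \<le> f i"
  shows "(\<Sum>i\<in>I. (f i)\<^sup>2) \<le> (\<Sum>i\<in>I. f i)\<^sup>2"
  using assms
proof (induction I rule: infinite_finite_induct)
  case (insert i I)
  have "0 \<le> f i * (\<Sum>i\<in>I. f i)" using insert by (intro mult_nonneg_nonneg sum_nonneg) auto
  then show ?case using insert by (simp add: power2_sum)
qed auto

text \<open>Above the truncation level both equations are homogeneous with zero initial value. The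
  continuous one has only the zero solution by the contraction argument; the discrete one by the
  stability estimate with \<open>\<rho> = 0\<close>, which kills all difference quotients.\<close>

lemma mode_zero_above_truncation:
  assumes op: "open \<Omega>" and eig: "dirichlet_eigensystem \<Omega> lam \<phi>" and q: "1 \<le> q" "L < q"
    and \<alpha>: "0 < \<alpha>" "\<alpha> < 1" and T: "0 < T" and m: "3 \<le> real m * \<alpha>"
    and lb0: "\<forall>q\<ge>1. loc_bounded (mode_source \<Omega> T m \<phi> g q)"
    and v: "truncated_solution \<Omega> T \<alpha> m L \<phi> g v"
    and mesh: "time_mesh T N t" and rt: "\<forall>k\<in>{2..N}. ratio t k \<in> {1..1.7319}"
    and V: "scheme_V \<Omega> T \<alpha> m L \<phi> g N t V" and n: "n \<in> {1..N}"
  shows "L2_inner \<Omega> (v (t n)) (\<phi> q) = 0" "L2_inner \<Omega> (V n) (\<phi> q) = 0"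
proof -
  have m0: "0 < m" using m by (cases m) auto
  have zero: "frac_int \<nu> (\<lambda>_. 0) s = 0" for \<nu> s by (simp add: frac_int_def)
  have tn: "t n \<in> {0<..T}"
    using mesh_less[OF mesh, of 0 n] mesh_range[OF mesh, of n] n mesh by (auto simp: time_mesh_def)
  define w where "w = (\<lambda>s. if s \<in> {0..T} then L2_inner \<Omega> (v s) (\<phi> q) else 0)"
  note vol = truncated_mode_volterra[OF op eig q(1) \<alpha> m0 lb0 v, folded w_def]
  have weq: "w s = - lam q * frac_int \<alpha> w s" if "0 < s" "s \<le> T" for s
  proof -
    have "w s = L2_inner \<Omega> (v s) (\<phi> q)" using that by (simp add: w_def)
    then show ?thesis using vol(3)[of s] that q zero by simp
  qed
  have "w (t n) = 0"
    by (rule volterra_unique[OF \<alpha>(1) vol(1), of T "lam q"]) (use weq tn in auto)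
  then show "L2_inner \<Omega> (v (t n)) (\<phi> q) = 0" using tn by (simp add: w_def)
  define Y where "Y = (\<lambda>j. if j \<in> {1..N} then L2_inner \<Omega> (V j) (\<phi> q) else 0)"
  have \<mu>1: "1 < real (m + 1) * \<alpha>" using m \<alpha> by (simp add: algebra_simps)
  have sch: "(if k \<le> 2 then diff_quot t Y k else bdf3 t Y k) + lam q * caputo_L2 t (1 - \<alpha>) k Y = 0"
    if "k \<in> {1..N}" for k
    using scheme_mode[OF op eig q(1) \<alpha>(1) \<mu>1 lb0 mesh V, of k, folded Y_def] q that zero by simp
  obtain S where stab: "\<forall>N t w \<rho> n. time_mesh T N t \<longrightarrow>
      (\<forall>k\<in>{2..N}. ratio t k \<in> {1..1.7319}) \<longrightarrow> n \<le> N \<longrightarrow>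
      (\<forall>k\<in>{1..n}. \<bar>(if k \<le> 2 then diff_quot t w k else bdf3 t w k) + lam q * caputo_L2 t (1 - \<alpha>) k w\<bar> \<le> \<rho>) \<longrightarrow>
      (\<forall>k\<in>{1..n}. \<bar>diff_quot t w k\<bar> \<le> S * \<rho>)"
    using bdf3_L2_stability[OF \<alpha>(1) less_imp_le[OF \<alpha>(2)] dirichlet_eigenvalue_nonneg[OF op eig q(1)] T]
    by (elim exE conjE)
  have "\<forall>k\<in>{1..N}. \<bar>(if k \<le> 2 then diff_quot t Y k else bdf3 t Y k) + lam q * caputo_L2 t (1 - \<alpha>) k Y\<bar> \<le> 0"
  proof
    fix k assume "k \<in> {1..N}"
    then show "\<bar>(if k \<le> 2 then diff_quot t Y k else bdf3 t Y k) + lam q * caputo_L2 t (1 - \<alpha>) k Y\<bar> \<le> 0"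
      by (simp only: sch abs_zero order_refl)
  qed
  then have "\<forall>k\<in>{1..N}. \<bar>diff_quot t Y k\<bar> \<le> S * 0"
    by (rule mp[OF mp[OF mp[OF mp[OF spec[OF spec[OF spec[OF spec[OF spec[OF stab, of N], of t], of Y], of 0], of N] mesh] rt] order_refl]])
  then have d: "diff_quot t Y k = 0" if "k \<in> {1..N}" for k using that by fastforce
  have "Y k = 0" if "k \<le> N" for k
    using that
  proof (induction k)
    case (Suc k)
    have "0 < step t (Suc k)" using Suc.prems by (intro step_pos[OF mesh]) auto
    then show ?case using d[of "Suc k"] Suc by (simp add: diff_quot_def)
  qed (simp add: Y_def)
  then have "Y n = 0" using n by simp
  then show "L2_inner \<Omega> (V n) (\<phi> q) = 0" using n by (simp add: Y_def)
qed

text \<open>\<open>U\<close> and \<open>u_hat\<close> contain the same initial value and correction,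
  so their difference agrees almost everywhere with that of \<open>V\<close> and \<open>v\<close>.
  The latter has only the first \<open>L\<close> modes, whose finitely many constants are
  added.\<close>

theorem theorem4p3:
  fixes \<Omega> :: "'a::euclidean_space set"
    and u0 :: "'a \<Rightarrow> real"
    and f v :: "real \<Rightarrow> 'a \<Rightarrow> real"
    and lam :: "nat \<Rightarrow> real"
    and \<phi> :: "nat \<Rightarrow> 'a \<Rightarrow> real"
    and \<alpha> T \<gamma> \<sigma> :: real
    and m L :: nat
  assumes dim: "DIM('a) \<le> 3"
    and domain: "open \<Omega>" "bounded \<Omega>" "smooth_boundary \<Omega>"
    and params: "0 < \<alpha>" "\<alpha> < 1" "0 < T" "1 \<le> m" "1 \<le> L"
    and eigen: "dirichlet_eigensystem \<Omega> lam \<phi>"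
    and u0: "lap_in_L2 \<Omega> 1 u0" "lap_in_L2 \<Omega> (m + 2) u0"
    and gamma: "0 < \<gamma>" "\<gamma> < 1 / 2"
    and f_space: "continuous_into_frac_Sobolev \<Omega> {0..T} (2 * m) \<gamma> (f_tilde \<Omega> u0 f)"
    and sigma: "0 < \<sigma>" "\<sigma> < 1"
    and f_time: "\<forall>j<4. L2_differentiable_on \<Omega> {0<..T} ((L2_tderiv \<Omega> {0<..T} ^^ j) f)"
    and f_bound3: "\<exists>Q>0. \<forall>t\<in>{0<..T}.
        lap_in_L2 \<Omega> (m + 1) ((L2_tderiv \<Omega> {0<..T} ^^ 3) f t) \<and>
        L2_norm \<Omega> (weak_lap \<Omega> (m + 1) ((L2_tderiv \<Omega> {0<..T} ^^ 3) f t)) \<le> Q * t powr (- \<sigma>)"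
    and f_bound4: "\<exists>Q>0. \<forall>t\<in>{0<..T}.
        lap_in_L2 \<Omega> m ((L2_tderiv \<Omega> {0<..T} ^^ 4) f t) \<and>
        L2_norm \<Omega> (weak_lap \<Omega> m ((L2_tderiv \<Omega> {0<..T} ^^ 4) f t)) \<le> Q * t powr (- \<sigma>)"
    and m_large: "real m \<ge> 3 / \<alpha>"
    and v: "truncated_solution \<Omega> T \<alpha> m L \<phi> (f_tilde \<Omega> u0 f) v"
  shows "\<exists>Q>0. \<forall>N t V U.
      time_mesh T N t \<and>
      (\<forall>k\<in>{2..N}. ratio t k \<in> {1..1.7319}) \<and>
      scheme_V \<Omega> T \<alpha> m L \<phi> (f_tilde \<Omega> u0 f) N t V \<and>
      scheme_U \<Omega> \<alpha> m L \<phi> (f_tilde \<Omega> u0 f) u0 N t V U \<longrightarrow>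
      (\<forall>n\<in>{1..N}.
         L2_norm \<Omega> (\<lambda>x. u_hat \<Omega> \<alpha> m L \<phi> (f_tilde \<Omega> u0 f) u0 v (t n) x - U n x)
           \<le> L2_norm \<Omega> (\<lambda>x. v (t n) x - V n x) \<and>
         L2_norm \<Omega> (\<lambda>x. v (t n) x - V n x) \<le> Q * step t n powr (2 + \<alpha>))"
proof -
  define g where "g = f_tilde \<Omega> u0 f"
  note op = domain(1)
  have m3: "3 \<le> real m * \<alpha>" using m_large unfolding pos_divide_le_eq[OF params(1)] .
  have lb0: "\<forall>q\<ge>1. loc_bounded (mode_source \<Omega> T m \<phi> g q)"
    unfolding g_def by (intro allI impI loc_bounded_mode_source[OF op eigen _ f_space])
  note v = v[folded g_def]
  \<comment> \<open>The condition on \<open>q\<close> is placed inside the existential, so that the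
    choice principle can be applied over all natural numbers.\<close>
  have "\<exists>Q. 1 \<le> q \<longrightarrow> 0 \<le> Q \<and> (\<forall>N t V. time_mesh T N t \<longrightarrow> (\<forall>k\<in>{2..N}. ratio t k \<in> {1..1.7319}) \<longrightarrow>
      scheme_V \<Omega> T \<alpha> m L \<phi> g N t V \<longrightarrow>
      (\<forall>n\<in>{1..N}. \<bar>L2_inner \<Omega> (v (t n)) (\<phi> q) - L2_inner \<Omega> (V n) (\<phi> q)\<bar> \<le> Q * step t n powr (2 + \<alpha>)))" for q
  proof (cases "1 \<le> q")
    case True
    show ?thesis
      using mode_convergence[OF op eigen True params(1-3) m3 lb0 v] by (elim exE) (rule exI, rule impI)
  qed simp
  then have "\<forall>q. \<exists>Q. 1 \<le> q \<longrightarrow> 0 \<le> Q \<and> (\<forall>N t V. time_mesh T N t \<longrightarrow> (\<forall>k\<in>{2..N}. ratio t k \<in> {1..1.7319}) \<longrightarrow>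
      scheme_V \<Omega> T \<alpha> m L \<phi> g N t V \<longrightarrow>
      (\<forall>n\<in>{1..N}. \<bar>L2_inner \<Omega> (v (t n)) (\<phi> q) - L2_inner \<Omega> (V n) (\<phi> q)\<bar> \<le> Q * step t n powr (2 + \<alpha>)))" by (rule allI)
  then obtain Q where Q: "\<forall>q. 1 \<le> q \<longrightarrow> 0 \<le> Q q \<and> (\<forall>N t V. time_mesh T N t \<longrightarrow> (\<forall>k\<in>{2..N}. ratio t k \<in> {1..1.7319}) \<longrightarrow>
      scheme_V \<Omega> T \<alpha> m L \<phi> g N t V \<longrightarrow>
      (\<forall>n\<in>{1..N}. \<bar>L2_inner \<Omega> (v (t n)) (\<phi> q) - L2_inner \<Omega> (V n) (\<phi> q)\<bar> \<le> Q q * step t n powr (2 + \<alpha>)))"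
    by (elim choice[THEN exE])
  \<comment> \<open>The summand 1 makes the constant strictly positive even if all modal constants
    vanish.\<close>
  define B where "B = (\<Sum>q=1..L. Q q) + 1"
  have Q0: "0 \<le> Q q" if "1 \<le> q" for q by (rule conjunct1[OF mp[OF spec[OF Q, of q] that]])
  then have sum0: "0 \<le> (\<Sum>q=1..L. Q q)" by (intro sum_nonneg) simp
  show ?thesis
  proof (intro exI[of _ B] conjI allI impI ballI)
    show "0 < B" using sum0 by (simp add: B_def)
    fix N t V U n
    assume A: "time_mesh T N t \<and> (\<forall>k\<in>{2..N}. ratio t k \<in> {1..1.7319}) \<and>
      scheme_V \<Omega> T \<alpha> m L \<phi> (f_tilde \<Omega> u0 f) N t V \<and> scheme_U \<Omega> \<alpha> m L \<phi> (f_tilde \<Omega> u0 f) u0 N t V U"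
      and n: "n \<in> {1..N}"
    have mesh: "time_mesh T N t" and rt: "\<forall>k\<in>{2..N}. ratio t k \<in> {1..1.7319}"
      and V: "scheme_V \<Omega> T \<alpha> m L \<phi> g N t V" and U: "scheme_U \<Omega> \<alpha> m L \<phi> g u0 N t V U"
      by (rule conjunct1[OF A], rule conjunct1[OF conjunct2[OF A]],
        unfold g_def, rule conjunct1[OF conjunct2[OF conjunct2[OF A]]], rule conjunct2[OF conjunct2[OF conjunct2[OF A]]])
    have tn: "t n \<in> {0<..T}"
      using mesh_less[OF mesh, of 0 n] mesh_range[OF mesh, of n] n mesh by (auto simp: time_mesh_def)
    have v2: "v (t n) \<in> L2_space \<Omega>"     proof -
      have "v (t n) \<in> Sobolev \<Omega> 2" using v tn unfolding truncated_solution_def by blast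
      then show ?thesis by (simp add: Sobolev_def)
    qed
    have V2: "V n \<in> L2_space \<Omega>"
    proof -
      have "V n \<in> Sobolev \<Omega> 2" using V n unfolding scheme_V_def by blast
      then show ?thesis by (simp add: Sobolev_def)
    qed
    define e where "e = (\<lambda>x. v (t n) x - V n x)"
    have e2: "e \<in> L2_space \<Omega>" unfolding e_def by (rule L2_space_diff[OF v2 V2])
    have eq: "L2_inner \<Omega> e (\<phi> q) = L2_inner \<Omega> (v (t n)) (\<phi> q) - L2_inner \<Omega> (V n) (\<phi> q)" if "1 \<le> q" for q
      unfolding e_def by (rule L2_inner_diff_left[OF v2 V2 dirichlet_eigensystem_L2[OF eigen that]])
    show "L2_norm \<Omega> (\<lambda>x. v (t n) x - V n x) \<le> B * step t n powr (2 + \<alpha>)"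
    proof -
      define s where "s = step t n powr (2 + \<alpha>)"
      have s: "0 \<le> s" by (simp add: s_def)
      have "(L2_norm \<Omega> e)\<^sup>2 = (\<Sum>q=1..L. (L2_inner \<Omega> e (\<phi> q))\<^sup>2)"
      proof (rule L2_norm_finite_expansion[OF eigen e2])
        fix q assume "L < q"
        then have "1 \<le> q" by simp
        then show "L2_inner \<Omega> e (\<phi> q) = 0"
          using mode_zero_above_truncation[OF op eigen _ \<open>L < q\<close> params(1-3) m3 lb0 v mesh rt V n] eq by simp
      qed
      also have "\<dots> \<le> (\<Sum>q=1..L. (Q q * s)\<^sup>2)"
      proof (rule sum_mono)
        fix q assume "q \<in> {1..L}"
        then have q: "1 \<le> q" by simp
        have "\<bar>L2_inner \<Omega> e (\<phi> q)\<bar> \<le> Q q * s"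
        proof -
          have Qq: "\<forall>N t V. time_mesh T N t \<longrightarrow> (\<forall>k\<in>{2..N}. ratio t k \<in> {1..1.7319}) \<longrightarrow>
            scheme_V \<Omega> T \<alpha> m L \<phi> g N t V \<longrightarrow>
            (\<forall>n\<in>{1..N}. \<bar>L2_inner \<Omega> (v (t n)) (\<phi> q) - L2_inner \<Omega> (V n) (\<phi> q)\<bar> \<le> Q q * step t n powr (2 + \<alpha>))"
            by (rule conjunct2[OF mp[OF spec[OF Q, of q] q]])
          show ?thesis unfolding eq[OF q] s_def
            by (rule bspec[OF mp[OF mp[OF mp[OF spec[OF spec[OF spec[OF Qq, of N], of t], of V] mesh] rt] V] n])
        qed
        then have "\<bar>L2_inner \<Omega> e (\<phi> q)\<bar>\<^sup>2 \<le> (Q q * s)\<^sup>2" by (intro power_mono) auto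
        then show "(L2_inner \<Omega> e (\<phi> q))\<^sup>2 \<le> (Q q * s)\<^sup>2" by simp
      qed
      also have "\<dots> \<le> (\<Sum>q=1..L. Q q * s)\<^sup>2"
      proof -
        have "0 \<le> Q q * s" if "q \<in> {1..L}" for q using Q0[of q] s that by simp
        then have "(\<Sum>q\<in>{1..L}. (Q q * s)\<^sup>2) \<le> (\<Sum>q\<in>{1..L}. Q q * s)\<^sup>2"
          by (rule sum_squares_le_square_sum)
        then show ?thesis .
      qed
      also have "\<dots> \<le> (B * s)\<^sup>2"
        unfolding sum_distrib_right[symmetric] B_def
        by (intro power_mono mult_right_mono mult_nonneg_nonneg sum0 s) simp
      finally have "(L2_norm \<Omega> e)\<^sup>2 \<le> (B * s)\<^sup>2" .
      moreover have "0 \<le> B * s" unfolding B_def by (intro mult_nonneg_nonneg add_nonneg_nonneg sum0 s) simp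
      ultimately have "L2_norm \<Omega> e \<le> B * s" by (rule power2_le_imp_le)
      then show ?thesis unfolding e_def s_def .
    qed
    define d where "d = (\<lambda>x. u_hat \<Omega> \<alpha> m L \<phi> (f_tilde \<Omega> u0 f) u0 v (t n) x - U n x)"
    have "AE x in lebesgue_on \<Omega>. U n x = V n x + u0 x + correction \<Omega> \<alpha> m L \<phi> g (t n) x"
      using U n unfolding scheme_U_def by blast
    then have ae: "AE x in lebesgue_on \<Omega>. d x * d x = e x * e x"
    proof eventually_elim
      case (elim x)
      have "d x = e x" unfolding d_def e_def u_hat_def elim g_def by simp
      then show ?case by simp
    qed
    \<comment> \<open>Measurability of \<open>U n\<close> is not recorded in the scheme. If the
      square of \<open>d\<close> is integrable, both sides are equal; otherwise its integral is 0 by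
      convention, and the inequality still holds.\<close>
    have "L2_inner \<Omega> d d \<le> L2_inner \<Omega> e e"
    proof (cases "integrable (lebesgue_on \<Omega>) (\<lambda>x. d x * d x)")
      case True
      then have "L2_inner \<Omega> d d = L2_inner \<Omega> e e"
        unfolding L2_inner_def using ae L2_integrable_mult[OF e2 e2] by (intro integral_cong_AE) auto
      then show ?thesis by simp
    next
      case False
      then show ?thesis
        using L2_inner_self_nonneg[of \<Omega> e] by (simp add: L2_inner_def[of \<Omega> d] not_integrable_integral_eq)
    qed
    then show "L2_norm \<Omega> (\<lambda>x. u_hat \<Omega> \<alpha> m L \<phi> (f_tilde \<Omega> u0 f) u0 v (t n) x - U n x)
        \<le> L2_norm \<Omega> (\<lambda>x. v (t n) x - V n x)"
      unfolding L2_norm_def d_def[symmetric] e_def[symmetric] by (rule real_sqrt_le_mono)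
  qed
qed

end
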